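(* Let $n\geq3$, let $u\in H$ be deterministic, and set $$F=\left(\sum_{k=1}^n\lambda_k^{-2}X(h_k)^2\right)^{(2-n)/2},\qquad \Pi_nX(t)=\sum_{k=1}^n\lambda_k^{-2}X(h_k)\,\Gamma h_k(t),\quad t\in[0,T].$$ Then $$D_t\log F=-(n-2)\frac{\Pi_nX(t)}{\|\Pi_nX\|^2_{L^2([0,T],dt)}},\qquad t\in[0,T],$$ and $$\mathbb{E}_u\left[\|X+D\log F-u\|^2_{L^2([0,T],dt)}\right]=\int_0^T\gamma(t,t)\,dt-(n-2)^2\,\mathbb{E}_u\left[\|\Pi_nX\|^{-2}_{L^2([0,T],dt)}\right].$$
   Context: Let $T>0$ and let $(X_t)_{t\in[0,T]}$ be a real centered Gaussian process on $(\Omega,\mathcal F,\mathbb{P})$, $\mathcal F=\sigma(X)$, with covariance $\gamma(s,t)=\mathbb{E}[X_sX_t]=\int_0^{s\wedge t}K(t,r)K(s,r)dr$ for a deterministic kernel $K$, and $\int_0^T\gamma(t,t)dt<\infty$. Let $\chi_t(s)=\min(s,t)$, $\langle h,g\rangle=\langle\dot h,\dot g\rangle_{L^2([0,T],dt)}$, $(Kh)(t)=\int_0^tK(t,s)\dot h(s)ds$, $\Gamma=KK^*$ (adjoint for $\langle\cdot,\cdot\rangle$). $H$ is the completion of the span of $\{\chi_t\}$ for $\langle h,g\rangle_H=\langle h,\Gamma g\rangle$, so $\langle\chi_t,\chi_s\rangle_H=\gamma(s,t)$, and $\{X(h):h\in H\}$ is the isonormal process (centered Gaussian, $\mathbb{E}[X(h)X(g)]=\langle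 h,g\rangle_H$) with $X(\chi_t)=X_t$. One has $(\Gamma h)(t)=\langle\chi_t,h\rangle_H=\mathbb{E}[X_tX(h)]$. For deterministic $u\in H$ (with $\Gamma^{-1}u\in H$), $\mathbb{P}_u$ is the probability with density $\exp\left(X(\Gamma^{-1}u)-\frac12\|\Gamma^{-1}u\|_H^2\right)$ with respect to $\mathbb{P}$. Under $\mathbb{P}_u$, $X^u:=X-u$ (i.e. $X^u_t=X_t-u(t)$, $X^u(g)=X(g)-\langle g,u\rangle$) has the law of $X$ under $\mathbb{P}$. $\mathbb{E}_u$ is expectation under $\mathbb{P}_u$. $(h_k)_{k\ge1}$ is a total sequence in $H$ such that $(\Gamma h_k)_{k\geq1}$ is orthogonal in $L^2([0,T],dt)$, and $\lambda_k=\|\Gamma h_k\|_{L^2([0,T],dt)}>0$. $D$ is the Malliavin-type derivative given on functionals $G=f(X(h_1),\dots,X(h_n))$ by $D_tG=\sum_{i=1}^n\Gamma h_i(t)\,\partial_if(X(h_1),\dots,X(h_n))$ (and extended by closability); $D_t\log F=D_tF/F$. *)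

theory Defs
  imports "HOL-Probability.Probability"
begin

definition centered_normal :: "'a measure \<Rightarrow> ('a \<Rightarrow> real) \<Rightarrow> bool" where
  \<comment> \<open>degenerate (almost surely zero) variables count as Gaussian\<close>
  "centered_normal M Y \<longleftrightarrow> Y \<in> borel_measurable M \<and>
     ((AE \<omega> in M. Y \<omega> = 0) \<or> (\<exists>\<sigma>>0. distributed M lborel Y (normal_density 0 \<sigma>)))"

definition centered_gaussian_family :: "'a measure \<Rightarrow> 'i set \<Rightarrow> ('i \<Rightarrow> 'a \<Rightarrow> real) \<Rightarrow> bool" where
  "centered_gaussian_family M I X \<longleftrightarrow>
     (\<forall>J a. finite J \<and> J \<subseteq> I \<longrightarrow> centered_normal M (\<lambda>\<omega>. \<Sum>i\<in>J. a i * X i \<omega>))"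

definition isonormal :: "'a measure \<Rightarrow> ('h::real_inner \<Rightarrow> 'a \<Rightarrow> real) \<Rightarrow> bool" where
  "isonormal M W \<longleftrightarrow> centered_gaussian_family M UNIV W \<and>
     (\<forall>h g. (\<integral>\<omega>. W h \<omega> * W g \<omega> \<partial>M) = h \<bullet> g)"

definition kernel_cov :: "(real \<Rightarrow> real \<Rightarrow> real) \<Rightarrow> real \<Rightarrow> real \<Rightarrow> real" where
  "kernel_cov K s t = (LINT r:{0..min s t}|lborel. K t r * K s r)"

text \<open>The space H is the completion of the span of the functions \<open>\<chi>\<^sub>t(s) = min s t\<close>
  (which are linearly independent for \<open>t > 0\<close>) for the (semi-)inner product determined by
  \<open>\<langle>\<chi>\<^sub>s, \<chi>\<^sub>t\<rangle>\<^sub>H = \<gamma>(s,t)\<close>. It is unique up to isometry: it is a Hilbert space together with a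
  total family \<open>chi t\<close>, the images of the \<open>\<chi>\<^sub>t\<close>, having these inner products.
  They come from \<open>\<Gamma> = K K*\<close>: as \<open>(K g)(t) = \<langle>\<chi>\<^sub>t, K g\<rangle>\<close> is the integral of \<open>K(t,r) g'(r)\<close> over
  \<open>[0,t]\<close>, the function \<open>K* \<chi>\<^sub>t\<close> has density \<open>K(t,\<cdot>)\<close> on \<open>[0,t]\<close> (and 0 beyond \<open>t\<close>), so that
  \<open>\<langle>\<chi>\<^sub>s, \<Gamma> \<chi>\<^sub>t\<rangle> = (\<Gamma> \<chi>\<^sub>t)(s) = \<gamma>(s,t)\<close>.\<close>

definition is_H_completion ::
    "real \<Rightarrow> (real \<Rightarrow> real \<Rightarrow> real) \<Rightarrow> (real \<Rightarrow> 'h::{real_inner,complete_space}) \<Rightarrow> bool" where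
  "is_H_completion T \<gamma> chi \<longleftrightarrow>
     (\<forall>s\<in>{0..T}. \<forall>t\<in>{0..T}. chi s \<bullet> chi t = \<gamma> s t) \<and> closure (span (chi ` {0..T})) = UNIV"

text \<open>The extension of \<open>\<Gamma>\<close> to all of H, with values in functions of \<open>t\<close>. Elements of the completion H
  need not be functions themselves.\<close>

definition Gam :: "(real \<Rightarrow> 'h::real_inner) \<Rightarrow> 'h \<Rightarrow> real \<Rightarrow> real" where
  "Gam chi h t = chi t \<bullet> h"

text \<open>\<open>Gam\<close> is injective when the \<open>chi t\<close>, \<open>t \<in> [0,T]\<close>, are total, so the description below
  is proper whenever \<open>u\<close> is in the range of \<open>Gam\<close>.\<close>

definition Gam_inv :: "real \<Rightarrow> (real \<Rightarrow> 'h::real_inner) \<Rightarrow> (real \<Rightarrow> real) \<Rightarrow> 'h" where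
  "Gam_inv T chi u = (THE v. \<forall>t\<in>{0..T}. Gam chi v t = u t)"

definition shifted_measure :: "'a measure \<Rightarrow> real \<Rightarrow> (real \<Rightarrow> 'h::real_inner) \<Rightarrow>
    ('h \<Rightarrow> 'a \<Rightarrow> real) \<Rightarrow> (real \<Rightarrow> real) \<Rightarrow> 'a measure" where
  "shifted_measure M T chi W u = density M
     (\<lambda>\<omega>. ennreal (exp (W (Gam_inv T chi u) \<omega> - (norm (Gam_inv T chi u))\<^sup>2 / 2)))"

definition l2norm :: "real \<Rightarrow> (real \<Rightarrow> real) \<Rightarrow> real" where
  "l2norm T f = sqrt (LINT t:{0..T}|lborel. (f t)\<^sup>2)"

text \<open>Functions on \<open>\<real>\<^sup>m\<close> are modelled as functions of \<open>x :: nat \<Rightarrow> real\<close> that depend only on the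
  coordinates \<open>x 1, \<dots>, x m\<close>.\<close>

definition partial_deriv :: "nat \<Rightarrow> ((nat \<Rightarrow> real) \<Rightarrow> real) \<Rightarrow> (nat \<Rightarrow> real) \<Rightarrow> real" where
  "partial_deriv i f x = deriv (\<lambda>s. f (x(i := s))) (x i)"

definition C1_bounded :: "nat \<Rightarrow> ((nat \<Rightarrow> real) \<Rightarrow> real) \<Rightarrow> bool" where
  "C1_bounded m f \<longleftrightarrow>
     (\<forall>x y. (\<forall>i\<in>{1..m}. x i = y i) \<longrightarrow> f x = f y) \<and>
     continuous_on UNIV f \<and> bounded (range f) \<and>
     (\<forall>i\<in>{1..m}. (\<forall>x. (\<lambda>s. f (x(i := s))) differentiable (at (x i))) \<and>
        continuous_on UNIV (partial_deriv i f) \<and> bounded (range (partial_deriv i f)))"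

definition cyl :: "('h \<Rightarrow> 'a \<Rightarrow> real) \<Rightarrow> (nat \<Rightarrow> 'h) \<Rightarrow> ((nat \<Rightarrow> real) \<Rightarrow> real) \<Rightarrow> 'a \<Rightarrow> real" where
  "cyl W g f \<omega> = f (\<lambda>j. W (g j) \<omega>)"

definition cyl_deriv :: "(real \<Rightarrow> 'h::real_inner) \<Rightarrow> ('h \<Rightarrow> 'a \<Rightarrow> real) \<Rightarrow> nat \<Rightarrow>
    (nat \<Rightarrow> 'h) \<Rightarrow> ((nat \<Rightarrow> real) \<Rightarrow> real) \<Rightarrow> real \<Rightarrow> 'a \<Rightarrow> real" where
  "cyl_deriv chi W m g f t \<omega> =
     (\<Sum>i=1..m. Gam chi (g i) t * partial_deriv i f (\<lambda>j. W (g j) \<omega>))"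

text \<open>The closure of the derivative on bounded \<open>C\<^sup>1\<close> cylindrical functionals, as an operator from
  \<open>L\<^sup>1(\<Omega>)\<close> to \<open>L\<^sup>1(\<Omega>; L\<^sup>2([0,T]))\<close>. The exponent 1 matters: functionals such as
  \<open>\<bar>Y\<bar>\<^bsup>2-n\<^esup>\<close> with \<open>Y\<close> a nondegenerate Gaussian vector in \<open>\<real>\<^sup>n\<close>, \<open>n \<ge> 3\<close>, have a derivative
  in \<open>L\<^sup>1\<close> but not in \<open>L\<^sup>2\<close>. Being a limit, the derivative is determined up to
  \<open>dt \<otimes> dP\<close>-null sets; the relation holds for each of its jointly measurable versions.\<close>

definition has_malliavin_deriv :: "'a measure \<Rightarrow> real \<Rightarrow> (real \<Rightarrow> 'h::real_inner) \<Rightarrow>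
    ('h \<Rightarrow> 'a \<Rightarrow> real) \<Rightarrow> ('a \<Rightarrow> real) \<Rightarrow> (real \<Rightarrow> 'a \<Rightarrow> real) \<Rightarrow> bool" where
  "has_malliavin_deriv M T chi W F DF \<longleftrightarrow>
     integrable M F \<and>
     case_prod DF \<in> borel_measurable (restrict_space lborel {0..T} \<Otimes>\<^sub>M M) \<and>
     (AE \<omega> in M. set_integrable lborel {0..T} (\<lambda>t. (DF t \<omega>)\<^sup>2)) \<and>
     integrable M (\<lambda>\<omega>. l2norm T (\<lambda>t. DF t \<omega>)) \<and>
     (\<exists>m g f. (\<forall>N::nat. C1_bounded (m N) (f N)) \<and>
        (\<lambda>N. \<integral>\<omega>. \<bar>cyl W (g N) (f N) \<omega> - F \<omega>\<bar> \<partial>M) \<longlonglongrightarrow> 0 \<and>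
        (\<lambda>N. \<integral>\<omega>. l2norm T (\<lambda>t. cyl_deriv chi W (m N) (g N) (f N) t \<omega> - DF t \<omega>) \<partial>M) \<longlonglongrightarrow> 0)"

end

theory Submission
  imports Defs
begin

text \<open>
  Write \<open>Y = (W h\<^sub>1, \<dots>, W h\<^sub>n)\<close>, \<open>q(x) = \<Sum> (x k)\<^sup>2 / (lam k)\<^sup>2\<close> and \<open>E\<close> for the expectation under the
  shifted measure. Since the functions \<open>\<Gamma> h\<^sub>k\<close> are orthogonal, the squared norm of \<open>\<Pi>X\<close> is \<open>q(Y)\<close>,
  so \<open>F\<close> is the power \<open>(2 - n)/2\<close> of \<open>q(Y)\<close> and its logarithmic derivative is
  \<open>-(n - 2) \<Pi>X / q(Y)\<close>. Expanding the square, the risk is the integral of \<open>\<gamma>(t,t)\<close>, plus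
  \<open>-2(n - 2) E\<langle>X - u, \<Pi>X / q(Y)\<rangle>\<close>, plus \<open>(n - 2)\<^sup>2 E[1 / q(Y)]\<close>. As in Stein's argument, the
  middle term is computed by Gaussian integration by parts: under the shifted measure \<open>X - u\<close> is
  again isonormal (\<open>cameron_martin\<close>), and differentiating \<open>\<Pi>X(t) / q(Y)\<close> in the direction \<open>chi t\<close> and
  integrating over \<open>t\<close> produces \<open>n / q - 2 q / q\<^sup>2 = (n - 2) / q\<close>. Hence
  the middle term is \<open>-2(n - 2)\<^sup>2 E[1 / q(Y)]\<close>, and together with the last one it leaves
  \<open>-(n - 2)\<^sup>2 E[1 / q(Y)]\<close> (\<open>stein_identity_regularized\<close>, \<open>stein_risk\<close>).

  Three points need care. The field \<open>x / q(x)\<close> is singular at the origin, so integration by parts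
  is done with \<open>q + \<epsilon>\<close> in place of \<open>q\<close>; the passage to the limit, and the membership of \<open>F\<close> in the domain
  of the derivative (\<open>has_malliavin_deriv_F\<close>), rest on the finiteness of \<open>E[q(Y) powr (-s)]\<close> for
  \<open>2 s < n\<close> (\<open>quadratic_form_negative_moment\<close>). Finally, the derivative is defined as a limit, so its
  value has to be shown unique (\<open>malliavin_deriv_unique\<close>). This is the usual closability argument:
  by integration by parts, \<open>D\<^sub>t F\<close> integrated against suitable bounded functions depends on \<open>F\<close> only, and
  these functions determine a random variable because the sigma-algebra is generated by \<open>X\<close>
  (\<open>AE_zero_of_char_zero\<close>).

  All Gaussian facts are derived from one statement: along a unit vector \<open>e\<close> the process splits into
  \<open>(g \<bullet> e) z\<close> with \<open>z\<close> standard normal, and an independent remainder (\<open>distr_split_unit\<close>). This holds because both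
  sides have the same characteristic functions, and these determine joint laws
  (\<open>distr_PiM_eqI_char\<close>).
\<close>

section \<open>Elementary estimates\<close>

lemma iexp_add: "iexp (x + y) = iexp x * iexp y"
  by (simp add: exp_add ring_distribs)

lemma abs_mult_le_sum_squares: "\<bar>x * y\<bar> \<le> x\<^sup>2 + y\<^sup>2" for x y :: real
proof -
  have "2 * (\<bar>x\<bar> * \<bar>y\<bar>) \<le> x\<^sup>2 + y\<^sup>2"
    using sum_squares_bound[of "\<bar>x\<bar>" "\<bar>y\<bar>"] by (simp add: mult.assoc)
  then show ?thesis using abs_ge_zero[of "x * y"] unfolding abs_mult by linarith
qed

lemma abs_le_one_plus_square: "\<bar>x\<bar> \<le> 1 + x\<^sup>2" for x :: real
  using abs_mult_le_sum_squares[of 1 x] by simp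

lemma norm_orthogonal_split:
  assumes "e \<bullet> e = 1"
  shows "(norm g)\<^sup>2 = (g \<bullet> e)\<^sup>2 + (norm (g - (g \<bullet> e) *\<^sub>R e))\<^sup>2"
  unfolding power2_norm_eq_inner
  by (simp add: inner_diff_left inner_diff_right assms power2_eq_square inner_commute algebra_simps)

lemma integrable_mult_bounded:
  fixes a b :: "'a \<Rightarrow> real"
  assumes "integrable M a" "b \<in> borel_measurable M" "\<And>\<omega>. \<bar>b \<omega>\<bar> \<le> c"
  shows "integrable M (\<lambda>\<omega>. a \<omega> * b \<omega>)"
proof (rule Bochner_Integration.integrable_bound)
  show "integrable M (\<lambda>\<omega>. c * a \<omega>)" using assms by simp
  have "\<bar>b \<omega>\<bar> \<le> \<bar>c\<bar>" for \<omega> using assms(3)[of \<omega>] by linarith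
  then show "AE \<omega> in M. norm (a \<omega> * b \<omega>) \<le> norm (c * a \<omega>)"
    by (intro AE_I2) (simp add: abs_mult mult.commute[of "\<bar>c\<bar>"] mult_left_mono)
qed (use assms in measurable)

lemma tendsto_integral_mult_bounded:
  fixes a :: "nat \<Rightarrow> 'a \<Rightarrow> real" and a' b :: "'a \<Rightarrow> real"
  assumes a: "\<And>N. integrable M (a N)" "integrable M a'" and b: "b \<in> borel_measurable M" "\<And>\<omega>. \<bar>b \<omega>\<bar> \<le> c"
    and lim: "(\<lambda>N. \<integral>\<omega>. \<bar>a N \<omega> - a' \<omega>\<bar> \<partial>M) \<longlonglongrightarrow> 0"
  shows "(\<lambda>N. \<integral>\<omega>. a N \<omega> * b \<omega> \<partial>M) \<longlonglongrightarrow> (\<integral>\<omega>. a' \<omega> * b \<omega> \<partial>M)"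
proof -
  note i = integrable_mult_bounded[OF _ b]
  have "(\<lambda>N. (\<integral>\<omega>. a N \<omega> * b \<omega> \<partial>M) - (\<integral>\<omega>. a' \<omega> * b \<omega> \<partial>M)) \<longlonglongrightarrow> 0"
  proof (rule Lim_null_comparison)
    have "norm ((\<integral>\<omega>. a N \<omega> * b \<omega> \<partial>M) - (\<integral>\<omega>. a' \<omega> * b \<omega> \<partial>M)) \<le> c * (\<integral>\<omega>. \<bar>a N \<omega> - a' \<omega>\<bar> \<partial>M)" for N
    proof -
      have d: "integrable M (\<lambda>\<omega>. a N \<omega> - a' \<omega>)" using a by simp
      have "(\<integral>\<omega>. a N \<omega> * b \<omega> \<partial>M) - (\<integral>\<omega>. a' \<omega> * b \<omega> \<partial>M) = (\<integral>\<omega>. (a N \<omega> - a' \<omega>) * b \<omega> \<partial>M)"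
        unfolding left_diff_distrib using a by (subst Bochner_Integration.integral_diff) (auto intro: i)
      also have "norm \<dots> \<le> (\<integral>\<omega>. norm ((a N \<omega> - a' \<omega>) * b \<omega>) \<partial>M)" by (rule integral_norm_bound)
      also have "\<dots> \<le> (\<integral>\<omega>. c * \<bar>a N \<omega> - a' \<omega>\<bar> \<partial>M)"
      proof (rule integral_mono)
        show "norm ((a N \<omega> - a' \<omega>) * b \<omega>) \<le> c * \<bar>a N \<omega> - a' \<omega>\<bar>" for \<omega>
          using mult_left_mono[OF b(2)[of \<omega>], of "\<bar>a N \<omega> - a' \<omega>\<bar>"] by (simp add: abs_mult mult.commute)
      qed (use d in \<open>auto intro!: integrable_norm integrable_mult_right i\<close>)
      finally show ?thesis by simp
    qed
    then show "\<forall>\<^sub>F N in sequentially. norm ((\<integral>\<omega>. a N \<omega> * b \<omega> \<partial>M) - (\<integral>\<omega>. a' \<omega> * b \<omega> \<partial>M))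
      \<le> c * (\<integral>\<omega>. \<bar>a N \<omega> - a' \<omega>\<bar> \<partial>M)" by simp
    show "(\<lambda>N. c * (\<integral>\<omega>. \<bar>a N \<omega> - a' \<omega>\<bar> \<partial>M)) \<longlonglongrightarrow> 0"
      using tendsto_mult_left[OF lim, of c] by simp
  qed
  then show ?thesis by (simp add: LIM_zero_iff)
qed

section \<open>Characteristic functions determine joint laws\<close>

text \<open>The uniqueness theorem for characteristic functions on the line speaks of probability measures,
  while below a complex weight \<open>w\<close> multiplies the exponential. A weight bounded by 1 becomes a
  probability density after adding the constant 2 to its real part and normalizing, and
  the characteristic function of the law of \<open>Y\<close> under that density is a combination of the
  transforms of \<open>Y\<close> with weights \<open>1\<close>, \<open>w\<close> and the conjugate of \<open>w\<close>.\<close>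

lemma (in prob_space)
  fixes Y :: "'a \<Rightarrow> real" and w :: "'a \<Rightarrow> complex"
  assumes [measurable]: "Y \<in> borel_measurable M" "w \<in> borel_measurable M"
    and w: "\<And>\<omega>. norm (w \<omega>) \<le> 1"
  defines "c \<equiv> 2 + Re (\<integral>\<omega>. w \<omega> \<partial>M)"
  defines "D \<equiv> distr (density M (\<lambda>\<omega>. ennreal ((2 + Re (w \<omega>)) / c))) borel Y"
  shows real_distribution_tilted: "real_distribution D"
    and char_tilted: "char D b = (2 * (\<integral>\<omega>. iexp (b * Y \<omega>) \<partial>M) + (\<integral>\<omega>. iexp (b * Y \<omega>) * w \<omega> \<partial>M) / 2
      + cnj (\<integral>\<omega>. iexp (- b * Y \<omega>) * w \<omega> \<partial>M) / 2) / c"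
    and measure_tilted: "A \<in> sets borel \<Longrightarrow>
      measure D A * c = 2 * (\<integral>\<omega>. indicator A (Y \<omega>) \<partial>M) + Re (\<integral>\<omega>. indicator A (Y \<omega>) * w \<omega> \<partial>M)"
proof -
  have bdd: "integrable M f" if "f \<in> borel_measurable M" "\<And>\<omega>. norm (f \<omega>) \<le> 1" for f :: "'a \<Rightarrow> complex"
    using that by (intro integrable_const_bound[where B=1]) auto
  have iw: "integrable M w" by (rule bdd) (auto simp: w)
  have re: "\<bar>Re (w \<omega>)\<bar> \<le> 1" for \<omega> using w[of \<omega>] abs_Re_le_cmod[of "w \<omega>"] by linarith
  have int_c: "(\<integral>\<omega>. 2 + Re (w \<omega>) \<partial>M) = c" using iw by (simp add: c_def prob_space)
  have "(\<integral>\<omega>. (1::real) \<partial>M) \<le> (\<integral>\<omega>. 2 + Re (w \<omega>) \<partial>M)"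
  proof (rule integral_mono)
    show "1 \<le> 2 + Re (w \<omega>)" for \<omega> using re[of \<omega>] by linarith
  qed (use iw in simp_all)
  then have c: "0 < c" unfolding int_c by (simp add: prob_space)
  have pos: "0 \<le> (2 + Re (w \<omega>)) / c" for \<omega> using re[of \<omega>] c by (intro divide_nonneg_nonneg) auto
  let ?D = "density M (\<lambda>\<omega>. ennreal ((2 + Re (w \<omega>)) / c))"
  have "emeasure ?D (space ?D) = (\<integral>\<^sup>+\<omega>. ennreal ((2 + Re (w \<omega>)) / c) \<partial>M)"
    by (simp add: emeasure_density cong: nn_integral_cong)
  also have "\<dots> = ennreal (\<integral>\<omega>. (2 + Re (w \<omega>)) / c \<partial>M)"
    using iw pos by (intro nn_integral_eq_integral) auto
  also have "\<dots> = 1" using c int_c by simp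
  finally interpret D: prob_space ?D by (rule prob_spaceI)
  show "real_distribution D"
    by (auto simp: D_def real_distribution_def real_distribution_axioms_def intro!: D.prob_space_distr)
  have i1: "integrable M (\<lambda>\<omega>. iexp (b * Y \<omega>))" and i2: "integrable M (\<lambda>\<omega>. iexp (b * Y \<omega>) * w \<omega>)" for b
    by (rule bdd; auto simp: norm_mult w)+
  have i3: "integrable M (\<lambda>\<omega>. cnj (iexp (- b * Y \<omega>) * w \<omega>))"
    using i2[of "- b"] by (simp only: integrable_cnj)
  have "char D b = (\<integral>\<omega>. ((2 + Re (w \<omega>)) / c) *\<^sub>R iexp (b * Y \<omega>) \<partial>M)"
    unfolding char_def D_def by (subst integral_distr) (auto simp: integral_density pos)
  also have "\<dots> = (\<integral>\<omega>. (2 * iexp (b * Y \<omega>) + iexp (b * Y \<omega>) * w \<omega> / 2 + cnj (iexp (- b * Y \<omega>) * w \<omega>) / 2) / c \<partial>M)"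
  proof (intro Bochner_Integration.integral_cong refl)
    fix \<omega>
    have "iexp (b * x) * complex_of_real (2 + Re z) = 2 * iexp (b * x) + iexp (b * x) * z / 2 + cnj (iexp (- b * x) * z) / 2" for x z
      by (simp add: complex_eq_iff field_simps Re_exp Im_exp)
    from this[of "Y \<omega>" "w \<omega>", symmetric]
    show "((2 + Re (w \<omega>)) / c) *\<^sub>R iexp (b * Y \<omega>)
      = (2 * iexp (b * Y \<omega>) + iexp (b * Y \<omega>) * w \<omega> / 2 + cnj (iexp (- b * Y \<omega>) * w \<omega>) / 2) / c"
      unfolding scaleR_conv_of_real of_real_divide
      by (simp only: times_divide_eq_left times_divide_eq_right mult.commute)
  qed
  also have "\<dots> = (2 * (\<integral>\<omega>. iexp (b * Y \<omega>) \<partial>M) + (\<integral>\<omega>. iexp (b * Y \<omega>) * w \<omega> \<partial>M) / 2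
      + (\<integral>\<omega>. cnj (iexp (- b * Y \<omega>) * w \<omega>) \<partial>M) / 2) / c"
    using i1[of b] i2[of b] i3 by simp
  also have "(\<integral>\<omega>. cnj (iexp (- b * Y \<omega>) * w \<omega>) \<partial>M) = cnj (\<integral>\<omega>. iexp (- b * Y \<omega>) * w \<omega> \<partial>M)"
    by (rule Bochner_Integration.integral_cnj)
  finally show "char D b = (2 * (\<integral>\<omega>. iexp (b * Y \<omega>) \<partial>M) + (\<integral>\<omega>. iexp (b * Y \<omega>) * w \<omega> \<partial>M) / 2
      + cnj (\<integral>\<omega>. iexp (- b * Y \<omega>) * w \<omega> \<partial>M) / 2) / c" .
  assume A[measurable]: "A \<in> sets borel"
  have j1: "integrable M (\<lambda>\<omega>. indicator A (Y \<omega>) * w \<omega>)"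
    by (rule bdd) (auto split: split_indicator intro: w)
  have j2: "integrable M (\<lambda>\<omega>. indicator A (Y \<omega>) :: real)"
    by (rule integrable_const_bound[where B=1]) auto
  have "measure D A = (\<integral>\<omega>. indicator A (Y \<omega>) \<partial>?D)"
    unfolding D_def
    by (subst measure_distr) (auto simp: indicator_vimage[symmetric] indicator_inter_arith
        simp flip: integral_indicator intro!: Bochner_Integration.integral_cong split: split_indicator)
  also have "\<dots> = (\<integral>\<omega>. ((2 + Re (w \<omega>)) / c) *\<^sub>R indicator A (Y \<omega>) \<partial>M)"
    by (subst integral_density) (auto simp: pos)
  also have "\<dots> = (\<integral>\<omega>. (2 * indicator A (Y \<omega>) + Re (indicator A (Y \<omega>) * w \<omega>)) / c \<partial>M)"
    by (intro Bochner_Integration.integral_cong refl) (auto split: split_indicator)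
  also have "\<dots> = (2 * (\<integral>\<omega>. indicator A (Y \<omega>) \<partial>M) + (\<integral>\<omega>. Re (indicator A (Y \<omega>) * w \<omega>) \<partial>M)) / c"
    using j2 integrable_Re[OF j1] by simp
  also have "(\<integral>\<omega>. Re (indicator A (Y \<omega>) * w \<omega>) \<partial>M) = Re (\<integral>\<omega>. indicator A (Y \<omega>) * w \<omega> \<partial>M)"
    by (rule integral_Re[OF j1])
  finally show "measure D A * c = 2 * (\<integral>\<omega>. indicator A (Y \<omega>) \<partial>M) + Re (\<integral>\<omega>. indicator A (Y \<omega>) * w \<omega> \<partial>M)"
    using c by simp
qed

lemma integral_weighted_char_unique:
  fixes Y :: "'a \<Rightarrow> real" and Z :: "'b \<Rightarrow> real" and w :: "'a \<Rightarrow> complex" and v :: "'b \<Rightarrow> complex"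
  assumes "prob_space M" "prob_space N"
    and [measurable]: "Y \<in> borel_measurable M" "w \<in> borel_measurable M"
      "Z \<in> borel_measurable N" "v \<in> borel_measurable N"
    and w: "\<And>\<omega>. norm (w \<omega>) \<le> 1" and v: "\<And>\<omega>. norm (v \<omega>) \<le> 1"
    and char: "\<And>b. (\<integral>\<omega>. iexp (b * Y \<omega>) \<partial>M) = (\<integral>\<omega>. iexp (b * Z \<omega>) \<partial>N)"
    and char_w: "\<And>b. (\<integral>\<omega>. iexp (b * Y \<omega>) * w \<omega> \<partial>M) = (\<integral>\<omega>. iexp (b * Z \<omega>) * v \<omega> \<partial>N)"
    and A: "A \<in> sets borel"
  shows "(\<integral>\<omega>. indicator A (Y \<omega>) * w \<omega> \<partial>M) = (\<integral>\<omega>. indicator A (Z \<omega>) * v \<omega> \<partial>N)"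
proof -
  interpret M: prob_space M by fact
  interpret N: prob_space N by fact
  have tilted: "2 * (\<integral>\<omega>. indicator A (Y \<omega>) \<partial>M) + Re (\<integral>\<omega>. indicator A (Y \<omega>) * w' \<omega> \<partial>M)
      = 2 * (\<integral>\<omega>. indicator A (Z \<omega>) \<partial>N) + Re (\<integral>\<omega>. indicator A (Z \<omega>) * v' \<omega> \<partial>N)"
    if m: "w' \<in> borel_measurable M" "v' \<in> borel_measurable N"
      and b: "\<And>\<omega>. norm (w' \<omega>) \<le> 1" "\<And>\<omega>. norm (v' \<omega>) \<le> 1"
      and ch: "\<And>b. (\<integral>\<omega>. iexp (b * Y \<omega>) * w' \<omega> \<partial>M) = (\<integral>\<omega>. iexp (b * Z \<omega>) * v' \<omega> \<partial>N)" for w' v'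
  proof -
    note Y = \<open>Y \<in> borel_measurable M\<close> and Z = \<open>Z \<in> borel_measurable N\<close>
    have c: "(\<integral>\<omega>. w' \<omega> \<partial>M) = (\<integral>\<omega>. v' \<omega> \<partial>N)" using ch[of 0] by simp
    have "distr (density M (\<lambda>\<omega>. ennreal ((2 + Re (w' \<omega>)) / (2 + Re (\<integral>\<omega>. w' \<omega> \<partial>M))))) borel Y
      = distr (density N (\<lambda>\<omega>. ennreal ((2 + Re (v' \<omega>)) / (2 + Re (\<integral>\<omega>. v' \<omega> \<partial>N))))) borel Z"
      by (intro Levy_uniqueness M.real_distribution_tilted N.real_distribution_tilted Y Z m b ext)
        (unfold M.char_tilted[OF Y m(1) b(1)] N.char_tilted[OF Z m(2) b(2)], simp only: char ch c)
    then show ?thesis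
      using M.measure_tilted[OF Y m(1) b(1) A] N.measure_tilted[OF Z m(2) b(2) A] c by simp
  qed
  have one: "(\<integral>\<omega>. indicat_real A (Y \<omega>) \<partial>M) = (\<integral>\<omega>. indicat_real A (Z \<omega>) \<partial>N)"
  proof -
    have "2 * (\<integral>\<omega>. indicator A (Y \<omega>) \<partial>M) + Re (\<integral>\<omega>. indicator A (Y \<omega>) * 0 \<partial>M)
      = 2 * (\<integral>\<omega>. indicator A (Z \<omega>) \<partial>N) + Re (\<integral>\<omega>. indicator A (Z \<omega>) * 0 \<partial>N)"
      by (rule tilted) simp_all
    then show ?thesis by simp
  qed
  have "Re (\<integral>\<omega>. indicator A (Y \<omega>) * w \<omega> \<partial>M) = Re (\<integral>\<omega>. indicator A (Z \<omega>) * v \<omega> \<partial>N)"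
    using tilted[of w v] w v char_w one by simp
  \<comment> \<open>the real part of \<open>- \<i> w\<close> is the imaginary part of \<open>w\<close>\<close>
  moreover have "Re (\<integral>\<omega>. indicator A (Y \<omega>) * (- \<i> * w \<omega>) \<partial>M) = Re (\<integral>\<omega>. indicator A (Z \<omega>) * (- \<i> * v \<omega>) \<partial>N)"
  proof -
    have "(\<integral>\<omega>. iexp (b * Y \<omega>) * (- \<i> * w \<omega>) \<partial>M) = (\<integral>\<omega>. iexp (b * Z \<omega>) * (- \<i> * v \<omega>) \<partial>N)" for b
      unfolding mult.left_commute[of "iexp _"] integral_mult_right_zero char_w ..
    then show ?thesis
      using tilted[of "\<lambda>\<omega>. - \<i> * w \<omega>" "\<lambda>\<omega>. - \<i> * v \<omega>"] w v unfolding one norm_mult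
      by (simp only: add_left_cancel) simp
  qed
  ultimately show ?thesis
    unfolding complex_eq_iff mult.left_commute[of "indicator A _"] integral_mult_right_zero by simp
qed

text \<open>Uniqueness in several (even infinitely many) variables reduces to one variable: starting from the
  joint characteristic function, the factor \<open>iexp (a j * Y j)\<close> of one coordinate at a time is replaced by the
  indicator of \<open>Y j \<in> A j\<close>, the remaining factors being a bounded complex weight. When
  all coordinates are converted, the measures of rectangles agree.\<close>

lemma distr_PiM_eqI_char:
  fixes Y :: "'i \<Rightarrow> 'a \<Rightarrow> real" and Z :: "'i \<Rightarrow> 'b \<Rightarrow> real"
  assumes M: "prob_space M" and N: "prob_space N"
    and Y: "\<And>i. i \<in> I \<Longrightarrow> Y i \<in> borel_measurable M" and Z: "\<And>i. i \<in> I \<Longrightarrow> Z i \<in> borel_measurable N"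
    and char: "\<And>J a. finite J \<Longrightarrow> J \<subseteq> I \<Longrightarrow>
      (\<integral>\<omega>. iexp (\<Sum>i\<in>J. a i * Y i \<omega>) \<partial>M) = (\<integral>\<omega>. iexp (\<Sum>i\<in>J. a i * Z i \<omega>) \<partial>N)"
  shows "distr M (PiM I (\<lambda>_. borel)) (\<lambda>\<omega>. \<lambda>i\<in>I. Y i \<omega>) = distr N (PiM I (\<lambda>_. borel)) (\<lambda>\<omega>. \<lambda>i\<in>I. Z i \<omega>)"
proof -
  interpret M: prob_space M by fact
  interpret N: prob_space N by fact
  \<comment> \<open>the coordinates in \<open>J\<close> are converted, those in \<open>J'\<close> are not\<close>
  have step: "(\<integral>\<omega>. (\<Prod>j\<in>J. indicator (A j) (Y j \<omega>)) * iexp (\<Sum>i\<in>J'. a i * Y i \<omega>) \<partial>M)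
      = (\<integral>\<omega>. (\<Prod>j\<in>J. indicator (A j) (Z j \<omega>)) * iexp (\<Sum>i\<in>J'. a i * Z i \<omega>) \<partial>N)"
    if "finite J" "finite J'" "J \<inter> J' = {}" "J \<subseteq> I" "J' \<subseteq> I" "\<And>j. j \<in> J \<Longrightarrow> A j \<in> sets borel"
    for J J' and A :: "'i \<Rightarrow> real set" and a
    using that
  proof (induction J arbitrary: J' a rule: finite_induct)
    case empty
    then show ?case using char[of J' a] by simp
  next
    case (insert j J)
    have [measurable]: "A j \<in> sets borel" "Y j \<in> borel_measurable M" "Z j \<in> borel_measurable N"
      using insert.prems Y Z by auto
    have [measurable]: "(\<lambda>\<omega>. (\<Prod>j\<in>J. indicator (A j) (Y j \<omega>)) * iexp (\<Sum>i\<in>J'. a i * Y i \<omega>)) \<in> borel_measurable M"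
    proof -
      have [measurable]: "Y i \<in> borel_measurable M" if "i \<in> J \<union> J'" for i using that insert.prems Y by auto
      have [measurable]: "A i \<in> sets borel" if "i \<in> J" for i using that insert.prems by auto
      show ?thesis by measurable
    qed
    have [measurable]: "(\<lambda>\<omega>. (\<Prod>j\<in>J. indicator (A j) (Z j \<omega>)) * iexp (\<Sum>i\<in>J'. a i * Z i \<omega>)) \<in> borel_measurable N"
    proof -
      have [measurable]: "Z i \<in> borel_measurable N" if "i \<in> J \<union> J'" for i using that insert.prems Z by auto
      have [measurable]: "A i \<in> sets borel" if "i \<in> J" for i using that insert.prems by auto
      show ?thesis by measurable
    qed
    have pr: "norm (\<Prod>j\<in>J. indicator (A j) (x j) :: complex) \<le> 1" for x
      by (auto simp: prod_norm[symmetric] intro!: prod_le_1 split: split_indicator)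
    have "(\<integral>\<omega>. indicator (A j) (Y j \<omega>) * ((\<Prod>j\<in>J. indicator (A j) (Y j \<omega>)) * iexp (\<Sum>i\<in>J'. a i * Y i \<omega>)) \<partial>M)
      = (\<integral>\<omega>. indicator (A j) (Z j \<omega>) * ((\<Prod>j\<in>J. indicator (A j) (Z j \<omega>)) * iexp (\<Sum>i\<in>J'. a i * Z i \<omega>)) \<partial>N)"
    proof (rule integral_weighted_char_unique[OF M N])
      show "(\<integral>\<omega>. iexp (b * Y j \<omega>) \<partial>M) = (\<integral>\<omega>. iexp (b * Z j \<omega>) \<partial>N)" for b
        using char[of "{j}" "\<lambda>_. b"] insert.prems by simp
      show "(\<integral>\<omega>. iexp (b * Y j \<omega>) * ((\<Prod>j\<in>J. indicator (A j) (Y j \<omega>)) * iexp (\<Sum>i\<in>J'. a i * Y i \<omega>)) \<partial>M)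
        = (\<integral>\<omega>. iexp (b * Z j \<omega>) * ((\<Prod>j\<in>J. indicator (A j) (Z j \<omega>)) * iexp (\<Sum>i\<in>J'. a i * Z i \<omega>)) \<partial>N)" for b
      proof -
        have jJ: "j \<notin> J'" using insert.prems by auto
        have sums: "(\<Sum>i\<in>insert j J'. (a(j:=b)) i * x i) = b * x j + (\<Sum>i\<in>J'. a i * x i)" for x :: "'i \<Rightarrow> real"
          using insert.prems jJ by (auto intro!: sum.cong)
        have perm: "p * (iexp x * q) = iexp x * (p * q)" for p x q
          by (rule mult.left_commute)
        have "(\<integral>\<omega>. (\<Prod>j\<in>J. indicator (A j) (Y j \<omega>)) * iexp (\<Sum>i\<in>insert j J'. (a(j:=b)) i * Y i \<omega>) \<partial>M)
          = (\<integral>\<omega>. (\<Prod>j\<in>J. indicator (A j) (Z j \<omega>)) * iexp (\<Sum>i\<in>insert j J'. (a(j:=b)) i * Z i \<omega>) \<partial>N)"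
          by (rule insert.IH) (use insert.prems insert.hyps in auto)
        then show ?thesis unfolding sums iexp_add perm .
      qed
    qed (auto simp: norm_mult pr simp del: of_real_sum)
    then show ?case using insert.hyps by (simp add: mult_ac)
  qed
  let ?P = "PiM I (\<lambda>_. borel :: real measure)"
  have mY: "(\<lambda>\<omega>. \<lambda>i\<in>I. Y i \<omega>) \<in> measurable M ?P" and mZ: "(\<lambda>\<omega>. \<lambda>i\<in>I. Z i \<omega>) \<in> measurable N ?P"
    using Y Z by (auto intro!: measurable_restrict)
  show ?thesis
  proof (rule measure_eqI_PiM_infinite)
    fix A :: "'i \<Rightarrow> real set" and J
    assume J: "finite J" "J \<subseteq> I" and A: "\<And>i. i \<in> J \<Longrightarrow> A i \<in> sets borel"
    let ?E = "prod_emb I (\<lambda>_. borel) J (Pi\<^sub>E J A)"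
    have E: "?E \<in> sets ?P" by (rule sets_PiM_I) (use J A in auto)
    have mM: "complex_of_real (measure P ((\<lambda>\<omega>. \<lambda>i\<in>I. S i \<omega>) -` ?E \<inter> space P)) = (\<integral>\<omega>. (\<Prod>j\<in>J. indicator (A j) (S j \<omega>)) \<partial>P)"
      if "prob_space P" and m: "(\<lambda>\<omega>. \<lambda>i\<in>I. S i \<omega>) \<in> measurable P ?P" for P :: "'c measure" and S
    proof -
      interpret P: prob_space P by fact
      have s: "(\<lambda>\<omega>. \<lambda>i\<in>I. S i \<omega>) -` ?E \<inter> space P \<in> sets P" by (rule measurable_sets[OF m E])
      have "indicator ((\<lambda>\<omega>. \<lambda>i\<in>I. S i \<omega>) -` ?E \<inter> space P) \<omega> = (\<Prod>j\<in>J. indicator (A j) (S j \<omega>) :: real)"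
        if "\<omega> \<in> space P" for \<omega>
      proof -
        have mem: "\<omega> \<in> (\<lambda>\<omega>. \<lambda>i\<in>I. S i \<omega>) -` ?E \<inter> space P \<longleftrightarrow> (\<forall>j\<in>J. S j \<omega> \<in> A j)"
          using that J by (auto simp: prod_emb_iff PiE_iff subset_eq)
        show ?thesis
        proof (cases "\<forall>j\<in>J. S j \<omega> \<in> A j")
          case True
          then have "(\<Prod>j\<in>J. indicator (A j) (S j \<omega>) :: real) = 1" by (intro prod.neutral) simp
          then show ?thesis using mem True by (simp only: indicator_simps)
        next
          case False
          then obtain j where "j \<in> J" "indicator (A j) (S j \<omega>) = (0::real)" by auto
          then have "(\<Prod>j\<in>J. indicator (A j) (S j \<omega>) :: real) = 0" using J(1) by (intro prod_zero) auto
          then show ?thesis using mem False by simp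
        qed
      qed
      then have ind: "(\<integral>\<omega>. indicator ((\<lambda>\<omega>. \<lambda>i\<in>I. S i \<omega>) -` ?E \<inter> space P) \<omega> \<partial>P) = (\<integral>\<omega>. (\<Prod>j\<in>J. indicator (A j) (S j \<omega>) :: real) \<partial>P)"
        by (intro Bochner_Integration.integral_cong refl)
      have "measure P ((\<lambda>\<omega>. \<lambda>i\<in>I. S i \<omega>) -` ?E \<inter> space P) = (\<integral>\<omega>. (\<Prod>j\<in>J. indicator (A j) (S j \<omega>)) \<partial>P)"
        unfolding ind[symmetric] Bochner_Integration.integral_indicator by (simp add: Int_assoc)
      moreover have "complex_of_real (\<Prod>j\<in>J. indicator (A j) (S j \<omega>)) = (\<Prod>j\<in>J. indicator (A j) (S j \<omega>))" for \<omega>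
        unfolding of_real_prod by (intro prod.cong refl) (simp add: indicator_def)
      ultimately show ?thesis by (simp only: integral_complex_of_real[symmetric])
    qed
    have "complex_of_real (measure M ((\<lambda>\<omega>. \<lambda>i\<in>I. Y i \<omega>) -` ?E \<inter> space M))
      = complex_of_real (measure N ((\<lambda>\<omega>. \<lambda>i\<in>I. Z i \<omega>) -` ?E \<inter> space N))"
      unfolding mM[OF M mY] mM[OF N mZ] using step[of J "{}" A] J A by simp
    then show "emeasure (distr M ?P (\<lambda>\<omega>. \<lambda>i\<in>I. Y i \<omega>)) ?E = emeasure (distr N ?P (\<lambda>\<omega>. \<lambda>i\<in>I. Z i \<omega>)) ?E"
      unfolding emeasure_distr[OF mY E] emeasure_distr[OF mZ E] M.emeasure_eq_measure N.emeasure_eq_measure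
      by (simp only: of_real_eq_iff)
  next
    show "finite_measure (distr M ?P (\<lambda>\<omega>. \<lambda>i\<in>I. Y i \<omega>))"
      by (rule M.finite_measure_distr[OF mY])
  qed (simp_all only: sets_distr)
qed

section \<open>Isonormal processes\<close>

lemma (in pair_sigma_finite)
  fixes f :: "'a \<Rightarrow> 'c::{real_normed_field, banach, second_countable_topology}"
  assumes f: "integrable M1 f" and g: "integrable M2 g"
  shows integrable_times_pair: "integrable (M1 \<Otimes>\<^sub>M M2) (\<lambda>(x, y). f x * g y)"
    and integral_times_pair: "(\<integral>(x, y). f x * g y \<partial>(M1 \<Otimes>\<^sub>M M2)) = (\<integral>x. f x \<partial>M1) * (\<integral>y. g y \<partial>M2)"
proof -
  have [measurable]: "f \<in> borel_measurable M1" "g \<in> borel_measurable M2" using f g by auto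
  show i: "integrable (M1 \<Otimes>\<^sub>M M2) (\<lambda>(x, y). f x * g y)"
  proof (rule Fubini_integrable)
    have "integrable M1 (\<lambda>x. norm (f x) * (\<integral>y. norm (g y) \<partial>M2))"
      using f by (intro integrable_mult_left integrable_norm)
    then show "integrable M1 (\<lambda>x. \<integral>y. norm (case (x, y) of (x, y) \<Rightarrow> f x * g y) \<partial>M2)"
      by (simp add: norm_mult)
    show "AE x in M1. integrable M2 (\<lambda>y. case (x, y) of (x, y) \<Rightarrow> f x * g y)"
      using g by simp
  qed measurable
  have "(\<integral>(x, y). f x * g y \<partial>(M1 \<Otimes>\<^sub>M M2)) = (\<integral>x. (\<integral>y. f x * g y \<partial>M2) \<partial>M1)"
    using integral_fst'[OF i] by simp
  also have "\<dots> = (\<integral>x. f x \<partial>M1) * (\<integral>y. g y \<partial>M2)"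
    by simp
  finally show "(\<integral>(x, y). f x * g y \<partial>(M1 \<Otimes>\<^sub>M M2)) = (\<integral>x. f x \<partial>M1) * (\<integral>y. g y \<partial>M2)" .
qed

interpretation std_normal: real_distribution std_normal_distribution
  by (rule real_dist_normal_dist)

lemma AE_std_normal_iff_lborel: "(AE x in std_normal_distribution. P x) \<longleftrightarrow> (AE x in lborel. P x)"
  by (subst AE_density) (auto simp: ennreal_zero_less_divide normal_density_pos)

text \<open>Gaussianity of all linear combinations is encoded by almost sure linearity together with
  the characteristic function of each single \<open>W g\<close>. In this form the Cameron--Martin shift below is a
  calculation of one integral.\<close>

locale isonormal_process = prob_space M for M :: "'a measure" +
  fixes W :: "'h::real_inner \<Rightarrow> 'a \<Rightarrow> real"
  assumes W_meas[measurable]: "\<And>g. W g \<in> borel_measurable M"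
    and W_linear: "\<And>a b g h. AE \<omega> in M. W (a *\<^sub>R g + b *\<^sub>R h) \<omega> = a * W g \<omega> + b * W h \<omega>"
    and W_char: "\<And>g. (\<integral>\<omega>. iexp (W g \<omega>) \<partial>M) = complex_of_real (exp (- (norm g)\<^sup>2 / 2))"
begin

lemma W_zero: "AE \<omega> in M. W 0 \<omega> = 0"
  using W_linear[of 0 0 0 0] by simp

lemma W_scale: "AE \<omega> in M. W (a *\<^sub>R g) \<omega> = a * W g \<omega>"
  using W_linear[of a g 0 0] by simp

lemma W_sum: "finite J \<Longrightarrow> AE \<omega> in M. W (\<Sum>i\<in>J. a i *\<^sub>R g i) \<omega> = (\<Sum>i\<in>J. a i * W (g i) \<omega>)"
proof (induction J rule: finite_induct)
  case empty
  then show ?case using W_zero by simp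
next
  case (insert j J)
  from insert.IH W_linear[of "a j" "g j" 1 "\<Sum>i\<in>J. a i *\<^sub>R g i"] show ?case
    by eventually_elim (use insert in simp)
qed

lemma char_W_sum:
  assumes "finite J"
  shows "(\<integral>\<omega>. iexp (\<Sum>i\<in>J. a i * W (g i) \<omega>) \<partial>M) = complex_of_real (exp (- (norm (\<Sum>i\<in>J. a i *\<^sub>R g i))\<^sup>2 / 2))"
proof -
  have "(\<integral>\<omega>. iexp (\<Sum>i\<in>J. a i * W (g i) \<omega>) \<partial>M) = (\<integral>\<omega>. iexp (W (\<Sum>i\<in>J. a i *\<^sub>R g i) \<omega>) \<partial>M)"
  proof (rule integral_cong_AE)
    show "AE \<omega> in M. iexp (\<Sum>i\<in>J. a i * W (g i) \<omega>) = iexp (W (\<Sum>i\<in>J. a i *\<^sub>R g i) \<omega>)"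
      using W_sum[OF assms, of a g] by eventually_elim simp
  qed measurable
  then show ?thesis by (simp only: W_char)
qed

lemma distr_W_unit:
  assumes "norm e = 1"
  shows "distr M borel (W e) = std_normal_distribution"
proof (rule Levy_uniqueness)
  show "real_distribution (distr M borel (W e))"
    by (auto simp: real_distribution_def real_distribution_axioms_def intro!: prob_space_distr)
  show "char (distr M borel (W e)) = char std_normal_distribution"
  proof
    fix t
    have "char (distr M borel (W e)) t = (\<integral>\<omega>. iexp (\<Sum>i\<in>{()}. t * W e \<omega>) \<partial>M)"
      unfolding char_def by (subst integral_distr) auto
    also have "\<dots> = complex_of_real (exp (- t\<^sup>2 / 2))"
      using assms by (subst char_W_sum) (auto simp: power_mult_distrib)
    finally show "char (distr M borel (W e)) t = char std_normal_distribution t"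
      by (simp add: char_std_normal_distribution)
  qed
qed (rule real_dist_normal_dist)

text \<open>The orthogonal parts \<open>(g i \<bullet> e) *\<^sub>R e\<close> and \<open>g i - (g i \<bullet> e) *\<^sub>R e\<close> contribute independently, as Pythagoras
  makes the joint characteristic function a product. Integrals over \<open>M\<close> thus become
  iterated integrals whose inner one is over a line with the standard normal law, which reduces
  Gaussian calculus on \<open>M\<close> to one dimension.\<close>

lemma distr_split_unit:
  fixes g :: "'i \<Rightarrow> 'h"
  assumes e: "norm e = 1"
  shows "distr M (PiM UNIV (\<lambda>_. borel)) (\<lambda>\<omega> i. W (g i) \<omega>)
    = distr (std_normal_distribution \<Otimes>\<^sub>M M) (PiM UNIV (\<lambda>_. borel))
        (\<lambda>(z, \<omega>) i. (g i \<bullet> e) * z + W (g i - (g i \<bullet> e) *\<^sub>R e) \<omega>)"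
proof -
  interpret P: pair_prob_space std_normal_distribution M ..
  let ?o = "\<lambda>x. x - (x \<bullet> e) *\<^sub>R e"
  have e2: "e \<bullet> e = 1" using e by (simp add: norm_eq_1)
  have "distr M (PiM UNIV (\<lambda>_. borel)) (\<lambda>\<omega>. \<lambda>i\<in>UNIV. W (g i) \<omega>)
    = distr (std_normal_distribution \<Otimes>\<^sub>M M) (PiM UNIV (\<lambda>_. borel))
        (\<lambda>p. \<lambda>i\<in>UNIV. (g i \<bullet> e) * fst p + W (?o (g i)) (snd p))"
  proof (rule distr_PiM_eqI_char)
    show "prob_space M" "prob_space (std_normal_distribution \<Otimes>\<^sub>M M)"
      by unfold_locales
    fix J :: "'i set" and a :: "'i \<Rightarrow> real"
    assume J: "finite J"
    define G where "G = (\<Sum>i\<in>J. a i *\<^sub>R g i)"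
    have Go: "(\<Sum>i\<in>J. a i *\<^sub>R ?o (g i)) = ?o G"
      by (simp add: G_def scaleR_right_diff_distrib sum_subtractf inner_sum_left scaleR_sum_left)
    have Ge: "(\<Sum>i\<in>J. a i * (g i \<bullet> e)) = G \<bullet> e"
      by (simp add: G_def inner_sum_left)
    have "(\<integral>p. iexp (\<Sum>i\<in>J. a i * ((g i \<bullet> e) * fst p + W (?o (g i)) (snd p))) \<partial>(std_normal_distribution \<Otimes>\<^sub>M M))
      = (\<integral>(z, \<omega>). iexp ((G \<bullet> e) * z) * iexp (\<Sum>i\<in>J. a i * W (?o (g i)) \<omega>) \<partial>(std_normal_distribution \<Otimes>\<^sub>M M))"
    proof (intro Bochner_Integration.integral_cong refl, clarsimp simp only: split_beta)
      fix z \<omega>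
      have *: "(\<Sum>i\<in>J. a i * ((g i \<bullet> e) * z + W (?o (g i)) \<omega>)) = (G \<bullet> e) * z + (\<Sum>i\<in>J. a i * W (?o (g i)) \<omega>)"
        unfolding Ge[symmetric] by (simp add: distrib_left sum.distrib sum_distrib_right mult.assoc)
      show "iexp (\<Sum>i\<in>J. a i * ((g i \<bullet> e) * fst (z, \<omega>) + W (?o (g i)) (snd (z, \<omega>))))
        = iexp ((G \<bullet> e) * fst (z, \<omega>)) * iexp (\<Sum>i\<in>J. a i * W (?o (g i)) (snd (z, \<omega>)))"
        unfolding fst_conv snd_conv * by (rule iexp_add)
    qed
    also have "\<dots> = (\<integral>z. iexp ((G \<bullet> e) * z) \<partial>std_normal_distribution) * (\<integral>\<omega>. iexp (\<Sum>i\<in>J. a i * W (?o (g i)) \<omega>) \<partial>M)"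
    proof (rule P.integral_times_pair)
      show "integrable std_normal_distribution (\<lambda>z. iexp ((G \<bullet> e) * z))"
        by (rule std_normal.integrable_iexp) simp_all
      show "integrable M (\<lambda>\<omega>. iexp (\<Sum>i\<in>J. a i * W (?o (g i)) \<omega>))"
        by (rule integrable_iexp) simp_all
    qed
    also have "(\<integral>z. iexp ((G \<bullet> e) * z) \<partial>std_normal_distribution) = complex_of_real (exp (- (G \<bullet> e)\<^sup>2 / 2))"
      using char_std_normal_distribution unfolding char_def by (rule fun_cong)
    also have "(\<integral>\<omega>. iexp (\<Sum>i\<in>J. a i * W (?o (g i)) \<omega>) \<partial>M) = complex_of_real (exp (- (norm (?o G))\<^sup>2 / 2))"
      by (simp only: char_W_sum[OF J] Go)
    also have "complex_of_real (exp (- (G \<bullet> e)\<^sup>2 / 2)) * complex_of_real (exp (- (norm (?o G))\<^sup>2 / 2))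
      = complex_of_real (exp (- (norm G)\<^sup>2 / 2))"
      unfolding norm_orthogonal_split[OF e2, of G] of_real_mult[symmetric] exp_add[symmetric] by (simp add: add_divide_distrib)
    finally show "(\<integral>\<omega>. iexp (\<Sum>i\<in>J. a i * W (g i) \<omega>) \<partial>M)
      = (\<integral>p. iexp (\<Sum>i\<in>J. a i * ((g i \<bullet> e) * fst p + W (?o (g i)) (snd p))) \<partial>(std_normal_distribution \<Otimes>\<^sub>M M))"
      by (simp only: char_W_sum[OF J] G_def)
  qed measurable
  then show ?thesis by (simp add: case_prod_unfold restrict_UNIV)
qed

end

section \<open>Gaussian integration by parts and products of negative powers\<close>

text \<open>The bound is uniform in the shift \<open>c\<close> because the normal density is at most 1: where
  \<open>z + c\<close> is within distance 1 of zero, the power is integrable against Lebesgue measure, and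
  elsewhere it is at most 1.\<close>

lemma nn_integral_shifted_powr_std_normal:
  assumes p: "0 \<le> p" "p < 1"
  shows "\<exists>C<\<infinity>. \<forall>c. (\<integral>\<^sup>+z. ennreal (\<bar>z + c\<bar> powr (-p)) \<partial>std_normal_distribution) \<le> C"
proof -
  define I where "I = (\<integral>\<^sup>+x. ennreal (\<bar>x\<bar> powr (-p)) * indicator {0..1} x \<partial>lborel)"
  have "I = (\<integral>\<^sup>+x. ennreal (x powr (-p)) * indicator {0..1} x \<partial>lborel)"
    unfolding I_def by (intro nn_integral_cong) (auto split: split_indicator)
  also have "\<dots> = ennreal (1 powr (-p + 1) / (-p + 1))"
    by (rule nn_integral_has_integral_lebesgue') (use has_integral_powr_from_0[of "-p" 1] p in simp_all)
  finally have I: "I < \<infinity>" by simp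
  have d: "std_normal_density z \<le> 1" for z
  proof -
    have "1 \<le> sqrt (2 * pi)" using pi_ge_two by (intro real_le_rsqrt) auto
    then show ?thesis unfolding std_normal_density_def
      by (intro mult_le_one) (auto simp: field_simps)
  qed
  have "(\<integral>\<^sup>+z. ennreal (\<bar>z + c\<bar> powr (-p)) \<partial>std_normal_distribution) \<le> I + I + 1" for c
  proof -
    have abs_flip: "\<bar>- c - x\<bar> = \<bar>x + c\<bar>" "- x - c = - c - x" for x by linarith+
    have "(\<integral>\<^sup>+z. ennreal (\<bar>z + c\<bar> powr (-p)) \<partial>std_normal_distribution)
      \<le> (\<integral>\<^sup>+z. ennreal (\<bar>z + c\<bar> powr (-p)) * indicator {0..1} (z + c)
          + ennreal (\<bar>z + c\<bar> powr (-p)) * indicator {0..1} (- (z + c)) + ennreal (std_normal_density z) \<partial>lborel)"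
    proof (subst nn_integral_density, simp, simp, rule nn_integral_mono)
      fix z
      consider "0 \<le> z + c" "z + c \<le> 1" | "-1 \<le> z + c" "z + c \<le> 0" | "1 < \<bar>z + c\<bar>" by linarith
      then show "ennreal (std_normal_density z) * ennreal (\<bar>z + c\<bar> powr (-p))
        \<le> ennreal (\<bar>z + c\<bar> powr (-p)) * indicator {0..1} (z + c)
          + ennreal (\<bar>z + c\<bar> powr (-p)) * indicator {0..1} (- (z + c)) + ennreal (std_normal_density z)"
      proof cases
        case 1
        have "ennreal (std_normal_density z) * ennreal (\<bar>z + c\<bar> powr (-p)) \<le> 1 * ennreal (\<bar>z + c\<bar> powr (-p))"
          by (intro mult_right_mono) (use d[of z] in auto)
        also have "\<dots> \<le> 1 * ennreal (\<bar>z + c\<bar> powr (-p)) * indicator {0..1} (z + c)" using 1 by simp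
        finally show ?thesis by (simp add: add_increasing2)
      next
        case 2
        have "ennreal (std_normal_density z) * ennreal (\<bar>z + c\<bar> powr (-p)) \<le> 1 * ennreal (\<bar>z + c\<bar> powr (-p))"
          by (intro mult_right_mono) (use d[of z] in auto)
        also have "\<dots> \<le> 1 * ennreal (\<bar>z + c\<bar> powr (-p)) * indicator {0..1} (- (z + c))" using 2 by simp
        finally show ?thesis by (simp add: add_increasing2 add_increasing)
      next
        case 3
        have "\<bar>z + c\<bar> powr (-p) \<le> \<bar>z + c\<bar> powr 0" using 3 p by (intro powr_mono) auto
        then have "ennreal (\<bar>z + c\<bar> powr (-p)) \<le> 1" using 3 by (auto split: if_splits)
        then have "ennreal (std_normal_density z) * ennreal (\<bar>z + c\<bar> powr (-p)) \<le> ennreal (std_normal_density z) * 1"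
          by (intro mult_left_mono) auto
        then show ?thesis by (simp add: add_increasing)
      qed
    qed
    also have "\<dots> = (\<integral>\<^sup>+z. ennreal (\<bar>z + c\<bar> powr (-p)) * indicator {0..1} (z + c) \<partial>lborel)
        + (\<integral>\<^sup>+z. ennreal (\<bar>z + c\<bar> powr (-p)) * indicator {0..1} (- (z + c)) \<partial>lborel)
        + (\<integral>\<^sup>+z. ennreal (std_normal_density z) \<partial>lborel)"
      by (subst nn_integral_add, simp, simp, subst nn_integral_add, simp_all)
    also have "(\<integral>\<^sup>+z. ennreal (\<bar>z + c\<bar> powr (-p)) * indicator {0..1} (z + c) \<partial>lborel) = I"
      unfolding I_def by (subst nn_integral_real_affine[of _ 1 c]) (simp_all add: add.commute)
    also have "(\<integral>\<^sup>+z. ennreal (\<bar>z + c\<bar> powr (-p)) * indicator {0..1} (- (z + c)) \<partial>lborel) = I"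
      unfolding I_def
      by (subst nn_integral_real_affine[of "\<lambda>x. ennreal (\<bar>x\<bar> powr (-p)) * indicator {0..1} x" "-1" "-c"])
        (simp_all add: abs_flip(1), simp add: abs_flip(2))
    also have "(\<integral>\<^sup>+z. ennreal (std_normal_density z) \<partial>lborel) = 1"
      by (subst nn_integral_eq_integral) auto
    finally show ?thesis .
  qed
  moreover have "I + I + 1 < \<infinity>" using I by (simp add: less_top)
  ultimately show ?thesis by blast
qed

text \<open>Stein's identity on the line: the derivative of \<open>\<psi>\<close> times the normal density is
  \<open>\<psi>'\<close> minus \<open>z * \<psi>\<close>, times the density, and its integral vanishes.\<close>

lemma stein_std_normal:
  fixes \<psi> \<psi>' :: "real \<Rightarrow> real"
  assumes deriv: "\<And>z. (\<psi> has_real_derivative \<psi>' z) (at z)" and cont: "continuous_on UNIV \<psi>'"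
    and bound: "\<And>z. \<bar>\<psi> z\<bar> \<le> B" "\<And>z. \<bar>\<psi>' z\<bar> \<le> B"
  shows "(\<integral>z. z * \<psi> z \<partial>std_normal_distribution) = (\<integral>z. \<psi>' z \<partial>std_normal_distribution)"
proof -
  let ?\<phi> = std_normal_density
  have c: "continuous_on UNIV \<psi>"
    using deriv DERIV_isCont by (auto simp: continuous_on_eq_continuous_at)
  have [measurable]: "\<psi> \<in> borel_measurable borel" "\<psi>' \<in> borel_measurable borel"
    using c cont by (auto intro: borel_measurable_continuous_onI)
  have d\<phi>: "(?\<phi> has_real_derivative - z * ?\<phi> z) (at z)" for z
    unfolding std_normal_density_def by (auto intro!: derivative_eq_intros simp: field_simps)
  have c\<phi>: "continuous_on UNIV ?\<phi>"
    using d\<phi> DERIV_isCont by (auto simp: continuous_on_eq_continuous_at)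
  have i1: "integrable lborel (\<lambda>z. \<psi>' z * ?\<phi> z)"
    by (rule Bochner_Integration.integrable_bound[of _ "\<lambda>z. B * ?\<phi> z"])
      (use bound(2) order_trans[OF abs_ge_zero bound(2)] in \<open>auto simp: abs_mult intro!: mult_right_mono\<close>)
  have i2: "integrable lborel (\<lambda>z. \<psi> z * (z * ?\<phi> z))"
  proof (rule Bochner_Integration.integrable_bound[of _ "\<lambda>z. B * (?\<phi> z * \<bar>z\<bar> ^ 1)"])
    show "integrable lborel (\<lambda>z. B * (?\<phi> z * \<bar>z\<bar> ^ 1))"
      by (rule integrable_mult_right[OF integrable_std_normal_moment_abs])
    have "norm (\<psi> z * (z * ?\<phi> z)) \<le> norm (B * (?\<phi> z * \<bar>z\<bar> ^ 1))" for z
    proof -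
      have "0 \<le> B" using order_trans[OF abs_ge_zero bound(1)] .
      then show ?thesis
        using mult_right_mono[OF bound(1)[of z], of "\<bar>z\<bar> * ?\<phi> z"] by (simp add: abs_mult mult_ac)
    qed
    then show "AE z in lborel. norm (\<psi> z * (z * ?\<phi> z)) \<le> norm (B * (?\<phi> z * \<bar>z\<bar> ^ 1))" by simp
  qed measurable
  have lim: "((\<lambda>z. \<psi> z * ?\<phi> z) \<longlongrightarrow> 0) F" if F: "filterlim (\<lambda>z. z\<^sup>2) at_top F" for F
  proof (rule Lim_null_comparison)
    show "\<forall>\<^sub>F z in F. norm (\<psi> z * ?\<phi> z) \<le> B * ?\<phi> z"
      using bound(1) by (auto simp: abs_mult intro!: always_eventually mult_right_mono)
    have "filterlim (\<lambda>z. - (1/2 * z\<^sup>2)) at_bot F"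
      by (intro filterlim_compose[OF filterlim_uminus_at_bot_at_top]
          filterlim_tendsto_pos_mult_at_top[OF tendsto_const _ F]) simp
    then have "((\<lambda>z. exp (- (1/2 * z\<^sup>2))) \<longlongrightarrow> 0) F"
      by (rule filterlim_compose[OF exp_at_bot])
    then have "((\<lambda>z. B * (1 / sqrt (2 * pi) * exp (- (1/2 * z\<^sup>2)))) \<longlongrightarrow> B * (1 / sqrt (2 * pi) * 0)) F"
      by (intro tendsto_mult tendsto_const)
    then show "((\<lambda>z. B * ?\<phi> z) \<longlongrightarrow> 0) F" by (simp add: std_normal_density_def)
  qed
  have "(LBINT z=-\<infinity>..\<infinity>. \<psi>' z * ?\<phi> z - \<psi> z * (z * ?\<phi> z)) = 0 - 0"
  proof (rule interval_integral_FTC_integrable)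
    show "((\<lambda>z. \<psi> z * ?\<phi> z) has_vector_derivative \<psi>' z * ?\<phi> z - \<psi> z * (z * ?\<phi> z)) (at z)" for z
      unfolding has_real_derivative_iff_has_vector_derivative[symmetric]
      by (rule derivative_eq_intros deriv d\<phi> refl)+ simp
    show "isCont (\<lambda>z. \<psi>' z * ?\<phi> z - \<psi> z * (z * ?\<phi> z)) z" for z
      using c cont c\<phi> by (auto intro!: continuous_intros simp: continuous_on_eq_continuous_at)
    show "set_integrable lborel (einterval (-\<infinity>) \<infinity>) (\<lambda>z. \<psi>' z * ?\<phi> z - \<psi> z * (z * ?\<phi> z))"
      using i1 i2 by (simp add: set_integrable_def)
    show "(((\<lambda>z. \<psi> z * ?\<phi> z) \<circ> real_of_ereal) \<longlongrightarrow> 0) (at_right (-\<infinity>))"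
      unfolding ereal_tendsto_simps
      by (rule lim) (intro filterlim_pow_at_bot_even filterlim_ident, simp_all)
    show "(((\<lambda>z. \<psi> z * ?\<phi> z) \<circ> real_of_ereal) \<longlongrightarrow> 0) (at_left \<infinity>)"
      unfolding ereal_tendsto_simps
      by (rule lim) (intro filterlim_pow_at_top filterlim_ident, simp)
  qed simp
  then have "(\<integral>z. \<psi>' z * ?\<phi> z - \<psi> z * (z * ?\<phi> z) \<partial>lborel) = 0"
    by (simp add: interval_lebesgue_integral_def set_lebesgue_integral_def)
  then have "(\<integral>z. \<psi>' z * ?\<phi> z \<partial>lborel) = (\<integral>z. \<psi> z * (z * ?\<phi> z) \<partial>lborel)"
    using i1 i2 by simp
  then show ?thesis
    by (simp add: integral_density mult_ac)
qed

lemma (in pair_sigma_finite) AE_pair_snd: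
  assumes "AE y in M2. Q y" "Measurable.pred M2 Q"
  shows "AE p in M1 \<Otimes>\<^sub>M M2. Q (snd p)"
  by (rule AE_pair_measure) (use assms in \<open>auto simp del: space_pair_measure\<close>)

context isonormal_process
begin

lemma pair_std_normal: "pair_prob_space std_normal_distribution M"
  ..

lemma W_norm_scale: "norm e = 1 \<Longrightarrow> w = s *\<^sub>R e \<Longrightarrow> AE \<omega> in M. W w \<omega> = s * W e \<omega>"
  using W_scale by simp

text \<open>The directional derivative along \<open>w\<close> of \<open>\<Phi>(W g)\<close> is dual to multiplication by \<open>W w\<close>. Splitting
  along \<open>w / norm w\<close> turns this into \<open>stein_std_normal\<close> in the inner integral; accordingly,
  smoothness of \<open>\<Phi>\<close> is required only on the lines in the direction \<open>(g i \<bullet> w)\<close>.\<close>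

lemma gaussian_integration_by_parts:
  fixes g :: "'i \<Rightarrow> 'h" and \<Phi> \<Phi>' :: "('i \<Rightarrow> real) \<Rightarrow> real"
  assumes [measurable]: "\<Phi> \<in> borel_measurable (PiM UNIV (\<lambda>_. borel))" "\<Phi>' \<in> borel_measurable (PiM UNIV (\<lambda>_. borel))"
    and deriv: "\<And>x z. ((\<lambda>z. \<Phi> (\<lambda>i. x i + z * (g i \<bullet> w))) has_real_derivative \<Phi>' (\<lambda>i. x i + z * (g i \<bullet> w))) (at z)"
    and cont: "\<And>x. continuous_on UNIV (\<lambda>z. \<Phi>' (\<lambda>i. x i + z * (g i \<bullet> w)))"
    and bound: "\<And>x. \<bar>\<Phi> x\<bar> \<le> B" "\<And>x. \<bar>\<Phi>' x\<bar> \<le> B"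
  shows "(\<integral>\<omega>. \<Phi> (\<lambda>i. W (g i) \<omega>) * W w \<omega> \<partial>M) = (\<integral>\<omega>. \<Phi>' (\<lambda>i. W (g i) \<omega>) \<partial>M)"
proof -
  have mg: "(\<lambda>\<omega> i. W (g i) \<omega>) \<in> measurable M (PiM UNIV (\<lambda>_. borel))"
    by (auto intro!: measurable_PiM_single')
  have [measurable]: "(\<lambda>\<omega>. \<Phi> (\<lambda>i. W (g i) \<omega>)) \<in> borel_measurable M"
    by (rule measurable_compose[OF mg]) measurable
  show ?thesis
  proof (cases "w = 0")
    case True
    have "((\<lambda>z. \<Phi> x) has_real_derivative \<Phi>' x) (at 0)" for x
      using deriv[of x 0] True by simp
    then have "\<Phi>' x = 0" for x
      using DERIV_unique DERIV_const by blast
    moreover have "(\<integral>\<omega>. \<Phi> (\<lambda>i. W (g i) \<omega>) * W w \<omega> \<partial>M) = (\<integral>\<omega>. 0 \<partial>M)"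
    proof (rule integral_cong_AE)
      show "AE \<omega> in M. \<Phi> (\<lambda>i. W (g i) \<omega>) * W w \<omega> = 0"
        using W_zero True by auto
    qed measurable
    ultimately show ?thesis by simp
  next
    case False
    define s where "s = norm w"
    define e where "e = w /\<^sub>R s"
    have s: "s > 0" using False by (simp add: s_def)
    have e: "norm e = 1" and w: "w = s *\<^sub>R e" using s by (auto simp: e_def s_def)
    have e2: "e \<bullet> e = 1" using e by (simp add: norm_eq_1)
    interpret P: pair_prob_space std_normal_distribution M by (rule pair_std_normal)
    let ?P = "std_normal_distribution \<Otimes>\<^sub>M M"
    let ?o = "\<lambda>x. x - (x \<bullet> e) *\<^sub>R e"
    let ?x = "\<lambda>\<omega> i. W (?o (g i)) \<omega>"
    let ?y = "\<lambda>z \<omega> i. W (?o (g i)) \<omega> + (z / s) * (g i \<bullet> w)"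
    have y: "(\<lambda>i. (g i \<bullet> e) * z + W (?o (g i)) \<omega>) = ?y z \<omega>" for z \<omega>
      using s by (simp add: w fun_eq_iff)
    have my[measurable]: "(\<lambda>(z, \<omega>). ?y z \<omega>) \<in> measurable ?P (PiM UNIV (\<lambda>_. borel))"
      by (auto intro!: measurable_PiM_single' simp: case_prod_unfold)
    \<comment> \<open>\<open>w\<close> itself joins the family, as the coordinate \<open>None\<close>\<close>
  define g' where "g' = case_option w g"
    have some: "(\<lambda>y i. y (Some i)) \<in> measurable (PiM UNIV (\<lambda>_. borel :: real measure)) (PiM (UNIV :: 'i set) (\<lambda>_. borel))"
      by (auto intro!: measurable_PiM_single')
    have [measurable]: "(\<lambda>y. \<Phi> (\<lambda>i. y (Some i))) \<in> borel_measurable (PiM UNIV (\<lambda>_. borel))"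
      by (rule measurable_compose[OF some]) measurable
    have "(\<integral>\<omega>. \<Phi> (\<lambda>i. W (g i) \<omega>) * W w \<omega> \<partial>M)
        = (\<integral>y. \<Phi> (\<lambda>i. y (Some i)) * y None \<partial>distr M (PiM UNIV (\<lambda>_. borel)) (\<lambda>\<omega> i. W (g' i) \<omega>))"
      by (subst integral_distr) (auto simp: g'_def intro!: measurable_PiM_single')
    also have "\<dots> = (\<integral>p. \<Phi> (?y (fst p) (snd p)) * (s * fst p + W (?o w) (snd p)) \<partial>?P)"
      unfolding distr_split_unit[OF e]
      by (subst integral_distr)
        (auto simp: g'_def case_prod_unfold y w e2 intro!: measurable_PiM_single')
    also have "\<dots> = (\<integral>p. \<Phi> (?y (fst p) (snd p)) * (s * fst p) \<partial>?P)"
    proof (rule integral_cong_AE)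
      have "AE p in ?P. W 0 (snd p) = 0" by (rule P.AE_pair_snd[OF W_zero]) measurable
      then show "AE p in ?P. \<Phi> (?y (fst p) (snd p)) * (s * fst p + W (?o w) (snd p)) = \<Phi> (?y (fst p) (snd p)) * (s * fst p)"
        by eventually_elim (simp add: w e2)
    qed (use my in \<open>simp_all add: case_prod_unfold\<close>)
    also have "\<dots> = (\<integral>\<omega>. (\<integral>z. \<Phi> (?y z \<omega>) * (s * z) \<partial>std_normal_distribution) \<partial>M)"
    proof -
      have "integrable ?P (\<lambda>(z, \<omega>). \<Phi> (?y z \<omega>) * (s * z))"
      proof (rule Bochner_Integration.integrable_bound)
        show "integrable ?P (\<lambda>(z, \<omega>). (B * s * z) * 1)"
          using integrable_std_normal_distribution_moment[of 1]
          by (intro P.integrable_times_pair) auto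
        have "0 \<le> B" using order_trans[OF abs_ge_zero bound(1)] .
        then show "AE p in ?P. norm (case p of (z, \<omega>) \<Rightarrow> \<Phi> (?y z \<omega>) * (s * z)) \<le> norm (case p of (z, \<omega>) \<Rightarrow> (B * s * z) * 1)"
          using bound(1) by (intro AE_I2) (auto simp: split_beta abs_mult mult.assoc intro!: mult_right_mono)
      qed (use my in \<open>simp add: case_prod_unfold\<close>)
      from P.integral_snd[OF this] show ?thesis by (simp add: case_prod_unfold)
    qed
    also have "\<dots> = (\<integral>\<omega>. (\<integral>z. \<Phi>' (?y z \<omega>) \<partial>std_normal_distribution) \<partial>M)"
    proof (rule Bochner_Integration.integral_cong[OF refl])
      fix \<omega>
      have "(\<integral>z. z * \<Phi> (?y z \<omega>) \<partial>std_normal_distribution) = (\<integral>z. \<Phi>' (?y z \<omega>) / s \<partial>std_normal_distribution)"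
      proof (rule stein_std_normal[where B="max B (B / s)"])
        show "((\<lambda>z. \<Phi> (?y z \<omega>)) has_real_derivative \<Phi>' (?y z \<omega>) / s) (at z)" for z
          using DERIV_chain2[OF deriv[of "?x \<omega>" "z / s"] DERIV_cdivide[OF DERIV_ident, of s z]] by simp
        show "continuous_on UNIV (\<lambda>z. \<Phi>' (?y z \<omega>) / s)"
          using s by (intro continuous_intros continuous_on_compose2[OF cont[of "?x \<omega>"]]) auto
        show "\<bar>\<Phi> (?y z \<omega>)\<bar> \<le> max B (B / s)" for z using bound(1) by (simp add: le_max_iff_disj)
        show "\<bar>\<Phi>' (?y z \<omega>) / s\<bar> \<le> max B (B / s)" for z
          using bound(2) s by (simp add: le_max_iff_disj divide_right_mono)
      qed
      moreover have "(\<integral>z. \<Phi> (?y z \<omega>) * (s * z) \<partial>std_normal_distribution) = (\<integral>z. s * (z * \<Phi> (?y z \<omega>)) \<partial>std_normal_distribution)"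
        by (intro Bochner_Integration.integral_cong refl) simp
      ultimately show "(\<integral>z. \<Phi> (?y z \<omega>) * (s * z) \<partial>std_normal_distribution) = (\<integral>z. \<Phi>' (?y z \<omega>) \<partial>std_normal_distribution)"
        using s by simp
    qed
    also have "\<dots> = (\<integral>p. \<Phi>' (?y (fst p) (snd p)) \<partial>?P)"
    proof -
      have "integrable ?P (\<lambda>(z, \<omega>). \<Phi>' (?y z \<omega>))"
        by (rule P.integrable_const_bound[where B=B]) (use my bound(2) in \<open>auto simp: case_prod_unfold\<close>)
      from P.integral_snd[OF this] show ?thesis by (simp add: case_prod_unfold)
    qed
    also have "\<dots> = (\<integral>y. \<Phi>' y \<partial>distr M (PiM UNIV (\<lambda>_. borel)) (\<lambda>\<omega> i. W (g i) \<omega>))"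
      unfolding distr_split_unit[OF e]
      by (subst integral_distr) (auto simp: case_prod_unfold y intro!: measurable_PiM_single')
    also have "\<dots> = (\<integral>\<omega>. \<Phi>' (\<lambda>i. W (g i) \<omega>) \<partial>M)"
      by (subst integral_distr) (auto intro!: measurable_PiM_single')
    finally show ?thesis .
  qed
qed

text \<open>Orthonormal vectors give independent normal variables, so the integral factorizes. The
  induction integrates out one vector at a time by \<open>distr_split_unit\<close>, applied to the
  family of all vectors of the space.\<close>

lemma nn_integral_prod_powr_finite:
  assumes p: "0 \<le> p" "p < 1" and "finite E"
    and orth: "\<And>x. x \<in> E \<Longrightarrow> norm x = 1" "\<And>x y. x \<in> E \<Longrightarrow> y \<in> E \<Longrightarrow> x \<noteq> y \<Longrightarrow> x \<bullet> y = 0"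
  shows "(\<integral>\<^sup>+\<omega>. (\<Prod>e\<in>E. ennreal (\<bar>W e \<omega> + c e\<bar> powr (-p))) \<partial>M) < \<infinity>"
  using \<open>finite E\<close> orth
proof (induction E rule: finite_induct)
  case empty
  then show ?case by (simp add: emeasure_space_1)
next
  case (insert e E)
  interpret P: pair_prob_space std_normal_distribution M by (rule pair_std_normal)
  obtain C where C: "C < \<infinity>" "\<And>c. (\<integral>\<^sup>+z. ennreal (\<bar>z + c\<bar> powr (-p)) \<partial>std_normal_distribution) \<le> C"
    using nn_integral_shifted_powr_std_normal[OF p] by blast
  have e: "norm e = 1" and e2: "e \<bullet> e = 1"
    using insert.prems(1)[of e] by (auto simp: power2_norm_eq_inner[symmetric])
  let ?o = "\<lambda>x. x - (x \<bullet> e) *\<^sub>R e"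
  let ?\<Psi> = "\<lambda>y. \<Prod>x\<in>insert e E. ennreal (\<bar>y x + c x\<bar> powr (-p))"
  have eE: "x \<bullet> e = 0" if "x \<in> E" for x using insert.prems(2)[of x e] insert.hyps that by auto
  have "(\<integral>\<^sup>+\<omega>. ?\<Psi> (\<lambda>x. W x \<omega>) \<partial>M) = (\<integral>\<^sup>+y. ?\<Psi> y \<partial>distr M (PiM UNIV (\<lambda>_. borel)) (\<lambda>\<omega> x. W x \<omega>))"
    by (subst nn_integral_distr) (auto intro!: measurable_PiM_single')
  also have "\<dots> = (\<integral>\<^sup>+p. ?\<Psi> (\<lambda>x. (x \<bullet> e) * fst p + W (?o x) (snd p)) \<partial>(std_normal_distribution \<Otimes>\<^sub>M M))"
    unfolding distr_split_unit[OF e, of "\<lambda>x. x"]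
    by (subst nn_integral_distr) (auto simp: case_prod_unfold intro!: measurable_PiM_single')
  also have "\<dots> = (\<integral>\<^sup>+\<omega>. (\<integral>\<^sup>+z. ?\<Psi> (\<lambda>x. (x \<bullet> e) * z + W (?o x) \<omega>) \<partial>std_normal_distribution) \<partial>M)"
    by (subst P.nn_integral_snd[symmetric]) auto
  also have "\<dots> \<le> (\<integral>\<^sup>+\<omega>. C * (\<Prod>x\<in>E. ennreal (\<bar>W x \<omega> + c x\<bar> powr (-p))) \<partial>M)"
  proof (rule nn_integral_mono)
    fix \<omega>
    have "?\<Psi> (\<lambda>x. (x \<bullet> e) * z + W (?o x) \<omega>)
      = ennreal (\<bar>z + (W 0 \<omega> + c e)\<bar> powr (-p)) * (\<Prod>x\<in>E. ennreal (\<bar>W x \<omega> + c x\<bar> powr (-p)))" for z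
    proof -
      have "?\<Psi> (\<lambda>x. (x \<bullet> e) * z + W (?o x) \<omega>) = ennreal (\<bar>(e \<bullet> e) * z + W (?o e) \<omega> + c e\<bar> powr (-p))
        * (\<Prod>x\<in>E. ennreal (\<bar>(x \<bullet> e) * z + W (?o x) \<omega> + c x\<bar> powr (-p)))"
        using insert.hyps by simp
      also have "(\<Prod>x\<in>E. ennreal (\<bar>(x \<bullet> e) * z + W (?o x) \<omega> + c x\<bar> powr (-p))) = (\<Prod>x\<in>E. ennreal (\<bar>W x \<omega> + c x\<bar> powr (-p)))"
        by (intro prod.cong refl) (simp add: eE)
      finally show ?thesis by (simp add: e2 add.assoc)
    qed
    then show "(\<integral>\<^sup>+z. ?\<Psi> (\<lambda>x. (x \<bullet> e) * z + W (?o x) \<omega>) \<partial>std_normal_distribution)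
      \<le> C * (\<Prod>x\<in>E. ennreal (\<bar>W x \<omega> + c x\<bar> powr (-p)))"
      using C(2)[of "W 0 \<omega> + c e"] by (simp add: nn_integral_multc mult_right_mono)
  qed
  also have "\<dots> = C * (\<integral>\<^sup>+\<omega>. (\<Prod>x\<in>E. ennreal (\<bar>W x \<omega> + c x\<bar> powr (-p))) \<partial>M)"
    by (rule nn_integral_cmult) measurable
  also have "\<dots> < \<infinity>"
    using insert.IH insert.prems C(1) by (auto simp: ennreal_mult_less_top)
  finally show ?case .
qed

end

section \<open>The Cameron--Martin shift\<close>

lemma normal_density_exp_tilt:
  "std_normal_density z * exp (s * z - s\<^sup>2 / 2) = normal_density s 1 z"
  unfolding normal_density_def by (simp add: exp_add[symmetric] power2_eq_square field_simps)

lemma integral_exp_tilt_std_normal: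
  fixes f :: "real \<Rightarrow> complex"
  assumes [measurable]: "f \<in> borel_measurable borel"
  shows "(\<integral>z. exp (s * z - s\<^sup>2 / 2) *\<^sub>R f (z - s) \<partial>std_normal_distribution) = (\<integral>z. f z \<partial>std_normal_distribution)"
proof -
  have "(\<integral>z. exp (s * z - s\<^sup>2 / 2) *\<^sub>R f (z - s) \<partial>std_normal_distribution)
      = (\<integral>z. normal_density s 1 z *\<^sub>R f (z - s) \<partial>lborel)"
    by (subst integral_density) (simp_all add: normal_density_exp_tilt)
  also have "\<dots> = (\<integral>z. normal_density s 1 (s + 1 * z) *\<^sub>R f (s + 1 * z - s) \<partial>lborel)"
    by (subst lborel_integral_real_affine[of 1 _ s]) simp_all
  also have "\<dots> = (\<integral>z. f z \<partial>std_normal_distribution)"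
    by (simp add: integral_density normal_density_def)
  finally show ?thesis .
qed

lemma nn_integral_exp_tilt_std_normal:
  "(\<integral>\<^sup>+z. ennreal (exp (s * z - s\<^sup>2 / 2)) \<partial>std_normal_distribution) = 1"
proof -
  have "(\<integral>\<^sup>+z. ennreal (exp (s * z - s\<^sup>2 / 2)) \<partial>std_normal_distribution) = (\<integral>\<^sup>+z. ennreal (normal_density s 1 z) \<partial>lborel)"
    by (subst nn_integral_density) (auto simp: ennreal_mult[symmetric] normal_density_exp_tilt)
  also have "\<dots> = 1" by (subst nn_integral_eq_integral) auto
  finally show ?thesis .
qed

context isonormal_process
begin

lemma nn_integral_W_unit:
  assumes e: "norm e = 1" and [measurable]: "f \<in> borel_measurable borel"
  shows "(\<integral>\<^sup>+\<omega>. f (W e \<omega>) \<partial>M) = (\<integral>\<^sup>+z. f z \<partial>std_normal_distribution)"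
  unfolding distr_W_unit[OF e, symmetric] by (subst nn_integral_distr) auto

lemma
  shows integrable_W_square: "integrable M (\<lambda>\<omega>. (W g \<omega>)\<^sup>2)"
    and integral_W_square: "(\<integral>\<omega>. (W g \<omega>)\<^sup>2 \<partial>M) = (norm g)\<^sup>2"
proof -
  have "integrable M (\<lambda>\<omega>. (W g \<omega>)\<^sup>2) \<and> (\<integral>\<omega>. (W g \<omega>)\<^sup>2 \<partial>M) = (norm g)\<^sup>2"
  proof (cases "g = 0")
    case True
    have ae: "AE \<omega> in M. (W g \<omega>)\<^sup>2 = 0" using W_zero True by auto
    have "integrable M (\<lambda>\<omega>. (W g \<omega>)\<^sup>2) \<longleftrightarrow> integrable M (\<lambda>\<omega>. 0::real)"
      by (rule integrable_cong_AE) (use ae in auto)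
    moreover have "(\<integral>\<omega>. (W g \<omega>)\<^sup>2 \<partial>M) = (\<integral>\<omega>. 0 \<partial>M)"
      by (rule integral_cong_AE) (use ae in auto)
    ultimately show ?thesis using True by simp
  next
    case False
    define e where "e = g /\<^sub>R norm g"
    have e: "norm e = 1" and g: "g = norm g *\<^sub>R e" using False by (auto simp: e_def)
    have ae: "AE \<omega> in M. (W g \<omega>)\<^sup>2 = (norm g)\<^sup>2 * (W e \<omega>)\<^sup>2"
      using W_norm_scale[OF e g] by eventually_elim (simp add: power_mult_distrib)
    have "integrable (distr M borel (W e)) (\<lambda>z. z\<^sup>2)"
      unfolding distr_W_unit[OF e] by (rule integrable_std_normal_distribution_moment)
    then have i: "integrable M (\<lambda>\<omega>. (W e \<omega>)\<^sup>2)"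
      by (subst (asm) integrable_distr_eq) auto
    have "(\<integral>z. z\<^sup>2 \<partial>distr M borel (W e)) = 1"
      unfolding distr_W_unit[OF e] using std_normal_distribution_even_moments(1)[of 1] by simp
    then have j: "(\<integral>\<omega>. (W e \<omega>)\<^sup>2 \<partial>M) = 1"
      by (subst (asm) integral_distr) auto
    have "integrable M (\<lambda>\<omega>. (W g \<omega>)\<^sup>2) \<longleftrightarrow> integrable M (\<lambda>\<omega>. (norm g)\<^sup>2 * (W e \<omega>)\<^sup>2)"
      by (rule integrable_cong_AE) (use ae in auto)
    moreover have "(\<integral>\<omega>. (W g \<omega>)\<^sup>2 \<partial>M) = (\<integral>\<omega>. (norm g)\<^sup>2 * (W e \<omega>)\<^sup>2 \<partial>M)"
      by (rule integral_cong_AE) (use ae in auto)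
    ultimately show ?thesis using i j by simp
  qed
  then show "integrable M (\<lambda>\<omega>. (W g \<omega>)\<^sup>2)" "(\<integral>\<omega>. (W g \<omega>)\<^sup>2 \<partial>M) = (norm g)\<^sup>2" by auto
qed

lemma AE_W_affine_neq_zero:
  assumes "e \<noteq> 0"
  shows "AE \<omega> in M. W e \<omega> + c \<noteq> 0"
proof -
  define u where "u = e /\<^sub>R norm e"
  have u: "norm u = 1" and e: "e = norm e *\<^sub>R u" using assms by (auto simp: u_def)
  have "AE z in distr M borel (W u). z \<noteq> - c / norm e"
    unfolding distr_W_unit[OF u] AE_std_normal_iff_lborel by (rule AE_lborel_singleton)
  then have "AE \<omega> in M. W u \<omega> \<noteq> - c / norm e"
    by (subst (asm) AE_distr_iff) auto
  with W_norm_scale[OF u e] show ?thesis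
    by eventually_elim (use assms in \<open>auto simp: field_simps add_eq_0_iff\<close>)
qed

text \<open>After splitting along \<open>v\<close>, the density depends on the one-dimensional variable \<open>z\<close> only, and on the line
  tilting the normal law by \<open>exp (s * z - s\<^sup>2 / 2)\<close> is translating it by \<open>s\<close>.\<close>

lemma cameron_martin:
  "isonormal_process (density M (\<lambda>\<omega>. ennreal (exp (W v \<omega> - (norm v)\<^sup>2 / 2)))) (\<lambda>g \<omega>. W g \<omega> - g \<bullet> v)"
proof (cases "v = 0")
  case True
  have "density M (\<lambda>\<omega>. ennreal (exp (W v \<omega> - (norm v)\<^sup>2 / 2))) = density M (\<lambda>\<omega>. 1)"
    by (rule density_cong) (use W_zero True in auto)
  then show ?thesis using True isonormal_process_axioms by (simp add: density_1)
next
  case False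
  define s where "s = norm v"
  define e where "e = v /\<^sub>R s"
  have s: "s > 0" using False by (simp add: s_def)
  have e: "norm e = 1" and v: "v = s *\<^sub>R e" using s by (auto simp: e_def s_def)
  have e2: "e \<bullet> e = 1" using e by (simp add: norm_eq_1)
  interpret P: pair_prob_space std_normal_distribution M by (rule pair_std_normal)
  let ?P = "std_normal_distribution \<Otimes>\<^sub>M M"
  let ?D = "density M (\<lambda>\<omega>. ennreal (exp (W v \<omega> - (norm v)\<^sup>2 / 2)))"
  let ?o = "\<lambda>x. x - (x \<bullet> e) *\<^sub>R e"
  have Wv: "AE \<omega> in M. W v \<omega> = s * W e \<omega>" by (rule W_norm_scale[OF e v])
  have "emeasure ?D (space ?D) = (\<integral>\<^sup>+\<omega>. ennreal (exp (W v \<omega> - (norm v)\<^sup>2 / 2)) \<partial>M)"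
    by (simp add: emeasure_density cong: nn_integral_cong)
  also have "\<dots> = (\<integral>\<^sup>+\<omega>. ennreal (exp (s * W e \<omega> - s\<^sup>2 / 2)) \<partial>M)"
    by (rule nn_integral_cong_AE) (use Wv in \<open>auto simp: s_def\<close>)
  also have "\<dots> = 1"
    by (subst nn_integral_W_unit[OF e]) (simp_all add: nn_integral_exp_tilt_std_normal)
  finally have prob: "prob_space ?D" by (rule prob_spaceI)
  show ?thesis
  proof (rule isonormal_process.intro[OF prob isonormal_process_axioms.intro])
    show "(\<lambda>\<omega>. W g \<omega> - g \<bullet> v) \<in> borel_measurable ?D" for g by simp
    show "AE \<omega> in ?D. W (a *\<^sub>R g + b *\<^sub>R h) \<omega> - (a *\<^sub>R g + b *\<^sub>R h) \<bullet> v = a * (W g \<omega> - g \<bullet> v) + b * (W h \<omega> - h \<bullet> v)"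
      for a b g h
    proof (subst AE_density)
      show "AE \<omega> in M. 0 < ennreal (exp (W v \<omega> - (norm v)\<^sup>2 / 2)) \<longrightarrow>
        W (a *\<^sub>R g + b *\<^sub>R h) \<omega> - (a *\<^sub>R g + b *\<^sub>R h) \<bullet> v = a * (W g \<omega> - g \<bullet> v) + b * (W h \<omega> - h \<bullet> v)"
        using W_linear[of a g b h] by eventually_elim (simp add: inner_add_left algebra_simps)
    qed simp
    show "(\<integral>\<omega>. iexp (W g \<omega> - g \<bullet> v) \<partial>?D) = complex_of_real (exp (- (norm g)\<^sup>2 / 2))" for g
    proof -
      let ?g = "case_bool v g"
      have "(\<integral>\<omega>. iexp (W g \<omega> - g \<bullet> v) \<partial>?D) = (\<integral>\<omega>. exp (W v \<omega> - s\<^sup>2 / 2) *\<^sub>R iexp (W g \<omega> - g \<bullet> v) \<partial>M)"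
        by (subst integral_density) (auto simp: s_def)
      also have "\<dots> = (\<integral>y. exp (y True - s\<^sup>2 / 2) *\<^sub>R iexp (y False - g \<bullet> v)
          \<partial>distr M (PiM UNIV (\<lambda>_. borel)) (\<lambda>\<omega> i. W (?g i) \<omega>))"
        by (subst integral_distr) (auto intro!: measurable_PiM_single')
      also have "\<dots> = (\<integral>p. exp (s * fst p + W (?o v) (snd p) - s\<^sup>2 / 2) *\<^sub>R iexp ((g \<bullet> e) * fst p + W (?o g) (snd p) - g \<bullet> v) \<partial>?P)"
        unfolding distr_split_unit[OF e]
        by (subst integral_distr) (auto simp: case_prod_unfold v e2 intro!: measurable_PiM_single')
      also have "\<dots> = (\<integral>(z, \<omega>). (exp (s * z - s\<^sup>2 / 2) *\<^sub>R iexp ((g \<bullet> e) * (z - s))) * iexp (W (?o g) \<omega>) \<partial>?P)"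
      proof (rule integral_cong_AE)
        have "AE p in ?P. W 0 (snd p) = 0" by (rule P.AE_pair_snd[OF W_zero]) measurable
        then show "AE p in ?P. exp (s * fst p + W (?o v) (snd p) - s\<^sup>2 / 2) *\<^sub>R iexp ((g \<bullet> e) * fst p + W (?o g) (snd p) - g \<bullet> v)
          = (case p of (z, \<omega>) \<Rightarrow> (exp (s * z - s\<^sup>2 / 2) *\<^sub>R iexp ((g \<bullet> e) * (z - s))) * iexp (W (?o g) \<omega>))"
        proof eventually_elim
          case (elim p)
          have "(g \<bullet> e) * fst p + W (?o g) (snd p) - g \<bullet> v = (g \<bullet> e) * (fst p - s) + W (?o g) (snd p)"
            by (simp add: v algebra_simps)
          moreover have "?o v = 0" by (simp add: v e2)
          ultimately show ?case
            using elim by (simp only: case_prod_unfold iexp_add) simp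
        qed
      qed (simp_all add: case_prod_unfold)
      also have "\<dots> = (\<integral>z. exp (s * z - s\<^sup>2 / 2) *\<^sub>R iexp ((g \<bullet> e) * (z - s)) \<partial>std_normal_distribution) * (\<integral>\<omega>. iexp (W (?o g) \<omega>) \<partial>M)"
      proof (rule P.integral_times_pair)
        show "integrable M (\<lambda>\<omega>. iexp (W (?o g) \<omega>))" by (rule integrable_iexp) simp_all
        show "integrable std_normal_distribution (\<lambda>z. exp (s * z - s\<^sup>2 / 2) *\<^sub>R iexp ((g \<bullet> e) * (z - s)))"
          by (rule integrableI_bounded) (simp_all add: nn_integral_exp_tilt_std_normal)
      qed
      also have "(\<integral>z. exp (s * z - s\<^sup>2 / 2) *\<^sub>R iexp ((g \<bullet> e) * (z - s)) \<partial>std_normal_distribution)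
          = (\<integral>z. iexp ((g \<bullet> e) * z) \<partial>std_normal_distribution)"
        by (rule integral_exp_tilt_std_normal) simp
      also have "\<dots> = complex_of_real (exp (- (g \<bullet> e)\<^sup>2 / 2))"
        using char_std_normal_distribution unfolding char_def by (rule fun_cong)
      also have "(\<integral>\<omega>. iexp (W (?o g) \<omega>) \<partial>M) = complex_of_real (exp (- (norm (?o g))\<^sup>2 / 2))"
        by (rule W_char)
      also have "complex_of_real (exp (- (g \<bullet> e)\<^sup>2 / 2)) * complex_of_real (exp (- (norm (?o g))\<^sup>2 / 2))
        = complex_of_real (exp (- (norm g)\<^sup>2 / 2))"
      proof -
        have "(norm g)\<^sup>2 = (g \<bullet> e)\<^sup>2 + (norm (?o g))\<^sup>2" by (rule norm_orthogonal_split[OF e2])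
        then show ?thesis
          by (simp add: add_divide_distrib flip: of_real_mult exp_add)
      qed
      finally show ?thesis .
    qed
  qed
qed

end

text \<open>Linearity holds almost surely since the variance of \<open>W (a g + b h) - a W g - b W h\<close>, computed
  from the prescribed covariances, is zero.\<close>

lemma isonormal_imp_isonormal_process:
  assumes "prob_space M" and iso: "isonormal M W"
  shows "isonormal_process M W"
proof -
  interpret prob_space M by fact
  have gauss: "centered_normal M (\<lambda>\<omega>. \<Sum>i\<in>J. a i * W i \<omega>)" if "finite J" for J a
    using iso that by (auto simp: isonormal_def centered_gaussian_family_def)
  have inner: "(\<integral>\<omega>. W h \<omega> * W g \<omega> \<partial>M) = h \<bullet> g" for h g
    using iso by (auto simp: isonormal_def)
  have cn: "centered_normal M (W g)" for g using gauss[of "{g}" "\<lambda>_. 1"] by simp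
  have [measurable]: "W g \<in> borel_measurable M" for g using cn by (auto simp: centered_normal_def)
  have sq: "integrable M (\<lambda>\<omega>. (W g \<omega>)\<^sup>2)" for g
  proof (cases "AE \<omega> in M. W g \<omega> = 0")
    case True
    have "integrable M (\<lambda>\<omega>. (W g \<omega>)\<^sup>2) \<longleftrightarrow> integrable M (\<lambda>\<omega>. 0::real)"
      by (rule integrable_cong_AE) (use True in auto)
    then show ?thesis by simp
  next
    case False
    then obtain \<sigma> where "\<sigma> > 0" and D: "distributed M lborel (W g) (normal_density 0 \<sigma>)"
      using cn by (auto simp: centered_normal_def)
    have "integrable lborel (\<lambda>x. normal_density 0 \<sigma> x * x\<^sup>2)"
      using integrable_normal_moment[OF \<open>\<sigma> > 0\<close>, of 0 2] by simp
    then show ?thesis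
      using distributed_integrable[OF D, of "\<lambda>x. x\<^sup>2"] by simp
  qed
  have prod: "integrable M (\<lambda>\<omega>. W h \<omega> * W g \<omega>)" for h g
  proof (rule Bochner_Integration.integrable_bound)
    show "integrable M (\<lambda>\<omega>. (W h \<omega>)\<^sup>2 + (W g \<omega>)\<^sup>2)" using sq by simp
    show "AE \<omega> in M. norm (W h \<omega> * W g \<omega>) \<le> norm ((W h \<omega>)\<^sup>2 + (W g \<omega>)\<^sup>2)"
      by (intro AE_I2) (simp add: abs_mult_le_sum_squares)
  qed simp
  show ?thesis
  proof (rule isonormal_process.intro[OF \<open>prob_space M\<close> isonormal_process_axioms.intro])
    show "W g \<in> borel_measurable M" for g by simp
    show "AE \<omega> in M. W (a *\<^sub>R g + b *\<^sub>R h) \<omega> = a * W g \<omega> + b * W h \<omega>" for a b g h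
    proof -
      let ?k = "a *\<^sub>R g + b *\<^sub>R h"
      have expand: "(W ?k \<omega> - (a * W g \<omega> + b * W h \<omega>))\<^sup>2
        = W ?k \<omega> * W ?k \<omega> + a\<^sup>2 * (W g \<omega> * W g \<omega>) + b\<^sup>2 * (W h \<omega> * W h \<omega>)
          - 2 * a * (W ?k \<omega> * W g \<omega>) - 2 * b * (W ?k \<omega> * W h \<omega>) + 2 * a * b * (W g \<omega> * W h \<omega>)" for \<omega>
        by (simp add: power2_eq_square algebra_simps)
      have i: "integrable M (\<lambda>\<omega>. (W ?k \<omega> - (a * W g \<omega> + b * W h \<omega>))\<^sup>2)"
        unfolding expand using prod by (intro Bochner_Integration.integrable_add Bochner_Integration.integrable_diff integrable_mult_right)
      have "(\<integral>\<omega>. (W ?k \<omega> - (a * W g \<omega> + b * W h \<omega>))\<^sup>2 \<partial>M)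
        = ?k \<bullet> ?k + a\<^sup>2 * (g \<bullet> g) + b\<^sup>2 * (h \<bullet> h) - 2 * a * (?k \<bullet> g) - 2 * b * (?k \<bullet> h) + 2 * a * b * (g \<bullet> h)"
        unfolding expand using prod by (simp add: inner)
      also have "\<dots> = 0"
        by (simp add: inner_add_left inner_add_right inner_commute[of h g] power2_eq_square algebra_simps)
      finally have "AE \<omega> in M. (W ?k \<omega> - (a * W g \<omega> + b * W h \<omega>))\<^sup>2 = 0"
        using integral_nonneg_eq_0_iff_AE[OF i] by simp
      then show ?thesis by eventually_elim simp
    qed
    show "(\<integral>\<omega>. iexp (W g \<omega>) \<partial>M) = complex_of_real (exp (- (norm g)\<^sup>2 / 2))" for g
    proof (cases "AE \<omega> in M. W g \<omega> = 0")
      case True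
      have "(\<integral>\<omega>. W g \<omega> * W g \<omega> \<partial>M) = (\<integral>\<omega>. 0 \<partial>M)"
        by (rule integral_cong_AE) (use True in auto)
      then have "g = 0" by (simp add: inner)
      moreover have "(\<integral>\<omega>. iexp (W g \<omega>) \<partial>M) = (\<integral>\<omega>. 1 \<partial>M)"
        by (rule integral_cong_AE) (use True in auto)
      ultimately show ?thesis by (simp add: prob_space)
    next
      case False
      then obtain \<sigma> where s: "\<sigma> > 0" and D: "distributed M lborel (W g) (normal_density 0 \<sigma>)"
        using cn by (auto simp: centered_normal_def)
      have "g \<bullet> g = (\<integral>x. normal_density 0 \<sigma> x * x\<^sup>2 \<partial>lborel)"
        using distributed_integral[OF D, of "\<lambda>x. x\<^sup>2"] inner[of g g] by (simp add: power2_eq_square)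
      also have "\<dots> = \<sigma>\<^sup>2"
        using integral_normal_moment_even[OF s, of 0 1] by (simp add: field_simps power2_eq_square)
      finally have "(norm g)\<^sup>2 = \<sigma>\<^sup>2" by (simp add: power2_norm_eq_inner)
      then have ng: "norm g = \<sigma>" using s by simp
      have "distributed M lborel (\<lambda>\<omega>. (W g \<omega> - 0) / \<sigma>) std_normal_density"
        using D s by (subst (asm) normal_standard_normal_convert) auto
      then have "distr M lborel (\<lambda>\<omega>. W g \<omega> / \<sigma>) = std_normal_distribution"
        by (simp add: distributed_def)
      then have "char (distr M lborel (\<lambda>\<omega>. W g \<omega> / \<sigma>)) \<sigma> = complex_of_real (exp (- \<sigma>\<^sup>2 / 2))"
        by (simp add: char_std_normal_distribution)
      moreover have "char (distr M lborel (\<lambda>\<omega>. W g \<omega> / \<sigma>)) \<sigma> = (\<integral>\<omega>. iexp (W g \<omega>) \<partial>M)"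
        unfolding char_def using s by (subst integral_distr) auto
      ultimately show ?thesis by (simp add: ng)
    qed
  qed
qed

section \<open>Bounded smooth functions of finitely many coordinates\<close>

text \<open>Existence of one partial derivative and joint continuity of the other give the chain rule
  for \<open>G s (\<rho> s)\<close>: the increment in the second variable is, by the mean value theorem, \<open>D s (\<xi> s)\<close>
  times the increment of \<open>\<rho>\<close>.\<close>

lemma has_real_derivative_along_curve:
  fixes G D :: "real \<Rightarrow> real \<Rightarrow> real"
  assumes d1: "((\<lambda>s. G s (\<rho> z)) has_real_derivative a) (at z)"
    and d2: "\<And>s r. ((\<lambda>r. G s r) has_real_derivative D s r) (at r)"
    and cont: "continuous_on UNIV (\<lambda>(s, r). D s r)"
    and d\<rho>: "(\<rho> has_real_derivative b) (at z)"
  shows "((\<lambda>s. G s (\<rho> s)) has_real_derivative a + b * D z (\<rho> z)) (at z)"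
proof -
  have "\<exists>\<xi>. \<bar>\<xi> - \<rho> z\<bar> \<le> \<bar>\<rho> s - \<rho> z\<bar> \<and> G s (\<rho> s) - G s (\<rho> z) = D s \<xi> * (\<rho> s - \<rho> z)" for s
  proof (cases "\<rho> s" "\<rho> z" rule: linorder_cases)
    case less
    obtain \<xi> where "\<rho> s < \<xi>" "\<xi> < \<rho> z" "G s (\<rho> z) - G s (\<rho> s) = (\<rho> z - \<rho> s) * D s \<xi>"
      using MVT2[OF less, of "G s" "D s"] d2 by blast
    then show ?thesis by (intro exI[of _ \<xi>]) (auto simp: algebra_simps)
  next
    case greater
    obtain \<xi> where "\<rho> z < \<xi>" "\<xi> < \<rho> s" "G s (\<rho> s) - G s (\<rho> z) = (\<rho> s - \<rho> z) * D s \<xi>"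
      using MVT2[OF greater, of "G s" "D s"] d2 by blast
    then show ?thesis by (intro exI[of _ \<xi>]) (auto simp: algebra_simps)
  qed auto
  then obtain \<xi> where \<xi>: "\<And>s. \<bar>\<xi> s - \<rho> z\<bar> \<le> \<bar>\<rho> s - \<rho> z\<bar>"
    and inc: "\<And>s. G s (\<rho> s) - G s (\<rho> z) = D s (\<xi> s) * (\<rho> s - \<rho> z)" by metis
  have \<xi>z: "\<xi> z = \<rho> z" using \<xi>[of z] by simp
  obtain q where q: "\<And>s. G s (\<rho> z) - G z (\<rho> z) = q s * (s - z)" "isCont q z" "q z = a"
    using d1 unfolding CARAT_DERIV by blast
  obtain r where r: "\<And>s. \<rho> s - \<rho> z = r s * (s - z)" "isCont r z" "r z = b"
    using d\<rho> unfolding CARAT_DERIV by blast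
  have \<rho>: "(\<rho> \<longlongrightarrow> \<rho> z) (at z)" using DERIV_isCont[OF d\<rho>] by (simp add: isCont_def)
  have "((\<lambda>s. \<xi> s - \<rho> z) \<longlongrightarrow> 0) (at z)"
  proof (rule Lim_null_comparison)
    show "\<forall>\<^sub>F s in at z. norm (\<xi> s - \<rho> z) \<le> \<bar>\<rho> s - \<rho> z\<bar>" using \<xi> by simp
    show "((\<lambda>s. \<bar>\<rho> s - \<rho> z\<bar>) \<longlongrightarrow> 0) (at z)"
      using tendsto_rabs[OF tendsto_diff[OF \<rho> tendsto_const[of "\<rho> z"]]] by simp
  qed
  then have "(\<xi> \<longlongrightarrow> \<rho> z) (at z)" by (simp add: LIM_zero_iff)
  then have "((\<lambda>s. (s, \<xi> s)) \<longlongrightarrow> (z, \<rho> z)) (at z)" by (intro tendsto_Pair tendsto_ident_at)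
  moreover have "isCont (\<lambda>(s, r). D s r) (z, \<rho> z)" using cont by (simp add: continuous_on_eq_continuous_at)
  ultimately have "((\<lambda>s. case (s, \<xi> s) of (s, r) \<Rightarrow> D s r) \<longlongrightarrow> (case (z, \<rho> z) of (s, r) \<Rightarrow> D s r)) (at z)"
    by (rule isCont_tendsto_compose[rotated])
  then have "isCont (\<lambda>s. D s (\<xi> s)) z" by (simp add: isCont_def \<xi>z)
  then have "isCont (\<lambda>s. q s + r s * D s (\<xi> s)) z" using q(2) r(2) by (intro continuous_intros)
  moreover have "G s (\<rho> s) - G z (\<rho> z) = (q s + r s * D s (\<xi> s)) * (s - z)" for s
    using inc[of s] q(1)[of s] r(1)[of s] by (simp add: algebra_simps)
  ultimately show ?thesis
    unfolding CARAT_DERIV using q(3) r(3) \<xi>z by (intro exI[of _ "\<lambda>s. q s + r s * D s (\<xi> s)"]) simp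
qed

lemma C1_bounded_depends:
  assumes "C1_bounded m f" "\<forall>i\<in>{1..m}. x i = y i"
  shows "f x = f y"
  using assms unfolding C1_bounded_def by blast

lemma C1_bounded_partial_depends:
  assumes f: "C1_bounded m f" and xy: "\<forall>i\<in>{1..m}. x i = y i" and i: "i \<in> {1..m}"
  shows "partial_deriv i f x = partial_deriv i f y"
proof -
  have "f (x(i := s)) = f (y(i := s))" for s
    by (rule C1_bounded_depends[OF f]) (use xy in auto)
  then show ?thesis using xy i by (simp add: partial_deriv_def)
qed

lemma C1_bounded_has_partial:
  assumes "C1_bounded m f" "i \<in> {1..m}"
  shows "((\<lambda>r. f (x(i := r))) has_real_derivative partial_deriv i f (x(i := r))) (at r)"
proof -
  have "(\<lambda>s. f ((x(i := r))(i := s))) differentiable (at ((x(i := r)) i))"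
    using assms unfolding C1_bounded_def by blast
  then show ?thesis
    by (simp add: partial_deriv_def DERIV_deriv_iff_real_differentiable)
qed

lemma C1_bounded_bounds:
  assumes f: "C1_bounded m f"
  shows "\<exists>B. \<forall>x. \<bar>f x\<bar> \<le> B"
    and "\<exists>B. \<forall>i\<in>{1..m}. \<forall>x. \<bar>partial_deriv i f x\<bar> \<le> B"
proof -
  show "\<exists>B. \<forall>x. \<bar>f x\<bar> \<le> B"
    using f unfolding C1_bounded_def bounded_iff by (metis rangeI real_norm_def)
  have "\<exists>B. \<forall>x. \<bar>partial_deriv i f x\<bar> \<le> B" if "i \<in> {1..m}" for i
    using f that unfolding C1_bounded_def bounded_iff by (metis rangeI real_norm_def)
  then obtain B where B: "\<And>i x. i \<in> {1..m} \<Longrightarrow> \<bar>partial_deriv i f x\<bar> \<le> B i" by metis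
  have "\<bar>partial_deriv i f x\<bar> \<le> (\<Sum>i=1..m. B i)" if "i \<in> {1..m}" for i x
  proof -
    have "B i \<le> (\<Sum>i=1..m. B i)"
      using that order_trans[OF abs_ge_zero B] by (intro member_le_sum) auto
    then show ?thesis using B[OF that, of x] by linarith
  qed
  then show "\<exists>B. \<forall>i\<in>{1..m}. \<forall>x. \<bar>partial_deriv i f x\<bar> \<le> B" by blast
qed

lemma continuous_on_partial_update:
  fixes x d y :: "nat \<Rightarrow> real"
  shows "continuous_on UNIV (\<lambda>(s, r). (\<lambda>i. if i \<in> {1..k} then x i + s * d i else (y(j := r)) i))"
proof (rule continuous_on_coordinatewise_then_product)
  fix i
  consider "i \<in> {1..k}" | "i \<notin> {1..k}" "i = j" | "i \<notin> {1..k}" "i \<noteq> j" by blast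
  then show "continuous_on UNIV (\<lambda>p. (case p of (s, r) \<Rightarrow> \<lambda>i. if i \<in> {1..k} then x i + s * d i else (y(j := r)) i) i)"
    by cases (simp_all only: case_prod_unfold if_True if_False fun_upd_same fun_upd_other not_False_eq_True,
      auto intro!: continuous_intros)
qed

text \<open>Continuous partial derivatives imply the chain rule along lines. The coordinates are
  set in motion one after the other, each step being an instance of \<open>has_real_derivative_along_curve\<close>
  with the new coordinate as second variable.\<close>

lemma C1_bounded_line_derivative:
  assumes f: "C1_bounded m f"
  shows "((\<lambda>z. f (\<lambda>i. x i + z * d i)) has_real_derivative
    (\<Sum>i=1..m. d i * partial_deriv i f (\<lambda>i. x i + z * d i))) (at z)"
proof -
  note dep = C1_bounded_depends[OF f] and dep' = C1_bounded_partial_depends[OF f]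
  let ?L = "\<lambda>k s y i. if i \<in> {1..k} then x i + s * d i else y i"
  have "((\<lambda>s. f (?L k s y)) has_real_derivative (\<Sum>i=1..k. d i * partial_deriv i f (?L k z y))) (at z)"
    if "k \<le> m" for k y z
    using that
  proof (induction k arbitrary: y)
    case 0
    then show ?case by simp
  next
    case (Suc k)
    let ?\<rho> = "\<lambda>s. x (Suc k) + s * d (Suc k)"
    have L: "?L (Suc k) s y = ?L k s (y(Suc k := ?\<rho> s))" for s by (auto simp: fun_eq_iff)
    have upd: "?L k s (y(Suc k := r)) = (?L k s y)(Suc k := r)" for s r by (auto simp: fun_eq_iff)
    have "((\<lambda>s. f (?L k s (y(Suc k := ?\<rho> s)))) has_real_derivative
        (\<Sum>i=1..k. d i * partial_deriv i f (?L k z (y(Suc k := ?\<rho> z))))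
          + d (Suc k) * partial_deriv (Suc k) f (?L k z (y(Suc k := ?\<rho> z)))) (at z)"
    proof (rule has_real_derivative_along_curve[of "\<lambda>s r. f (?L k s (y(Suc k := r)))"])
      show "((\<lambda>s. f (?L k s (y(Suc k := ?\<rho> z)))) has_real_derivative
        (\<Sum>i=1..k. d i * partial_deriv i f (?L k z (y(Suc k := ?\<rho> z))))) (at z)"
        using Suc by simp
      show "((\<lambda>r. f (?L k s (y(Suc k := r)))) has_real_derivative partial_deriv (Suc k) f (?L k s (y(Suc k := r)))) (at r)" for s r
        unfolding upd using Suc.prems by (intro C1_bounded_has_partial[OF f]) auto
      have "continuous_on UNIV (partial_deriv (Suc k) f)"
        using f Suc.prems unfolding C1_bounded_def by simp
      from continuous_on_compose2[OF this continuous_on_partial_update[of k x d y "Suc k"]]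
      show "continuous_on UNIV (\<lambda>(s, r). partial_deriv (Suc k) f (?L k s (y(Suc k := r))))"
        by (simp add: case_prod_unfold)
      show "(?\<rho> has_real_derivative d (Suc k)) (at z)"
        by (auto intro!: derivative_eq_intros)
    qed
    then show ?case unfolding L by simp
  qed
  from this[of m "\<lambda>_. 0" z] have "((\<lambda>s. f (?L m s (\<lambda>_. 0))) has_real_derivative (\<Sum>i=1..m. d i * partial_deriv i f (?L m z (\<lambda>_. 0)))) (at z)"
    by simp
  moreover have "f (?L m s (\<lambda>_. 0)) = f (\<lambda>i. x i + s * d i)" for s by (rule dep) auto
  moreover have "(\<Sum>i=1..m. d i * partial_deriv i f (?L m z (\<lambda>_. 0))) = (\<Sum>i=1..m. d i * partial_deriv i f (\<lambda>i. x i + z * d i))"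
    by (intro sum.cong refl arg_cong2[where f="(*)"] dep') auto
  ultimately show ?thesis by simp
qed

lemma continuous_borel_measurable_PiM:
  fixes f :: "(nat \<Rightarrow> real) \<Rightarrow> real"
  assumes "continuous_on UNIV f"
  shows "f \<in> borel_measurable (PiM UNIV (\<lambda>_. borel))"
  using borel_measurable_continuous_onI[OF assms] measurable_cong_sets[OF sets_PiM_equal_borel refl] by blast

lemma C1_bounded_measurable:
  assumes "C1_bounded m f"
  shows "f \<in> borel_measurable (PiM UNIV (\<lambda>_. borel))"
    and "i \<in> {1..m} \<Longrightarrow> partial_deriv i f \<in> borel_measurable (PiM UNIV (\<lambda>_. borel))"
  using assms unfolding C1_bounded_def by (auto intro!: continuous_borel_measurable_PiM)

section \<open>Negative moments of Gaussian quadratic forms\<close>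

lemma orthonormal_basis_of_span:
  fixes B :: "'h::real_inner set"
  assumes B: "finite B" "independent B"
  obtains E where "finite E" "card E = card B" "E \<subseteq> span B" "\<And>e. e \<in> E \<Longrightarrow> norm e = 1"
    "\<And>e e'. e \<in> E \<Longrightarrow> e' \<in> E \<Longrightarrow> e \<noteq> e' \<Longrightarrow> e \<bullet> e' = 0"
proof -
  obtain C where C: "finite C" "card C \<le> card B" "span C = span B" "pairwise orthogonal C"
    using basis_orthogonal[OF B(1)] by blast
  have "card B \<le> card (C - {0})"
    using independent_span_bound[of "C - {0}" B] B C span_superset[of B] by auto
  then have C0: "0 \<notin> C" and card: "card C = card B"
    using C(1,2) by (auto simp: card_Diff_singleton_if split: if_splits) (metis Suc_pred card_gt_0_iff empty_iff not_less_eq_eq order_trans)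
  define n where "n = (\<lambda>x::'h. x /\<^sub>R norm x)"
  have nn: "norm (n x) = 1" if "x \<in> C" for x
  proof -
    have "x \<noteq> 0" using that C0 by auto
    then show ?thesis by (simp add: n_def)
  qed
  have orth: "n x \<bullet> n y = 0" if "x \<in> C" "y \<in> C" "x \<noteq> y" for x y
    using that C(4) by (auto simp: n_def pairwise_def orthogonal_def)
  have inj: "inj_on n C"
  proof (rule inj_onI, rule ccontr)
    fix x y assume *: "x \<in> C" "y \<in> C" "n x = n y" "x \<noteq> y"
    then have "n x \<bullet> n x = 0" using orth[of x y] by simp
    then show False using nn[of x] * by simp
  qed
  show ?thesis
  proof (rule that[of "n ` C"])
    show "finite (n ` C)" using C by simp
    show "card (n ` C) = card B" using card_image[OF inj] card by simp
    show "n ` C \<subseteq> span B"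
      using C(3) span_superset[of C] by (auto simp: n_def intro!: span_scale)
  qed (use nn orth in auto)
qed

context isonormal_process
begin

text \<open>Each \<open>e\<close> in an orthonormal basis \<open>E\<close> of the span of the \<open>h k\<close> is a combination of them, so
  \<open>W e\<close> plus a constant is at most a multiple of the square root of the quadratic form.
  Multiplying these \<open>n\<close> inequalities bounds the form raised to \<open>-s\<close> by a multiple of
  a product of \<open>n\<close> independent factors, each raised to \<open>- 2 s / n\<close>; this exponent is integrable at zero
  exactly when \<open>2 s < n\<close>. The constants \<open>c k\<close> make the lemma applicable under a shifted measure.\<close>

lemma quadratic_form_negative_moment:
  fixes h :: "nat \<Rightarrow> 'h" and b c :: "nat \<Rightarrow> real"
  assumes inj: "inj_on h {1..n}" and ind: "independent (h ` {1..n})"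
    and b: "\<And>k. k \<in> {1..n} \<Longrightarrow> b k > 0" and n: "n \<ge> 1" and s: "0 \<le> s" "2 * s < real n"
  shows "AE \<omega> in M. (\<Sum>k=1..n. (W (h k) \<omega> + c k)\<^sup>2 / (b k)\<^sup>2) > 0" (is "AE \<omega> in M. ?q \<omega> > 0")
    and "(\<integral>\<^sup>+\<omega>. ennreal ((\<Sum>k=1..n. (W (h k) \<omega> + c k)\<^sup>2 / (b k)\<^sup>2) powr (-s)) \<partial>M) < \<infinity>"
proof -
  obtain E where E: "finite E" "card E = card (h ` {1..n})" "E \<subseteq> span (h ` {1..n})"
    "\<And>e. e \<in> E \<Longrightarrow> norm e = 1" "\<And>e e'. e \<in> E \<Longrightarrow> e' \<in> E \<Longrightarrow> e \<noteq> e' \<Longrightarrow> e \<bullet> e' = 0"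
    using orthonormal_basis_of_span[OF _ ind] by blast
  have cE: "card E = n" using E(2) card_image[OF inj] by simp
  have "\<exists>\<alpha>. e = (\<Sum>k=1..n. \<alpha> k *\<^sub>R h k)" if "e \<in> E" for e
  proof -
    have "e \<in> span (h ` {1..n})" using E that by auto
    then obtain u where "e = (\<Sum>v\<in>h ` {1..n}. u v *\<^sub>R v)" by (auto simp: span_finite)
    also have "\<dots> = (\<Sum>k=1..n. u (h k) *\<^sub>R h k)" by (subst sum.reindex[OF inj]) simp
    finally show ?thesis by (intro exI[of _ "\<lambda>k. u (h k)"])
  qed
  then obtain \<alpha> where \<alpha>: "\<And>e. e \<in> E \<Longrightarrow> e = (\<Sum>k=1..n. \<alpha> e k *\<^sub>R h k)" by metis
  define c' where "c' = (\<lambda>e. \<Sum>k=1..n. \<alpha> e k * c k)"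
  define A where "A = 1 + (\<Sum>e\<in>E. \<Sum>k=1..n. \<bar>\<alpha> e k\<bar> * b k)"
  have A1: "(\<Sum>k=1..n. \<bar>\<alpha> e k\<bar> * b k) \<le> A" if "e \<in> E" for e
  proof -
    have "(\<Sum>k=1..n. \<bar>\<alpha> e k\<bar> * b k) \<le> (\<Sum>e\<in>E. \<Sum>k=1..n. \<bar>\<alpha> e k\<bar> * b k)"
      using that E(1) b by (intro member_le_sum) (auto intro!: sum_nonneg mult_nonneg_nonneg simp: less_imp_le)
    then show ?thesis by (simp add: A_def)
  qed
  have "0 \<le> (\<Sum>e\<in>E. \<Sum>k=1..n. \<bar>\<alpha> e k\<bar> * b k)"
    using b by (intro sum_nonneg mult_nonneg_nonneg) (auto intro: less_imp_le)
  then have A: "A \<ge> 1" by (simp add: A_def)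
  have q0: "?q \<omega> \<ge> 0" for \<omega> by (intro sum_nonneg) auto
  have bnd: "AE \<omega> in M. \<bar>W e \<omega> + c' e\<bar> \<le> A * sqrt (?q \<omega>)" if e: "e \<in> E" for e
  proof -
    have "AE \<omega> in M. W e \<omega> = (\<Sum>k=1..n. \<alpha> e k * W (h k) \<omega>)"
      using W_sum[of "{1..n}" "\<alpha> e" h] \<alpha>[OF e] by simp
    then show ?thesis
    proof eventually_elim
      case (elim \<omega>)
      have "W e \<omega> + c' e = (\<Sum>k=1..n. \<alpha> e k * (W (h k) \<omega> + c k))"
        by (simp add: elim c'_def distrib_left sum.distrib)
      also have "\<bar>\<dots>\<bar> \<le> (\<Sum>k=1..n. \<bar>\<alpha> e k\<bar> * \<bar>W (h k) \<omega> + c k\<bar>)"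
        by (rule order_trans[OF sum_abs]) (simp add: abs_mult)
      also have "\<dots> \<le> (\<Sum>k=1..n. (\<bar>\<alpha> e k\<bar> * b k) * sqrt (?q \<omega>))"
      proof (rule sum_mono)
        fix k assume k: "k \<in> {1..n}"
        have "((W (h k) \<omega> + c k) / b k)\<^sup>2 \<le> ?q \<omega>"
          unfolding power_divide using k by (intro member_le_sum) auto
        then have "\<bar>(W (h k) \<omega> + c k) / b k\<bar> \<le> sqrt (?q \<omega>)"
          using real_sqrt_le_mono by fastforce
        then have "\<bar>W (h k) \<omega> + c k\<bar> \<le> b k * sqrt (?q \<omega>)"
          using b[OF k] by (simp add: field_simps)
        from mult_left_mono[OF this, of "\<bar>\<alpha> e k\<bar>"]
        show "\<bar>\<alpha> e k\<bar> * \<bar>W (h k) \<omega> + c k\<bar> \<le> (\<bar>\<alpha> e k\<bar> * b k) * sqrt (?q \<omega>)"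
          by (simp add: mult.assoc)
      qed
      also have "\<dots> = (\<Sum>k=1..n. \<bar>\<alpha> e k\<bar> * b k) * sqrt (?q \<omega>)" by (simp only: sum_distrib_right)
      also have "\<dots> \<le> A * sqrt (?q \<omega>)" using A1[OF e] q0 by (intro mult_right_mono) auto
      finally show ?case .
    qed
  qed
  have "AE \<omega> in M. \<forall>e\<in>E. \<bar>W e \<omega> + c' e\<bar> \<le> A * sqrt (?q \<omega>)"
    using bnd E(1) by (intro AE_finite_allI) auto
  moreover have "AE \<omega> in M. \<forall>e\<in>E. W e \<omega> + c' e \<noteq> 0"
  proof (intro AE_finite_allI[OF E(1)])
    fix e assume "e \<in> E"
    then have "e \<noteq> 0" using E(4)[of e] by auto
    then show "AE \<omega> in M. W e \<omega> + c' e \<noteq> 0" by (rule AE_W_affine_neq_zero)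
  qed
  ultimately have ae: "AE \<omega> in M. ?q \<omega> > 0 \<and>
    ennreal (?q \<omega> powr (-s)) \<le> ennreal (A powr (2 * s)) * (\<Prod>e\<in>E. ennreal (\<bar>W e \<omega> + c' e\<bar> powr (- (2 * s / n))))"
  proof eventually_elim
    case (elim \<omega>)
    have "E \<noteq> {}" using cE n by auto
    then obtain e0 where "e0 \<in> E" by auto
    then have "0 < A * sqrt (?q \<omega>)" using elim by (meson less_le_trans zero_less_abs_iff)
    then have q: "?q \<omega> > 0" using A by (simp add: zero_less_mult_iff)
    have "(A * sqrt (?q \<omega>)) powr (- (2 * s / n)) \<le> \<bar>W e \<omega> + c' e\<bar> powr (- (2 * s / n))" if "e \<in> E" for e
      using elim that s by (intro powr_mono2') auto
    then have "(\<Prod>e\<in>E. (A * sqrt (?q \<omega>)) powr (- (2 * s / n))) \<le> (\<Prod>e\<in>E. \<bar>W e \<omega> + c' e\<bar> powr (- (2 * s / n)))"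
      by (intro prod_mono) auto
    moreover have "(\<Prod>e\<in>E. (A * sqrt (?q \<omega>)) powr (- (2 * s / n))) = A powr (- (2 * s)) * ?q \<omega> powr (-s)"
    proof -
      have "(\<Prod>e\<in>E. (A * sqrt (?q \<omega>)) powr (- (2 * s / n))) = (A * sqrt (?q \<omega>)) powr (- (2 * s))"
        using cE n A q by (simp add: powr_realpow[symmetric] powr_powr)
      also have "\<dots> = A powr (- (2 * s)) * (?q \<omega> powr (1/2)) powr (- (2 * s))"
        using A q by (simp add: powr_mult powr_half_sqrt)
      also have "\<dots> = A powr (- (2 * s)) * ?q \<omega> powr (-s)" by (simp add: powr_powr)
      finally show ?thesis .
    qed
    ultimately have "A powr (2 * s) * (A powr (- (2 * s)) * ?q \<omega> powr (-s))
      \<le> A powr (2 * s) * (\<Prod>e\<in>E. \<bar>W e \<omega> + c' e\<bar> powr (- (2 * s / n)))"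
      by (intro mult_left_mono) auto
    also have "A powr (2 * s) * (A powr (- (2 * s)) * ?q \<omega> powr (-s)) = ?q \<omega> powr (-s)"
      using A by (simp add: mult.assoc[symmetric] powr_add[symmetric])
    finally show ?case using q by (simp add: prod_ennreal ennreal_mult[symmetric] prod_nonneg)
  qed
  show "AE \<omega> in M. ?q \<omega> > 0" using ae by eventually_elim simp
  have "(\<integral>\<^sup>+\<omega>. ennreal (?q \<omega> powr (-s)) \<partial>M)
    \<le> (\<integral>\<^sup>+\<omega>. ennreal (A powr (2 * s)) * (\<Prod>e\<in>E. ennreal (\<bar>W e \<omega> + c' e\<bar> powr (- (2 * s / n)))) \<partial>M)"
    by (rule nn_integral_mono_AE) (use ae in eventually_elim, simp)
  also have "\<dots> = ennreal (A powr (2 * s)) * (\<integral>\<^sup>+\<omega>. (\<Prod>e\<in>E. ennreal (\<bar>W e \<omega> + c' e\<bar> powr (- (2 * s / n)))) \<partial>M)"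
    by (rule nn_integral_cmult) measurable
  also have "\<dots> < \<infinity>"
    using nn_integral_prod_powr_finite[of "2 * s / n" E c'] s n E
    by (auto simp: ennreal_mult_less_top)
  finally show "(\<integral>\<^sup>+\<omega>. ennreal (?q \<omega> powr (-s)) \<partial>M) < \<infinity>" .
qed

end

section \<open>Closability of the derivative\<close>

lemma (in isonormal_process) integral_W_mult:
  "(\<integral>\<omega>. W g \<omega> * W h \<omega> \<partial>M) = g \<bullet> h"
proof -
  have "AE \<omega> in M. (W (g + h) \<omega>)\<^sup>2 = (W g \<omega> + W h \<omega>)\<^sup>2"
    using W_linear[of 1 g 1 h] by eventually_elim simp
  then have ae: "AE \<omega> in M. W g \<omega> * W h \<omega> = ((W (g + h) \<omega>)\<^sup>2 - (W g \<omega>)\<^sup>2 - (W h \<omega>)\<^sup>2) / 2"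
    by eventually_elim (simp add: power2_sum)
  have "(\<integral>\<omega>. W g \<omega> * W h \<omega> \<partial>M) = (\<integral>\<omega>. ((W (g + h) \<omega>)\<^sup>2 - (W g \<omega>)\<^sup>2 - (W h \<omega>)\<^sup>2) / 2 \<partial>M)"
    by (rule integral_cong_AE) (use ae in simp_all)
  also have "\<dots> = ((norm (g + h))\<^sup>2 - (norm g)\<^sup>2 - (norm h)\<^sup>2) / 2"
    using integrable_W_square by (simp add: integral_W_square)
  also have "\<dots> = g \<bullet> h"
    unfolding power2_norm_eq_inner by (simp add: inner_add_left inner_add_right inner_commute)
  finally show "(\<integral>\<omega>. W g \<omega> * W h \<omega> \<partial>M) = g \<bullet> h" .
qed

text \<open>A positive function such that \<open>x * bump x\<close> is bounded. Since the approximating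
  functionals converge in \<open>L\<^sup>1\<close> only, every factor multiplying them after integration by parts must be bounded,
  including the Gaussian variable \<open>W w\<close> itself; positivity allows the factor to be divided out at the end.\<close>

definition bump :: "real \<Rightarrow> real" where "bump x = 1 / (1 + x\<^sup>2)"

definition bump' :: "real \<Rightarrow> real" where "bump' x = - (2 * x) / (1 + x\<^sup>2)\<^sup>2"

lemma bump_pos: "bump x > 0"
  unfolding bump_def by (simp add: add_pos_nonneg)

lemma bump_le_1: "bump x \<le> 1"
proof -
  have "0 < 1 + x\<^sup>2" by (simp add: add_pos_nonneg)
  then show ?thesis by (simp add: bump_def divide_le_eq_1_pos)
qed

lemma bump_deriv: "(bump has_real_derivative bump' x) (at x)"
proof -
  have "1 + x\<^sup>2 \<noteq> 0" by (metis add_pos_nonneg less_irrefl zero_le_power2 zero_less_one)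
  then show ?thesis unfolding bump_def[abs_def] bump'_def
    by (auto intro!: derivative_eq_intros simp: power2_eq_square)
qed

lemma continuous_bump: "continuous_on S bump" "continuous_on S bump'"
proof -
  have nz: "1 + x\<^sup>2 \<noteq> 0" for x :: real
    by (metis add_pos_nonneg less_irrefl zero_le_power2 zero_less_one)
  show "continuous_on S bump" "continuous_on S bump'"
    unfolding bump_def[abs_def] bump'_def[abs_def] by (auto intro!: continuous_intros simp: nz)
qed

lemma bump_measurable[measurable]: "bump \<in> borel_measurable borel" "bump' \<in> borel_measurable borel"
  by (auto intro: borel_measurable_continuous_onI continuous_bump)

lemma abs_times_bump_le: "\<bar>x * bump x\<bar> \<le> 1" and abs_bump'_le: "\<bar>bump' x\<bar> \<le> 2"
proof -
  have p: "0 < 1 + x\<^sup>2" by (simp add: add_pos_nonneg)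
  show 1: "\<bar>x * bump x\<bar> \<le> 1" using p abs_le_one_plus_square[of x] by (simp add: bump_def)
  have "bump' x = - 2 * ((x * bump x) * bump x)" by (simp add: bump'_def bump_def power2_eq_square)
  then have "\<bar>bump' x\<bar> = 2 * (\<bar>x * bump x\<bar> * \<bar>bump x\<bar>)" by (simp add: abs_mult)
  also have "\<dots> \<le> 2 * (1 * 1)"
    using 1 bump_pos[of x] bump_le_1[of x] by (intro mult_left_mono mult_mono) auto
  finally show "\<bar>bump' x\<bar> \<le> 2" by simp
qed

context isonormal_process
begin

definition test_fun :: "'h \<Rightarrow> 'h \<Rightarrow> real \<Rightarrow> 'a \<Rightarrow> real" where
  "test_fun w s \<theta> \<omega> = cos (W s \<omega> + \<theta>) * bump (W w \<omega>)"

text \<open>The divergence of \<open>test_fun w s \<theta>\<close> in the direction \<open>w\<close>, that is, the result of moving the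
  directional derivative onto the test function.\<close>

definition test_div :: "'h \<Rightarrow> 'h \<Rightarrow> real \<Rightarrow> 'a \<Rightarrow> real" where
  "test_div w s \<theta> \<omega> = test_fun w s \<theta> \<omega> * W w \<omega> + (s \<bullet> w) * (sin (W s \<omega> + \<theta>) * bump (W w \<omega>))
     - (w \<bullet> w) * (cos (W s \<omega> + \<theta>) * bump' (W w \<omega>))"

lemma test_measurable[measurable]:
  "test_fun w s \<theta> \<in> borel_measurable M" "test_div w s \<theta> \<in> borel_measurable M"
  unfolding test_fun_def[abs_def] test_div_def[abs_def] by measurable

lemma test_fun_bound: "\<bar>test_fun w s \<theta> \<omega>\<bar> \<le> 1"
  unfolding test_fun_def abs_mult using bump_pos[of "W w \<omega>"] bump_le_1[of "W w \<omega>"]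
  by (intro mult_le_one) auto

lemma test_div_bound: "\<bar>test_div w s \<theta> \<omega>\<bar> \<le> 1 + \<bar>s \<bullet> w\<bar> + 2 * (w \<bullet> w)"
proof -
  have 1: "\<bar>test_fun w s \<theta> \<omega> * W w \<omega>\<bar> \<le> 1"
  proof -
    have "\<bar>test_fun w s \<theta> \<omega> * W w \<omega>\<bar> = \<bar>cos (W s \<omega> + \<theta>)\<bar> * \<bar>W w \<omega> * bump (W w \<omega>)\<bar>"
      by (simp add: test_fun_def abs_mult)
    also have "\<dots> \<le> 1" using abs_times_bump_le by (intro mult_le_one) auto
    finally show ?thesis .
  qed
  have 2: "\<bar>(s \<bullet> w) * (sin (W s \<omega> + \<theta>) * bump (W w \<omega>))\<bar> \<le> \<bar>s \<bullet> w\<bar> * 1"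
    unfolding abs_mult using bump_pos[of "W w \<omega>"] bump_le_1[of "W w \<omega>"]
    by (intro mult_left_mono mult_le_one) auto
  have 3: "\<bar>(w \<bullet> w) * (cos (W s \<omega> + \<theta>) * bump' (W w \<omega>))\<bar> \<le> (w \<bullet> w) * (1 * 2)"
    unfolding abs_mult using abs_bump'_le
    by (simp only: abs_of_nonneg[OF inner_ge_zero]) (intro mult_left_mono mult_mono, auto)
  show ?thesis unfolding test_div_def using 1 2 3 by linarith
qed

text \<open>Product rule and integration by parts. The function \<open>f\<close> depends on the coordinates \<open>1, \<dots>, m\<close> only,
  so the free coordinates \<open>0\<close> and \<open>m + 1\<close> can carry \<open>s\<close> and \<open>w\<close>.\<close>

lemma cylindrical_test_identity:
  assumes f: "C1_bounded m f"
  shows "(\<integral>\<omega>. (\<Sum>i=1..m. (g i \<bullet> w) * partial_deriv i f (\<lambda>j. W (g j) \<omega>)) * test_fun w s \<theta> \<omega> \<partial>M)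
    = (\<integral>\<omega>. f (\<lambda>j. W (g j) \<omega>) * test_div w s \<theta> \<omega> \<partial>M)"
proof -
  obtain Bf where Bf: "\<And>x. \<bar>f x\<bar> \<le> Bf" using C1_bounded_bounds(1)[OF f] by blast
  obtain Bp where Bp: "\<And>i x. i \<in> {1..m} \<Longrightarrow> \<bar>partial_deriv i f x\<bar> \<le> Bp"
    using C1_bounded_bounds(2)[OF f] by blast
  define g' where "g' = g(0 := s, Suc m := w)"
  have g': "g' i = g i" if "i \<in> {1..m}" for i using that by (simp add: g'_def)
  have g0: "g' 0 = s" "g' (Suc m) = w" by (auto simp: g'_def)
  let ?dir = "\<lambda>x. \<Sum>i=1..m. (g i \<bullet> w) * partial_deriv i f x"
  let ?\<kappa> = "\<lambda>x. cos (x 0 + \<theta>) * bump (x (Suc m))"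
  let ?\<kappa>' = "\<lambda>x. cos (x 0 + \<theta>) * (bump' (x (Suc m)) * (w \<bullet> w)) - sin (x 0 + \<theta>) * (s \<bullet> w) * bump (x (Suc m))"
  define \<Phi> where "\<Phi> = (\<lambda>x. f x * ?\<kappa> x)"
  define \<Phi>' where "\<Phi>' = (\<lambda>x. ?dir x * ?\<kappa> x + f x * ?\<kappa>' x)"
  note [measurable] = C1_bounded_measurable[OF f]
  have md: "?dir \<in> borel_measurable (PiM UNIV (\<lambda>_. borel))" by measurable
  have line: "continuous_on UNIV (\<lambda>z. (\<lambda>i. x i + z * d i))" for x d :: "nat \<Rightarrow> real"
    by (intro continuous_on_coordinatewise_then_product continuous_intros)
  have cp: "continuous_on UNIV (\<lambda>z. partial_deriv i f (\<lambda>i. x i + z * d i))" if "i \<in> {1..m}" for i and x d :: "nat \<Rightarrow> real"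
    using f that unfolding C1_bounded_def by (intro continuous_on_compose2[OF _ line]) auto
  have cf: "continuous_on UNIV (\<lambda>z. f (\<lambda>i. x i + z * d i))" for x d :: "nat \<Rightarrow> real"
    using f unfolding C1_bounded_def by (intro continuous_on_compose2[OF _ line]) auto
  have \<kappa>: "\<bar>?\<kappa> x\<bar> \<le> 1" for x
    unfolding abs_mult using bump_pos[of "x (Suc m)"] bump_le_1[of "x (Suc m)"] by (intro mult_le_one) auto
  have \<kappa>': "\<bar>?\<kappa>' x\<bar> \<le> 2 * (w \<bullet> w) + \<bar>s \<bullet> w\<bar>" for x
  proof -
    have "\<bar>cos (x 0 + \<theta>) * (bump' (x (Suc m)) * (w \<bullet> w))\<bar> \<le> 1 * (2 * (w \<bullet> w))"
      unfolding abs_mult using abs_bump'_le by (intro mult_mono) auto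
    moreover have "\<bar>sin (x 0 + \<theta>) * (s \<bullet> w) * bump (x (Suc m))\<bar> \<le> (1 * \<bar>s \<bullet> w\<bar>) * 1"
      unfolding abs_mult using bump_pos[of "x (Suc m)"] bump_le_1[of "x (Suc m)"] by (intro mult_mono) auto
    ultimately show ?thesis by linarith
  qed
  define B' where "B' = (\<Sum>i=1..m. \<bar>g i \<bullet> w\<bar> * Bp) + Bf * (2 * (w \<bullet> w) + \<bar>s \<bullet> w\<bar>)"
  have dir: "\<bar>?dir x\<bar> \<le> (\<Sum>i=1..m. \<bar>g i \<bullet> w\<bar> * Bp)" for x
    by (rule order_trans[OF sum_abs], rule sum_mono) (auto simp: abs_mult intro!: mult_left_mono Bp)
  have Bf0: "0 \<le> Bf" using Bf order_trans[OF abs_ge_zero] by blast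
  have ibp: "(\<integral>\<omega>. \<Phi> (\<lambda>i. W (g' i) \<omega>) * W w \<omega> \<partial>M) = (\<integral>\<omega>. \<Phi>' (\<lambda>i. W (g' i) \<omega>) \<partial>M)"
  proof (rule gaussian_integration_by_parts[where \<Phi>=\<Phi> and \<Phi>'=\<Phi>' and g=g' and B="max Bf B'"])
    show "\<Phi> \<in> borel_measurable (PiM UNIV (\<lambda>_. borel))" unfolding \<Phi>_def by measurable
    show "\<Phi>' \<in> borel_measurable (PiM UNIV (\<lambda>_. borel))" unfolding \<Phi>'_def by measurable
    fix x :: "nat \<Rightarrow> real"
    let ?y = "\<lambda>z i. x i + z * (g' i \<bullet> w)"
    have df: "((\<lambda>z. f (?y z)) has_real_derivative ?dir (?y z)) (at z)" for z
    proof -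
      have "(\<Sum>i=1..m. (g' i \<bullet> w) * partial_deriv i f (?y z)) = ?dir (?y z)"
        by (intro sum.cong refl) (simp only: g')
      then show ?thesis using C1_bounded_line_derivative[OF f, of x "\<lambda>i. g' i \<bullet> w" z] by simp
    qed
    have db: "((\<lambda>z. bump (?y z (Suc m))) has_real_derivative bump' (?y z (Suc m)) * (w \<bullet> w)) (at z)" for z
      by (rule DERIV_chain2[OF bump_deriv]) (auto simp: g0 intro!: derivative_eq_intros)
    have dc: "((\<lambda>z. cos (?y z 0 + \<theta>)) has_real_derivative - sin (?y z 0 + \<theta>) * (s \<bullet> w)) (at z)" for z
      by (auto simp: g0 intro!: derivative_eq_intros)
    show "((\<lambda>z. \<Phi> (?y z)) has_real_derivative \<Phi>' (?y z)) (at z)" for z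
      unfolding \<Phi>_def \<Phi>'_def
      by (rule DERIV_cong[OF DERIV_mult[OF df DERIV_mult[OF dc db]]]) (simp add: algebra_simps)
    show "continuous_on UNIV (\<lambda>z. \<Phi>' (?y z))"
      unfolding \<Phi>'_def
      by (intro continuous_intros cp cf continuous_on_compose2[OF continuous_bump(1)[of UNIV]]
          continuous_on_compose2[OF continuous_bump(2)[of UNIV]]) auto
    have "\<bar>\<Phi> x\<bar> \<le> Bf * 1" unfolding \<Phi>_def abs_mult[of "f x"] using Bf \<kappa> Bf0 by (intro mult_mono) auto
    then show "\<bar>\<Phi> x\<bar> \<le> max Bf B'" by simp
    have "\<bar>?dir x * ?\<kappa> x\<bar> \<le> (\<Sum>i=1..m. \<bar>g i \<bullet> w\<bar> * Bp) * 1"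
      unfolding abs_mult[of "?dir x"] using dir \<kappa> order_trans[OF abs_ge_zero dir] by (intro mult_mono) auto
    moreover have "\<bar>f x * ?\<kappa>' x\<bar> \<le> Bf * (2 * (w \<bullet> w) + \<bar>s \<bullet> w\<bar>)"
      unfolding abs_mult[of "f x"] using Bf \<kappa>' Bf0 by (intro mult_mono) auto
    ultimately have "\<bar>\<Phi>' x\<bar> \<le> B'" unfolding \<Phi>'_def B'_def by linarith
    then show "\<bar>\<Phi>' x\<bar> \<le> max Bf B'" by simp
  qed
  have fW: "f (\<lambda>i. W (g' i) \<omega>) = f (\<lambda>i. W (g i) \<omega>)" for \<omega>
    by (rule C1_bounded_depends[OF f]) (simp add: g')
  have pW: "?dir (\<lambda>i. W (g' i) \<omega>) = ?dir (\<lambda>i. W (g i) \<omega>)" for \<omega>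
    by (intro sum.cong refl arg_cong2[where f="(*)"] C1_bounded_partial_depends[OF f]) (auto simp: g')
  have "(\<integral>\<omega>. \<Phi> (\<lambda>i. W (g' i) \<omega>) * W w \<omega> \<partial>M) = (\<integral>\<omega>. f (\<lambda>i. W (g i) \<omega>) * test_fun w s \<theta> \<omega> * W w \<omega> \<partial>M)"
    unfolding \<Phi>_def fW g0 test_fun_def by (rule refl)
  moreover have "(\<integral>\<omega>. \<Phi>' (\<lambda>i. W (g' i) \<omega>) \<partial>M)
    = (\<integral>\<omega>. ?dir (\<lambda>i. W (g i) \<omega>) * test_fun w s \<theta> \<omega> + f (\<lambda>i. W (g i) \<omega>) * (test_fun w s \<theta> \<omega> * W w \<omega> - test_div w s \<theta> \<omega>) \<partial>M)"
    by (intro Bochner_Integration.integral_cong refl, unfold \<Phi>'_def fW pW g0 test_fun_def test_div_def)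
      (simp add: algebra_simps)
  ultimately have eq: "(\<integral>\<omega>. f (\<lambda>i. W (g i) \<omega>) * test_fun w s \<theta> \<omega> * W w \<omega> \<partial>M)
    = (\<integral>\<omega>. ?dir (\<lambda>i. W (g i) \<omega>) * test_fun w s \<theta> \<omega> + f (\<lambda>i. W (g i) \<omega>) * (test_fun w s \<theta> \<omega> * W w \<omega> - test_div w s \<theta> \<omega>) \<partial>M)"
    using ibp by (simp only:)
  have mg: "(\<lambda>\<omega> i. W (g i) \<omega>) \<in> measurable M (PiM UNIV (\<lambda>_. borel))"
    by (auto intro!: measurable_PiM_single')
  have mf[measurable]: "(\<lambda>\<omega>. f (\<lambda>i. W (g i) \<omega>)) \<in> borel_measurable M"
    by (rule measurable_compose[OF mg]) measurable
  have mdir[measurable]: "(\<lambda>\<omega>. ?dir (\<lambda>i. W (g i) \<omega>)) \<in> borel_measurable M"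
    by (rule measurable_compose[OF mg md])
  have i1: "integrable M (\<lambda>\<omega>. ?dir (\<lambda>i. W (g i) \<omega>) * test_fun w s \<theta> \<omega>)"
  proof (rule integrable_mult_bounded[OF _ _ test_fun_bound])
    show "integrable M (\<lambda>\<omega>. ?dir (\<lambda>i. W (g i) \<omega>))"
      by (rule integrable_const_bound[OF _ mdir]) (use dir in auto)
  qed measurable
  have ifW: "integrable M (\<lambda>\<omega>. f (\<lambda>i. W (g i) \<omega>))"
    by (rule integrable_const_bound[OF _ mf]) (use Bf in auto)
  have i2: "integrable M (\<lambda>\<omega>. f (\<lambda>i. W (g i) \<omega>) * test_div w s \<theta> \<omega>)"
    by (rule integrable_mult_bounded[OF ifW _ test_div_bound]) measurable
  have i3: "integrable M (\<lambda>\<omega>. f (\<lambda>i. W (g i) \<omega>) * (test_fun w s \<theta> \<omega> * W w \<omega>))"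
  proof (rule integrable_mult_bounded[OF ifW])
    show "\<bar>test_fun w s \<theta> \<omega> * W w \<omega>\<bar> \<le> 1" for \<omega>
      using mult_mono[OF abs_cos_le_one[of "W s \<omega> + \<theta>"] abs_times_bump_le[of "W w \<omega>"]]
      by (simp add: test_fun_def abs_mult mult_ac)
  qed measurable
  show "(\<integral>\<omega>. ?dir (\<lambda>j. W (g j) \<omega>) * test_fun w s \<theta> \<omega> \<partial>M) = (\<integral>\<omega>. f (\<lambda>j. W (g j) \<omega>) * test_div w s \<theta> \<omega> \<partial>M)"
    using eq i1 i2 i3 by (simp add: right_diff_distrib mult.assoc)
qed

end

text \<open>The process \<open>X\<close> enters through joint measurability, which makes \<open>Gam chi g\<close> a measurable function of
  time, and through the sigma-algebra that it generates.\<close>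

locale isonormal_path_process = isonormal_process M W
  for M :: "'a measure" and W :: "'h::real_inner \<Rightarrow> 'a \<Rightarrow> real" +
  fixes T :: real and X :: "real \<Rightarrow> 'a \<Rightarrow> real" and chi :: "real \<Rightarrow> 'h"
  assumes T_pos: "T > 0"
    and sets_M: "sets M = sigma_sets (space M) (\<Union>t\<in>{0..T}. {X t -` A \<inter> space M | A. A \<in> sets borel})"
    and X_random: "\<And>t. t \<in> {0..T} \<Longrightarrow> X t \<in> borel_measurable M"
    and X_joint[measurable]: "case_prod X \<in> borel_measurable (restrict_space lborel {0..T} \<Otimes>\<^sub>M M)"
    and chi_square_integrable: "integrable (restrict_space lborel {0..T}) (\<lambda>t. (norm (chi t))\<^sup>2)"
    and W_chi: "\<And>t. t \<in> {0..T} \<Longrightarrow> AE \<omega> in M. W (chi t) \<omega> = X t \<omega>"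
begin

abbreviation "L \<equiv> restrict_space lborel {0..T}"

lemma space_L: "space L = {0..T}"
  by (simp add: space_restrict_space)

lemma measure_L: "emeasure L (space L) = ennreal T"
  using T_pos by (simp add: space_L emeasure_restrict_space)

text \<open>The positive and negative parts of \<open>\<rho>\<close>, as densities, give \<open>X\<close> the same joint characteristic
  functions, hence the same law on path space. As every event is determined by \<open>X\<close>, the two
  measures coincide on all of \<open>M\<close>.\<close>

lemma AE_zero_of_char_zero:
  assumes \<rho>: "integrable M \<rho>" and char0: "\<And>s. (\<integral>\<omega>. \<rho> \<omega> *\<^sub>R iexp (W s \<omega>) \<partial>M) = 0"
  shows "AE \<omega> in M. \<rho> \<omega> = 0"
proof -
  have [measurable]: "\<rho> \<in> borel_measurable M" using \<rho> by auto
  define p where "p = (\<lambda>\<omega>. max 0 (\<rho> \<omega>))"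
  define q where "q = (\<lambda>\<omega>. max 0 (- \<rho> \<omega>))"
  have pq: "\<rho> \<omega> = p \<omega> - q \<omega>" "p \<omega> = 0 \<or> q \<omega> = 0" "0 \<le> p \<omega>" "0 \<le> q \<omega>" for \<omega>
    by (auto simp: p_def q_def)
  have [measurable]: "p \<in> borel_measurable M" "q \<in> borel_measurable M"
    by (simp_all add: p_def q_def)
  have ip: "integrable M p" and iq: "integrable M q" using \<rho> by (simp_all add: p_def q_def)
  have eq: "(\<integral>\<omega>. p \<omega> *\<^sub>R iexp (W s \<omega>) \<partial>M) = (\<integral>\<omega>. q \<omega> *\<^sub>R iexp (W s \<omega>) \<partial>M)" for s
  proof -
    have "integrable M (\<lambda>\<omega>. r \<omega> *\<^sub>R iexp (W s \<omega>))" if "integrable M r" for r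
      by (rule Bochner_Integration.integrable_bound[OF that]) (use that in auto)
    from this[OF ip] this[OF iq] have "(\<integral>\<omega>. \<rho> \<omega> *\<^sub>R iexp (W s \<omega>) \<partial>M)
      = (\<integral>\<omega>. p \<omega> *\<^sub>R iexp (W s \<omega>) \<partial>M) - (\<integral>\<omega>. q \<omega> *\<^sub>R iexp (W s \<omega>) \<partial>M)"
      unfolding pq(1) scaleR_left_diff_distrib by simp
    then show ?thesis using char0[of s] by simp
  qed
  define c where "c = (\<integral>\<omega>. p \<omega> \<partial>M)"
  have W0: "(\<integral>\<omega>. r \<omega> *\<^sub>R iexp (W 0 \<omega>) \<partial>M) = complex_of_real (\<integral>\<omega>. r \<omega> \<partial>M)"
    if [measurable]: "r \<in> borel_measurable M" for r
  proof -
    have "(\<integral>\<omega>. r \<omega> *\<^sub>R iexp (W 0 \<omega>) \<partial>M) = (\<integral>\<omega>. complex_of_real (r \<omega>) \<partial>M)"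
      by (rule integral_cong_AE) (use W_zero in \<open>auto simp: scaleR_conv_of_real\<close>)
    then show ?thesis by simp
  qed
  have cq: "c = (\<integral>\<omega>. q \<omega> \<partial>M)"
    using eq[of 0] unfolding W0[OF \<open>p \<in> _\<close>] W0[OF \<open>q \<in> _\<close>] c_def by (simp only: of_real_eq_iff)
  have "0 \<le> c" unfolding c_def using pq by (intro integral_nonneg_AE) simp
  show ?thesis
  proof (cases "c = 0")
    case True
    have "AE \<omega> in M. p \<omega> = 0"
      using integral_nonneg_eq_0_iff_AE[OF ip] pq True by (simp add: c_def)
    moreover have "AE \<omega> in M. q \<omega> = 0"
      using integral_nonneg_eq_0_iff_AE[OF iq] pq True cq by simp
    ultimately show ?thesis by eventually_elim (simp add: pq(1))
  next
    case False
    with \<open>0 \<le> c\<close> have c: "c > 0" by simp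
    let ?N = "\<lambda>r. density M (\<lambda>\<omega>. ennreal (r \<omega> / c))"
    have prob: "prob_space (?N r)" if r: "integrable M r" "\<And>\<omega>. 0 \<le> r \<omega>" "c = (\<integral>\<omega>. r \<omega> \<partial>M)" for r
    proof (rule prob_spaceI)
      have [measurable]: "r \<in> borel_measurable M" using r by auto
      have "emeasure (?N r) (space (?N r)) = (\<integral>\<^sup>+\<omega>. ennreal (r \<omega> / c) \<partial>M)"
        by (simp add: emeasure_density cong: nn_integral_cong)
      also have "\<dots> = ennreal (\<integral>\<omega>. r \<omega> / c \<partial>M)"
        using r c by (intro nn_integral_eq_integral) auto
      also have "\<dots> = 1" using r c by simp
      finally show "emeasure (?N r) (space (?N r)) = 1" .
    qed
    let ?Xm = "\<lambda>\<omega>. \<lambda>t\<in>{0..T}. X t \<omega>"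
    let ?P = "PiM {0..T} (\<lambda>_. borel :: real measure)"
    have Xm[measurable]: "?Xm \<in> measurable M ?P" using X_random by (intro measurable_restrict) auto
    have distr: "distr (?N p) ?P ?Xm = distr (?N q) ?P ?Xm"
    proof (rule distr_PiM_eqI_char)
      show "prob_space (?N p)" by (rule prob) (use ip pq c_def in auto)
      show "prob_space (?N q)" by (rule prob) (use iq pq cq in auto)
      show "X t \<in> borel_measurable (?N p)" "X t \<in> borel_measurable (?N q)" if "t \<in> {0..T}" for t
        using X_random[OF that] by simp_all
      fix J and a :: "real \<Rightarrow> real" assume J: "finite J" "J \<subseteq> {0..T}"
      let ?s = "\<Sum>t\<in>J. a t *\<^sub>R chi t"
      define S where "S = (\<lambda>\<omega>. \<Sum>t\<in>J. a t * X t \<omega>)"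
      have [measurable]: "S \<in> borel_measurable M"
        unfolding S_def using J X_random by (intro borel_measurable_sum borel_measurable_times) auto
      have "AE \<omega> in M. \<forall>t\<in>J. W (chi t) \<omega> = X t \<omega>"
        using J W_chi by (intro AE_finite_allI) auto
      with W_sum[OF J(1), of a chi] have ae: "AE \<omega> in M. S \<omega> = W ?s \<omega>"
        by eventually_elim (simp add: S_def)
      have "(\<integral>\<omega>. iexp (S \<omega>) \<partial>?N r) = (\<integral>\<omega>. r \<omega> *\<^sub>R iexp (W ?s \<omega>) \<partial>M) / c"
        if [measurable]: "r \<in> borel_measurable M" and r: "\<And>\<omega>. 0 \<le> r \<omega>" for r
      proof -
        have "(\<integral>\<omega>. iexp (S \<omega>) \<partial>?N r) = (\<integral>\<omega>. (r \<omega> / c) *\<^sub>R iexp (S \<omega>) \<partial>M)"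
          using r c by (subst integral_density) auto
        also have "\<dots> = (\<integral>\<omega>. (r \<omega> *\<^sub>R iexp (W ?s \<omega>)) / c \<partial>M)"
        proof (rule integral_cong_AE)
          show "AE \<omega> in M. (r \<omega> / c) *\<^sub>R iexp (S \<omega>) = (r \<omega> *\<^sub>R iexp (W ?s \<omega>)) / c"
            using ae by eventually_elim (simp add: scaleR_conv_of_real)
        qed measurable
        finally show ?thesis by simp
      qed
      from this[of p] this[of q] have "(\<integral>\<omega>. iexp (S \<omega>) \<partial>?N p) = (\<integral>\<omega>. iexp (S \<omega>) \<partial>?N q)"
        using pq eq[of ?s] by simp
      then show "(\<integral>\<omega>. iexp (\<Sum>t\<in>J. a t * X t \<omega>) \<partial>?N p) = (\<integral>\<omega>. iexp (\<Sum>t\<in>J. a t * X t \<omega>) \<partial>?N q)"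
        by (simp only: S_def)
    qed
    have gen: "sets M \<subseteq> {?Xm -` B \<inter> space M | B. B \<in> sets ?P}"
    proof -
      have eqv: "{?Xm -` B \<inter> space M | B. B \<in> sets ?P} = sets (vimage_algebra (space M) ?Xm ?P)"
        using measurable_space[OF Xm] by (subst sets_vimage_algebra2) auto
      have "X t -` A \<inter> space M \<in> sets (vimage_algebra (space M) ?Xm ?P)"
        if "t \<in> {0..T}" "A \<in> sets borel" for t A
      proof -
        have "(\<lambda>x. x t) -` A \<inter> space ?P \<in> sets ?P"
          using that by (intro measurable_sets[OF measurable_component_singleton]) auto
        then have "?Xm -` ((\<lambda>x. x t) -` A \<inter> space ?P) \<inter> space M \<in> sets (vimage_algebra (space M) ?Xm ?P)"
          unfolding eqv[symmetric] by blast
        moreover have "?Xm -` ((\<lambda>x. x t) -` A \<inter> space ?P) \<inter> space M = X t -` A \<inter> space M"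
          using that measurable_space[OF Xm] by auto
        ultimately show ?thesis by simp
      qed
      then have "(\<Union>t\<in>{0..T}. {X t -` A \<inter> space M | A. A \<in> sets borel}) \<subseteq> sets (vimage_algebra (space M) ?Xm ?P)"
        by blast
      from sets.sigma_sets_subset[OF this] show ?thesis unfolding eqv by (simp only: sets_M space_vimage_algebra)
    qed
    have "?N p = ?N q"
    proof (rule measure_eqI)
      fix A assume "A \<in> sets (?N p)"
      then obtain B where B: "B \<in> sets ?P" and A: "A = ?Xm -` B \<inter> space M" using gen by auto
      have "emeasure (distr (?N r) ?P ?Xm) B = emeasure (?N r) A" for r
        using B A by (subst emeasure_distr) auto
      then show "emeasure (?N p) A = emeasure (?N q) A" using distr by metis
    qed simp
    then have "AE \<omega> in M. ennreal (p \<omega> / c) = ennreal (q \<omega> / c)"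
      using density_unique_iff[of "\<lambda>\<omega>. ennreal (p \<omega> / c)" "\<lambda>\<omega>. ennreal (q \<omega> / c)"] by simp
    then show ?thesis
    proof eventually_elim
      case (elim \<omega>)
      then have "p \<omega> = q \<omega>" using c pq(3,4)[of \<omega>] by (simp add: divide_nonneg_pos)
      then show ?case by (simp add: pq(1))
    qed
  qed
qed

end

context isonormal_path_process
begin

lemma finite_measure_L: "finite_measure L"
  by (rule finite_measureI, unfold measure_L) simp

lemma pair_L_M: "pair_sigma_finite L M"
  using finite_measure_L unfolding pair_sigma_finite_def
  by (simp add: finite_measure.sigma_finite_measure sigma_finite_measure_axioms)

lemma set_integral_L: "(LINT t:{0..T}|lborel. f t) = (\<integral>t. f t \<partial>L)" for f :: "real \<Rightarrow> real"
  by (simp add: set_lebesgue_integral_def integral_restrict_space)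

lemma set_integrable_L: "set_integrable lborel {0..T} f \<longleftrightarrow> integrable L f" for f :: "real \<Rightarrow> real"
  by (simp add: set_integrable_def integrable_restrict_space)

lemma l2norm_L: "l2norm T f = sqrt (\<integral>t. (f t)\<^sup>2 \<partial>L)"
  by (simp add: l2norm_def set_integral_L)

lemma Gam_measurable[measurable]: "Gam chi g \<in> borel_measurable L"
proof -
  have [measurable]: "(\<lambda>(t, \<omega>). X t \<omega> * W g \<omega>) \<in> borel_measurable (L \<Otimes>\<^sub>M M)"
  proof -
    have "(\<lambda>p. case_prod X p * W g (snd p)) \<in> borel_measurable (L \<Otimes>\<^sub>M M)" by measurable
    then show ?thesis by (simp add: case_prod_unfold)
  qed
  have "(\<lambda>t. \<integral>\<omega>. X t \<omega> * W g \<omega> \<partial>M) \<in> borel_measurable L"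
    by (rule borel_measurable_lebesgue_integral) measurable
  also have "?this \<longleftrightarrow> Gam chi g \<in> borel_measurable L"
  proof (rule measurable_cong)
    fix t assume "t \<in> space L"
    then have t: "t \<in> {0..T}" by (simp add: space_L)
    have "(\<integral>\<omega>. X t \<omega> * W g \<omega> \<partial>M) = (\<integral>\<omega>. W (chi t) \<omega> * W g \<omega> \<partial>M)"
      by (rule integral_cong_AE) (use W_chi[OF t] X_random[OF t] in auto)
    then show "(\<integral>\<omega>. X t \<omega> * W g \<omega> \<partial>M) = Gam chi g t"
      by (simp add: integral_W_mult Gam_def)
  qed
  finally show ?thesis .
qed

lemma Gam_bound: "\<bar>Gam chi g t\<bar> \<le> norm (chi t) * norm g"
  unfolding Gam_def by (rule Cauchy_Schwarz_ineq2)

lemma integrable_Gam_mult: "integrable L (\<lambda>t. Gam chi g t * Gam chi h t)"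
proof (rule Bochner_Integration.integrable_bound)
  show "integrable L (\<lambda>t. (norm g * norm h) * (norm (chi t))\<^sup>2)"
    using chi_square_integrable by simp
  show "AE t in L. norm (Gam chi g t * Gam chi h t) \<le> norm ((norm g * norm h) * (norm (chi t))\<^sup>2)"
  proof (rule AE_I2)
    fix t
    have "\<bar>Gam chi g t\<bar> * \<bar>Gam chi h t\<bar> \<le> (norm (chi t) * norm g) * (norm (chi t) * norm h)"
      by (intro mult_mono Gam_bound) auto
    then show "norm (Gam chi g t * Gam chi h t) \<le> norm ((norm g * norm h) * (norm (chi t))\<^sup>2)"
      by (simp add: abs_mult power2_eq_square mult_ac)
  qed
qed measurable

lemma
  assumes [measurable]: "f \<in> borel_measurable L" and sq: "integrable L (\<lambda>t. (f t)\<^sup>2)"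
  shows integrable_of_square_integrable: "integrable L f"
    and integral_abs_le_l2norm: "(\<integral>t. \<bar>f t\<bar> \<partial>L) \<le> sqrt T * l2norm T f"
proof -
  interpret L: finite_measure L by (rule finite_measure_L)
  have mL: "measure L {0..T} = T" using measure_L T_pos by (simp add: measure_def space_L)
  show i: "integrable L f"
  proof (rule Bochner_Integration.integrable_bound)
    show "integrable L (\<lambda>t. 1 + (f t)\<^sup>2)" using sq by simp
    show "AE t in L. norm (f t) \<le> norm (1 + (f t)\<^sup>2)"
      by (intro AE_I2) (simp add: abs_of_nonneg abs_le_one_plus_square)
  qed measurable
  define A where "A = (\<integral>t. \<bar>f t\<bar> \<partial>L)"
  have "0 \<le> (\<integral>t. (\<bar>f t\<bar> - A / T)\<^sup>2 \<partial>L)" by simp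
  also have "(\<lambda>t. (\<bar>f t\<bar> - A / T)\<^sup>2) = (\<lambda>t. (f t)\<^sup>2 + (A / T)\<^sup>2 - 2 * (A / T) * \<bar>f t\<bar>)"
    by (simp add: power2_diff algebra_simps)
  also have "(\<integral>t. (f t)\<^sup>2 + (A / T)\<^sup>2 - 2 * (A / T) * \<bar>f t\<bar> \<partial>L) = (\<integral>t. (f t)\<^sup>2 \<partial>L) + (A / T)\<^sup>2 * T - 2 * (A / T) * A"
    using sq i by (simp add: mL A_def space_L)
  also have "\<dots> = (\<integral>t. (f t)\<^sup>2 \<partial>L) - A\<^sup>2 / T"
    using T_pos by (simp add: power2_eq_square field_simps)
  finally have "A\<^sup>2 \<le> T * (\<integral>t. (f t)\<^sup>2 \<partial>L)" using T_pos by (simp add: field_simps)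
  then have "\<bar>A\<bar> \<le> sqrt (T * (\<integral>t. (f t)\<^sup>2 \<partial>L))" using real_sqrt_le_mono by fastforce
  then show "(\<integral>t. \<bar>f t\<bar> \<partial>L) \<le> sqrt T * l2norm T f"
    by (simp add: A_def l2norm_L real_sqrt_mult)
qed

lemma
  assumes [measurable]: "f \<in> borel_measurable L" "g \<in> borel_measurable L"
    and f: "integrable L (\<lambda>t. (f t)\<^sup>2)" and g: "integrable L (\<lambda>t. (g t)\<^sup>2)"
  shows square_integrable_diff: "integrable L (\<lambda>t. (f t - g t)\<^sup>2)"
    and l2norm_diff_le: "l2norm T (\<lambda>t. f t - g t) \<le> 2 * (l2norm T f + l2norm T g)"
proof -
  have le: "(x - y)\<^sup>2 \<le> 4 * x\<^sup>2 + 4 * y\<^sup>2" for x y :: real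
  proof -
    have "4 * x\<^sup>2 + 4 * y\<^sup>2 - (x - y)\<^sup>2 = 2 * x\<^sup>2 + 2 * y\<^sup>2 + (x + y)\<^sup>2"
      by (simp add: power2_eq_square algebra_simps)
    moreover have "0 \<le> 2 * x\<^sup>2 + 2 * y\<^sup>2 + (x + y)\<^sup>2" by simp
    ultimately show ?thesis by linarith
  qed
  have fg: "integrable L (\<lambda>t. 4 * (f t)\<^sup>2 + 4 * (g t)\<^sup>2)" using f g by simp
  show i: "integrable L (\<lambda>t. (f t - g t)\<^sup>2)"
    by (rule Bochner_Integration.integrable_bound[OF fg]) (use le in auto)
  have "(\<integral>t. (f t - g t)\<^sup>2 \<partial>L) \<le> (\<integral>t. 4 * (f t)\<^sup>2 + 4 * (g t)\<^sup>2 \<partial>L)"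
    by (rule integral_mono[OF i fg le])
  also have "\<dots> = 4 * (\<integral>t. (f t)\<^sup>2 \<partial>L) + 4 * (\<integral>t. (g t)\<^sup>2 \<partial>L)" using f g by simp
  finally have "l2norm T (\<lambda>t. f t - g t) \<le> sqrt (4 * (\<integral>t. (f t)\<^sup>2 \<partial>L) + 4 * (\<integral>t. (g t)\<^sup>2 \<partial>L))"
    by (simp add: l2norm_L)
  also have "\<dots> \<le> sqrt (4 * (\<integral>t. (f t)\<^sup>2 \<partial>L)) + sqrt (4 * (\<integral>t. (g t)\<^sup>2 \<partial>L))"
    by (rule sqrt_add_le_add_sqrt) simp_all
  finally show "l2norm T (\<lambda>t. f t - g t) \<le> 2 * (l2norm T f + l2norm T g)"
    by (simp add: l2norm_L real_sqrt_mult)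
qed

lemma l2norm_measurable:
  assumes [measurable]: "case_prod f \<in> borel_measurable (L \<Otimes>\<^sub>M M)"
  shows "(\<lambda>\<omega>. l2norm T (\<lambda>t. f t \<omega>)) \<in> borel_measurable M"
proof -
  interpret L: finite_measure L by (rule finite_measure_L)
  have [measurable]: "(\<lambda>(\<omega>, t). (f t \<omega>)\<^sup>2) \<in> borel_measurable (M \<Otimes>\<^sub>M L)"
  proof -
    have "(\<lambda>(\<omega>, t). case_prod f (t, \<omega>)) \<in> borel_measurable (M \<Otimes>\<^sub>M L)"
      by (rule measurable_pair_swap) measurable
    then have "(\<lambda>p. (case p of (\<omega>, t) \<Rightarrow> case_prod f (t, \<omega>))\<^sup>2) \<in> borel_measurable (M \<Otimes>\<^sub>M L)" by measurable
    then show ?thesis by (simp add: case_prod_unfold)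
  qed
  have "(\<lambda>\<omega>. \<integral>t. (f t \<omega>)\<^sup>2 \<partial>L) \<in> borel_measurable M"
    by (rule L.borel_measurable_lebesgue_integral) measurable
  then show ?thesis unfolding l2norm_L by measurable
qed

lemma section_measurable:
  assumes f: "case_prod f \<in> borel_measurable (L \<Otimes>\<^sub>M M)"
  shows "\<omega> \<in> space M \<Longrightarrow> (\<lambda>t. f t \<omega>) \<in> borel_measurable L"
    and "t \<in> {0..T} \<Longrightarrow> f t \<in> borel_measurable M"
  using measurable_compose[OF measurable_Pair2' f, of \<omega>] measurable_compose[OF measurable_Pair1' f, of t]
  by (simp_all add: space_L)

lemma cyl_deriv_joint_measurable:
  assumes "\<And>i. i \<in> {1..m} \<Longrightarrow> (\<lambda>\<omega>. partial_deriv i f (\<lambda>j. W (g j) \<omega>)) \<in> borel_measurable M"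
  shows "case_prod (cyl_deriv chi W m g f) \<in> borel_measurable (L \<Otimes>\<^sub>M M)"
proof -
  have "(\<lambda>p. \<Sum>i=1..m. Gam chi (g i) (fst p) * partial_deriv i f (\<lambda>j. W (g j) (snd p))) \<in> borel_measurable (L \<Otimes>\<^sub>M M)"
  proof (intro borel_measurable_sum borel_measurable_times)
    fix i assume "i \<in> {1..m}"
    show "(\<lambda>p. Gam chi (g i) (fst p)) \<in> borel_measurable (L \<Otimes>\<^sub>M M)" by measurable
    show "(\<lambda>p. partial_deriv i f (\<lambda>j. W (g j) (snd p))) \<in> borel_measurable (L \<Otimes>\<^sub>M M)"
      by (rule measurable_compose[OF measurable_snd assms[OF \<open>i \<in> {1..m}\<close>]])
  qed
  then show ?thesis by (simp add: cyl_deriv_def[abs_def] case_prod_unfold)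
qed

lemma process_vector_measurable: "(\<lambda>\<omega> j. W (g j) \<omega>) \<in> measurable M (PiM UNIV (\<lambda>_. borel))"
  by (auto intro!: measurable_PiM_single')

lemma C1_cyl_measurable:
  assumes "C1_bounded m f"
  shows "cyl W g f \<in> borel_measurable M"
    and "case_prod (cyl_deriv chi W m g f) \<in> borel_measurable (L \<Otimes>\<^sub>M M)"
  using measurable_compose[OF process_vector_measurable C1_bounded_measurable(1)[OF assms]]
    measurable_compose[OF process_vector_measurable C1_bounded_measurable(2)[OF assms]]
  by (auto simp: cyl_def[abs_def] intro!: cyl_deriv_joint_measurable)

lemma C1_cyl_deriv_bound:
  assumes f: "C1_bounded m f"
  obtains K where "K \<ge> 0" "\<And>t \<omega>. \<bar>cyl_deriv chi W m g f t \<omega>\<bar> \<le> K * norm (chi t)"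
proof -
  obtain B where B: "\<And>i x. i \<in> {1..m} \<Longrightarrow> \<bar>partial_deriv i f x\<bar> \<le> B"
    using C1_bounded_bounds(2)[OF f] by blast
  have "\<bar>cyl_deriv chi W m g f t \<omega>\<bar> \<le> (\<Sum>i=1..m. norm (g i) * \<bar>B\<bar>) * norm (chi t)" for t \<omega>
  proof -
    have "\<bar>cyl_deriv chi W m g f t \<omega>\<bar> \<le> (\<Sum>i=1..m. \<bar>Gam chi (g i) t * partial_deriv i f (\<lambda>j. W (g j) \<omega>)\<bar>)"
      unfolding cyl_deriv_def by (rule sum_abs)
    also have "\<dots> \<le> (\<Sum>i=1..m. (norm (chi t) * norm (g i)) * \<bar>B\<bar>)"
      unfolding abs_mult by (intro sum_mono mult_mono Gam_bound order_trans[OF B]) auto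
    finally show ?thesis by (simp add: sum_distrib_right sum_distrib_left mult_ac)
  qed
  moreover have "0 \<le> (\<Sum>i=1..m. norm (g i) * \<bar>B\<bar>)" by (intro sum_nonneg) auto
  ultimately show ?thesis using that by blast
qed

text \<open>For cylindrical functionals this is \<open>cylindrical_test_identity\<close> with \<open>w = chi t\<close>. Convergence of
  the derivatives in \<open>L\<^sup>1(\<Omega>; L\<^sup>2)\<close> implies convergence in \<open>L\<^sup>1(dt \<otimes> dP)\<close>, hence along a subsequence
  in \<open>L\<^sup>1(dP)\<close> for almost every \<open>t\<close>, and both sides are continuous for these
  convergences. The exceptional null set of times does not depend on \<open>s\<close> and \<open>\<theta>\<close>.\<close>

lemma malliavin_test_identity:
  assumes DF: "has_malliavin_deriv M T chi W F DF"
  shows "AE t in L. integrable M (DF t) \<and>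
    (\<forall>s \<theta>. (\<integral>\<omega>. DF t \<omega> * test_fun (chi t) s \<theta> \<omega> \<partial>M) = (\<integral>\<omega>. F \<omega> * test_div (chi t) s \<theta> \<omega> \<partial>M))"
proof -
  interpret L: finite_measure L by (rule finite_measure_L)
  interpret P: pair_sigma_finite L M by (rule pair_L_M)
  have iF: "integrable M F" and mDF[measurable]: "case_prod DF \<in> borel_measurable (L \<Otimes>\<^sub>M M)"
    and sqDF: "AE \<omega> in M. integrable L (\<lambda>t. (DF t \<omega>)\<^sup>2)"
    and iDF: "integrable M (\<lambda>\<omega>. l2norm T (\<lambda>t. DF t \<omega>))"
    using DF by (auto simp: has_malliavin_deriv_def set_integrable_L)
  have [measurable]: "F \<in> borel_measurable M" using iF by auto
  obtain m g f where C1: "\<And>N::nat. C1_bounded (m N) (f N)"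
    and conv: "(\<lambda>N. \<integral>\<omega>. \<bar>cyl W (g N) (f N) \<omega> - F \<omega>\<bar> \<partial>M) \<longlonglongrightarrow> 0"
    and convD: "(\<lambda>N. \<integral>\<omega>. l2norm T (\<lambda>t. cyl_deriv chi W (m N) (g N) (f N) t \<omega> - DF t \<omega>) \<partial>M) \<longlonglongrightarrow> 0"
    using DF unfolding has_malliavin_deriv_def by blast
  define G where "G N = cyl W (g N) (f N)" for N
  define D where "D N = cyl_deriv chi W (m N) (g N) (f N)" for N
  define \<Delta> where "\<Delta> N t \<omega> = D N t \<omega> - DF t \<omega>" for N t \<omega>
  have mG[measurable]: "G N \<in> borel_measurable M" for N unfolding G_def by (rule C1_cyl_measurable[OF C1])
  have mD[measurable]: "case_prod (D N) \<in> borel_measurable (L \<Otimes>\<^sub>M M)" for N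
    unfolding D_def by (rule C1_cyl_measurable[OF C1])
  have m\<Delta>[measurable]: "case_prod (\<Delta> N) \<in> borel_measurable (L \<Otimes>\<^sub>M M)" for N
  proof -
    have "(\<lambda>p. case_prod (D N) p - case_prod DF p) \<in> borel_measurable (L \<Otimes>\<^sub>M M)" by measurable
    then show ?thesis by (simp add: \<Delta>_def[abs_def] case_prod_unfold)
  qed
  have "\<exists>K\<ge>0. \<forall>t \<omega>. \<bar>D N t \<omega>\<bar> \<le> K * norm (chi t)" for N
    unfolding D_def by (rule C1_cyl_deriv_bound[OF C1, of N "g N"]) blast
  then obtain K where K0: "\<And>N. K N \<ge> 0" and K: "\<And>N t \<omega>. \<bar>D N t \<omega>\<bar> \<le> K N * norm (chi t)" by metis
  have bG: "\<exists>B. \<forall>\<omega>. \<bar>G N \<omega>\<bar> \<le> B" for N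
    using C1_bounded_bounds(1)[OF C1, of N] by (auto simp: G_def cyl_def)
  have iG: "integrable M (G N)" for N
  proof -
    obtain B where "\<And>\<omega>. \<bar>G N \<omega>\<bar> \<le> B" using bG[of N] by blast
    then show ?thesis by (intro integrable_const_bound[where B=B]) auto
  qed
  have sqD: "integrable L (\<lambda>t. (D N t \<omega>)\<^sup>2)" "l2norm T (\<lambda>t. D N t \<omega>) \<le> sqrt (\<integral>t. (K N * norm (chi t))\<^sup>2 \<partial>L)"
    if "\<omega> \<in> space M" for N \<omega>
  proof -
    have le: "(D N t \<omega>)\<^sup>2 \<le> (K N * norm (chi t))\<^sup>2" for t
      using power_mono[OF K[of N t \<omega>], of 2] by simp
    have i: "integrable L (\<lambda>t. (K N * norm (chi t))\<^sup>2)" using chi_square_integrable by (simp add: power_mult_distrib)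
    have [measurable]: "(\<lambda>t. D N t \<omega>) \<in> borel_measurable L" by (rule section_measurable(1)[OF mD that])
    show j: "integrable L (\<lambda>t. (D N t \<omega>)\<^sup>2)"
      by (rule Bochner_Integration.integrable_bound[OF i]) (use le in auto)
    show "l2norm T (\<lambda>t. D N t \<omega>) \<le> sqrt (\<integral>t. (K N * norm (chi t))\<^sup>2 \<partial>L)"
      unfolding l2norm_L by (intro real_sqrt_le_mono integral_mono[OF j i le])
  qed
  have l2nn: "0 \<le> l2norm T f" for f by (simp add: l2norm_L)
  have i\<Delta>n: "integrable M (\<lambda>\<omega>. l2norm T (\<lambda>t. \<Delta> N t \<omega>))"
    and ae\<Delta>: "AE \<omega> in M. integrable L (\<lambda>t. (\<Delta> N t \<omega>)\<^sup>2)" for N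
  proof -
    have ae: "AE \<omega> in M. integrable L (\<lambda>t. (\<Delta> N t \<omega>)\<^sup>2) \<and>
      l2norm T (\<lambda>t. \<Delta> N t \<omega>) \<le> 2 * (sqrt (\<integral>t. (K N * norm (chi t))\<^sup>2 \<partial>L) + l2norm T (\<lambda>t. DF t \<omega>))"
      using sqDF AE_space
    proof eventually_elim
      case (elim \<omega>)
      note m = section_measurable(1)[OF mD elim(2), of N] section_measurable(1)[OF mDF elim(2)]
      show ?case
        using square_integrable_diff[OF m sqD(1)[OF elim(2)] elim(1)]
          l2norm_diff_le[OF m sqD(1)[OF elim(2)] elim(1)] sqD(2)[OF elim(2), of N]
        by (auto simp: \<Delta>_def)
    qed
    then show "AE \<omega> in M. integrable L (\<lambda>t. (\<Delta> N t \<omega>)\<^sup>2)" by eventually_elim simp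
    show "integrable M (\<lambda>\<omega>. l2norm T (\<lambda>t. \<Delta> N t \<omega>))"
    proof (rule Bochner_Integration.integrable_bound)
      show "integrable M (\<lambda>\<omega>. 2 * (sqrt (\<integral>t. (K N * norm (chi t))\<^sup>2 \<partial>L) + l2norm T (\<lambda>t. DF t \<omega>)))"
        using iDF by simp
      show "AE \<omega> in M. norm (l2norm T (\<lambda>t. \<Delta> N t \<omega>)) \<le> norm (2 * (sqrt (\<integral>t. (K N * norm (chi t))\<^sup>2 \<partial>L) + l2norm T (\<lambda>t. DF t \<omega>)))"
        using ae by eventually_elim (simp add: l2nn)
    qed (rule l2norm_measurable[OF m\<Delta>])
  qed
  have bound: "(\<integral>\<^sup>+p. ennreal (norm (case_prod (\<Delta> N) p)) \<partial>(L \<Otimes>\<^sub>M M)) \<le> ennreal (sqrt T * (\<integral>\<omega>. l2norm T (\<lambda>t. \<Delta> N t \<omega>) \<partial>M))" for N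
  proof -
    have "(\<integral>\<^sup>+p. ennreal (norm (case_prod (\<Delta> N) p)) \<partial>(L \<Otimes>\<^sub>M M)) = (\<integral>\<^sup>+\<omega>. (\<integral>\<^sup>+t. ennreal (norm (\<Delta> N t \<omega>)) \<partial>L) \<partial>M)"
      by (subst P.nn_integral_snd[symmetric]) auto
    also have "\<dots> \<le> (\<integral>\<^sup>+\<omega>. ennreal (sqrt T * l2norm T (\<lambda>t. \<Delta> N t \<omega>)) \<partial>M)"
    proof (rule nn_integral_mono_AE)
      show "AE \<omega> in M. (\<integral>\<^sup>+t. ennreal (norm (\<Delta> N t \<omega>)) \<partial>L) \<le> ennreal (sqrt T * l2norm T (\<lambda>t. \<Delta> N t \<omega>))"
        using ae\<Delta>[of N] AE_space
      proof eventually_elim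
        case (elim \<omega>)
        note m = section_measurable(1)[OF m\<Delta> elim(2), of N]
        have "(\<integral>\<^sup>+t. ennreal (norm (\<Delta> N t \<omega>)) \<partial>L) = ennreal (\<integral>t. norm (\<Delta> N t \<omega>) \<partial>L)"
          using integrable_of_square_integrable[OF m elim(1)] by (intro nn_integral_eq_integral) auto
        also have "\<dots> \<le> ennreal (sqrt T * l2norm T (\<lambda>t. \<Delta> N t \<omega>))"
          using integral_abs_le_l2norm[OF m elim(1)] by (intro ennreal_leI) simp
        finally show ?case .
      qed
    qed
    also have "\<dots> = ennreal (\<integral>\<omega>. sqrt T * l2norm T (\<lambda>t. \<Delta> N t \<omega>) \<partial>M)"
      using i\<Delta>n[of N] T_pos by (intro nn_integral_eq_integral) (auto simp: l2nn)
    finally show ?thesis by simp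
  qed
  have i\<Delta>: "integrable (L \<Otimes>\<^sub>M M) (case_prod (\<Delta> N))" for N
    using le_less_trans[OF bound[of N] ennreal_less_top] by (intro integrableI_bounded m\<Delta>) simp
  define u where "u N t = (\<integral>\<omega>. \<bar>\<Delta> N t \<omega>\<bar> \<partial>M)" for N t
  have i\<Delta>': "integrable (L \<Otimes>\<^sub>M M) (\<lambda>(t, \<omega>). \<bar>\<Delta> N t \<omega>\<bar>)" for N
    using integrable_norm[OF i\<Delta>[of N]] by (simp add: case_prod_unfold)
  have iu: "integrable L (u N)" for N
    using P.integrable_fst[OF i\<Delta>'[of N]] by (simp add: u_def[abs_def])
  have un: "0 \<le> u N t" for N t by (simp add: u_def)
  have "(\<lambda>N. \<integral>t. norm (u N t) \<partial>L) \<longlonglongrightarrow> 0"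
  proof (rule tendsto_sandwich)
    show "\<forall>\<^sub>F N in sequentially. 0 \<le> (\<integral>t. norm (u N t) \<partial>L)" by simp
    have "(\<integral>t. norm (u N t) \<partial>L) \<le> sqrt T * (\<integral>\<omega>. l2norm T (\<lambda>t. \<Delta> N t \<omega>) \<partial>M)" for N
    proof -
      have "(\<integral>t. norm (u N t) \<partial>L) = (\<integral>t. (\<integral>\<omega>. \<bar>\<Delta> N t \<omega>\<bar> \<partial>M) \<partial>L)" using un by (simp add: u_def)
      also have "\<dots> = (\<integral>p. norm (case_prod (\<Delta> N) p) \<partial>(L \<Otimes>\<^sub>M M))"
        using P.integral_fst[OF i\<Delta>'[of N]] by (simp add: case_prod_unfold)
      finally have "ennreal (\<integral>t. norm (u N t) \<partial>L) = (\<integral>\<^sup>+p. ennreal (norm (case_prod (\<Delta> N) p)) \<partial>(L \<Otimes>\<^sub>M M))"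
        using i\<Delta>[of N] by (subst nn_integral_eq_integral) auto
      moreover have "0 \<le> sqrt T * (\<integral>\<omega>. l2norm T (\<lambda>t. \<Delta> N t \<omega>) \<partial>M)"
        using T_pos by (intro mult_nonneg_nonneg integral_nonneg_AE) (auto simp: l2nn)
      ultimately show ?thesis using bound[of N] by (metis ennreal_le_iff)
    qed
    then show "\<forall>\<^sub>F N in sequentially. (\<integral>t. norm (u N t) \<partial>L) \<le> sqrt T * (\<integral>\<omega>. l2norm T (\<lambda>t. \<Delta> N t \<omega>) \<partial>M)" by simp
    show "(\<lambda>N. sqrt T * (\<integral>\<omega>. l2norm T (\<lambda>t. \<Delta> N t \<omega>) \<partial>M)) \<longlonglongrightarrow> 0"
      using tendsto_mult_left[OF convD, of "sqrt T"] by (simp add: \<Delta>_def D_def)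
  qed simp
  from tendsto_L1_AE_subseq[OF iu this] obtain r where r: "strict_mono r"
    and ur: "AE t in L. (\<lambda>N. u (r N) t) \<longlonglongrightarrow> 0" by blast
  have "AE t in L. \<forall>N. integrable M (\<Delta> N t)"
    using P.AE_integrable_fst[OF i\<Delta>] by (simp add: AE_all_countable)
  with ur AE_space show ?thesis
  proof eventually_elim
    case (elim t)
    then have t: "t \<in> {0..T}" by (simp add: space_L)
    have [measurable]: "D N t \<in> borel_measurable M" "\<Delta> N t \<in> borel_measurable M" "DF t \<in> borel_measurable M" for N
      using section_measurable(2)[OF mD t] section_measurable(2)[OF m\<Delta> t] section_measurable(2)[OF mDF t] by auto
    have iD: "integrable M (D N t)" for N
      by (rule integrable_const_bound[where B="K N * norm (chi t)"]) (use K in auto)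
    have "integrable M (\<lambda>\<omega>. D 0 t \<omega> - \<Delta> 0 t \<omega>)"
      using iD elim by (intro Bochner_Integration.integrable_diff) auto
    then have iDFt: "integrable M (DF t)" by (simp add: \<Delta>_def)
    have "(\<integral>\<omega>. DF t \<omega> * test_fun (chi t) s \<theta> \<omega> \<partial>M) = (\<integral>\<omega>. F \<omega> * test_div (chi t) s \<theta> \<omega> \<partial>M)" for s \<theta>
    proof (rule LIMSEQ_unique)
      let ?\<kappa> = "test_fun (chi t) s \<theta>" and ?R = "test_div (chi t) s \<theta>"
      have "(\<lambda>N. \<integral>\<omega>. \<bar>D (r N) t \<omega> - DF t \<omega>\<bar> \<partial>M) \<longlonglongrightarrow> 0"
        using elim by (simp add: u_def \<Delta>_def)
      then show "(\<lambda>N. \<integral>\<omega>. D (r N) t \<omega> * ?\<kappa> \<omega> \<partial>M) \<longlonglongrightarrow> (\<integral>\<omega>. DF t \<omega> * ?\<kappa> \<omega> \<partial>M)"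
        by (intro tendsto_integral_mult_bounded[OF iD iDFt _ test_fun_bound]) measurable
      have DG: "(\<integral>\<omega>. D N t \<omega> * ?\<kappa> \<omega> \<partial>M) = (\<integral>\<omega>. G N \<omega> * ?R \<omega> \<partial>M)" for N
        using cylindrical_test_identity[OF C1[of N], of "g N" "chi t" s \<theta>]
        by (simp add: D_def G_def cyl_def cyl_deriv_def Gam_def inner_commute[of "chi t"])
      have "(\<lambda>N. \<integral>\<omega>. G N \<omega> * ?R \<omega> \<partial>M) \<longlonglongrightarrow> (\<integral>\<omega>. F \<omega> * ?R \<omega> \<partial>M)"
        using conv by (intro tendsto_integral_mult_bounded[OF iG iF _ test_div_bound]) (auto simp: G_def)
      then show "(\<lambda>N. \<integral>\<omega>. D (r N) t \<omega> * ?\<kappa> \<omega> \<partial>M) \<longlonglongrightarrow> (\<integral>\<omega>. F \<omega> * ?R \<omega> \<partial>M)"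
        unfolding DG using LIMSEQ_subseq_LIMSEQ[OF _ r] by (simp add: o_def)
    qed
    then show ?case using iDFt by blast
  qed
qed

text \<open>At almost every time the difference of two derivatives annihilates all test functions. The
  phases \<open>\<theta> = 0\<close> and \<open>\<theta> = - pi / 2\<close> supply the real and the imaginary part of \<open>iexp (W s)\<close>, so
  \<open>AE_zero_of_char_zero\<close> applies to the difference times the bump.\<close>

lemma malliavin_deriv_unique:
  assumes D1: "has_malliavin_deriv M T chi W F D1" and D2: "has_malliavin_deriv M T chi W F D2"
  shows "AE (t, \<omega>) in L \<Otimes>\<^sub>M M. D1 t \<omega> = D2 t \<omega>"
proof -
  interpret P: pair_sigma_finite L M by (rule pair_L_M)
  have [measurable]: "case_prod D1 \<in> borel_measurable (L \<Otimes>\<^sub>M M)" "case_prod D2 \<in> borel_measurable (L \<Otimes>\<^sub>M M)"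
    using D1 D2 by (auto simp: has_malliavin_deriv_def)
  have "AE t in L. AE \<omega> in M. D1 t \<omega> = D2 t \<omega>"
    using malliavin_test_identity[OF D1] malliavin_test_identity[OF D2]
  proof eventually_elim
    case (elim t)
    define \<rho> where "\<rho> \<omega> = (D1 t \<omega> - D2 t \<omega>) * bump (W (chi t) \<omega>)" for \<omega>
    have i: "integrable M (D1 t)" "integrable M (D2 t)" using elim by auto
    have [measurable]: "D1 t \<in> borel_measurable M" "D2 t \<in> borel_measurable M" using i by auto
    have i\<rho>: "integrable M \<rho>"
      unfolding \<rho>_def using i bump_pos bump_le_1
      by (intro integrable_mult_bounded[where c=1] Bochner_Integration.integrable_diff) (auto simp: abs_of_pos)
    have cos0: "(\<integral>\<omega>. \<rho> \<omega> * cos (W s \<omega> + \<theta>) \<partial>M) = 0" for s \<theta>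
    proof -
      have "(\<integral>\<omega>. \<rho> \<omega> * cos (W s \<omega> + \<theta>) \<partial>M)
        = (\<integral>\<omega>. D1 t \<omega> * test_fun (chi t) s \<theta> \<omega> - D2 t \<omega> * test_fun (chi t) s \<theta> \<omega> \<partial>M)"
        by (intro Bochner_Integration.integral_cong refl) (simp add: \<rho>_def test_fun_def algebra_simps)
      also have "\<dots> = (\<integral>\<omega>. D1 t \<omega> * test_fun (chi t) s \<theta> \<omega> \<partial>M) - (\<integral>\<omega>. D2 t \<omega> * test_fun (chi t) s \<theta> \<omega> \<partial>M)"
        using i by (intro Bochner_Integration.integral_diff integrable_mult_bounded[OF _ _ test_fun_bound]) auto
      also have "\<dots> = 0" using elim by simp
      finally show ?thesis .
    qed
    have "AE \<omega> in M. \<rho> \<omega> = 0"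
    proof (rule AE_zero_of_char_zero[OF i\<rho>])
      fix s
      have [measurable]: "\<rho> \<in> borel_measurable M" using i\<rho> by auto
      have ii: "integrable M (\<lambda>\<omega>. \<rho> \<omega> *\<^sub>R iexp (W s \<omega>))"
        by (rule Bochner_Integration.integrable_bound[OF i\<rho>]) auto
      have "Re (\<integral>\<omega>. \<rho> \<omega> *\<^sub>R iexp (W s \<omega>) \<partial>M) = (\<integral>\<omega>. \<rho> \<omega> * cos (W s \<omega> + 0) \<partial>M)"
        unfolding integral_Re[OF ii, symmetric] by (simp add: Re_exp)
      moreover have "Im (\<integral>\<omega>. \<rho> \<omega> *\<^sub>R iexp (W s \<omega>) \<partial>M) = (\<integral>\<omega>. \<rho> \<omega> * cos (W s \<omega> + (- (pi / 2))) \<partial>M)"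
        unfolding integral_Im[OF ii, symmetric] by (simp add: Im_exp cos_diff)
      ultimately show "(\<integral>\<omega>. \<rho> \<omega> *\<^sub>R iexp (W s \<omega>) \<partial>M) = 0"
        unfolding cos0 by (simp add: complex_eq_iff)
    qed
    then show "AE \<omega> in M. D1 t \<omega> = D2 t \<omega>"
      by eventually_elim (use bump_pos in \<open>auto simp: \<rho>_def less_imp_neq[THEN not_sym]\<close>)
  qed
  then show ?thesis
    by (intro P.AE_pair_measure) (auto simp: case_prod_unfold)
qed

end

section \<open>The functional and its derivative\<close>

locale orthogonal_gaussian_system = isonormal_path_process M W T X chi
  for M :: "'a measure" and W :: "'h::real_inner \<Rightarrow> 'a \<Rightarrow> real" and T X and chi :: "real \<Rightarrow> 'h" +
  fixes h :: "nat \<Rightarrow> 'h" and lam :: "nat \<Rightarrow> real" and n :: nat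
  assumes h_orth: "\<And>j k. j \<in> {1..n} \<Longrightarrow> k \<in> {1..n} \<Longrightarrow> j \<noteq> k \<Longrightarrow>
      (\<integral>t. Gam chi (h j) t * Gam chi (h k) t \<partial>restrict_space lborel {0..T}) = 0"
    and lam_def: "lam = (\<lambda>k. l2norm T (Gam chi (h k)))"
    and lam_pos: "\<And>k. k \<in> {1..n} \<Longrightarrow> lam k > 0"
    and n_ge_3: "n \<ge> 3"
begin

lemma integral_Gam_orth:
  assumes "j \<in> {1..n}" "k \<in> {1..n}"
  shows "(\<integral>t. Gam chi (h j) t * Gam chi (h k) t \<partial>L) = (if j = k then (lam k)\<^sup>2 else 0)"
proof (cases "j = k")
  case True
  have "(lam k)\<^sup>2 = (\<integral>t. (Gam chi (h k) t)\<^sup>2 \<partial>L)" by (simp add: lam_def l2norm_L)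
  then show ?thesis using True by (simp add: power2_eq_square)
next
  case False
  then show ?thesis using h_orth[OF assms] by simp
qed

lemma integral_comb_mult_Gam:
  assumes "j \<in> {1..n}"
  shows "(\<integral>t. (\<Sum>k=1..n. a k * Gam chi (h k) t) * Gam chi (h j) t \<partial>L) = a j * (lam j)\<^sup>2"
proof -
  have "(\<integral>t. (\<Sum>k=1..n. a k * Gam chi (h k) t) * Gam chi (h j) t \<partial>L)
    = (\<integral>t. (\<Sum>k=1..n. a k * (Gam chi (h k) t * Gam chi (h j) t)) \<partial>L)"
    by (simp add: sum_distrib_right mult.assoc)
  also have "\<dots> = (\<Sum>k=1..n. a k * (\<integral>t. Gam chi (h k) t * Gam chi (h j) t \<partial>L))"
    by (simp add: Bochner_Integration.integral_sum integrable_Gam_mult)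
  also have "\<dots> = (\<Sum>k=1..n. if k = j then a j * (lam j)\<^sup>2 else 0)"
    using assms by (intro sum.cong refl) (simp add: integral_Gam_orth)
  also have "\<dots> = a j * (lam j)\<^sup>2" using assms by simp
  finally show ?thesis .
qed

lemma
  shows integrable_comb_square: "integrable L (\<lambda>t. (\<Sum>k=1..n. a k * Gam chi (h k) t)\<^sup>2)"
    and integral_comb_square: "(\<integral>t. (\<Sum>k=1..n. a k * Gam chi (h k) t)\<^sup>2 \<partial>L) = (\<Sum>k=1..n. (a k)\<^sup>2 * (lam k)\<^sup>2)"
proof -
  have eq: "(\<Sum>k=1..n. a k * Gam chi (h k) t)\<^sup>2 = (\<Sum>j=1..n. a j * ((\<Sum>k=1..n. a k * Gam chi (h k) t) * Gam chi (h j) t))" for t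
    by (simp add: power2_eq_square sum_distrib_left mult_ac)
  have i: "integrable L (\<lambda>t. (\<Sum>k=1..n. a k * Gam chi (h k) t) * Gam chi (h j) t)" for j
    by (simp add: sum_distrib_right mult.assoc integrable_Gam_mult)
  show "integrable L (\<lambda>t. (\<Sum>k=1..n. a k * Gam chi (h k) t)\<^sup>2)"
    unfolding eq by (intro Bochner_Integration.integrable_sum integrable_mult_right i)
  have "(\<integral>t. (\<Sum>k=1..n. a k * Gam chi (h k) t)\<^sup>2 \<partial>L)
    = (\<Sum>j=1..n. a j * (\<integral>t. (\<Sum>k=1..n. a k * Gam chi (h k) t) * Gam chi (h j) t \<partial>L))"
    unfolding eq by (subst Bochner_Integration.integral_sum, intro integrable_mult_right i) (simp only: integral_mult_right_zero)
  also have "\<dots> = (\<Sum>j=1..n. (a j)\<^sup>2 * (lam j)\<^sup>2)"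
  proof (intro sum.cong refl)
    fix j assume "j \<in> {1..n}"
    from integral_comb_mult_Gam[OF this, of a]
    show "a j * (\<integral>t. (\<Sum>k=1..n. a k * Gam chi (h k) t) * Gam chi (h j) t \<partial>L) = (a j)\<^sup>2 * (lam j)\<^sup>2"
      by (simp only: power2_eq_square mult.assoc)
  qed
  finally show "(\<integral>t. (\<Sum>k=1..n. a k * Gam chi (h k) t)\<^sup>2 \<partial>L) = (\<Sum>k=1..n. (a k)\<^sup>2 * (lam k)\<^sup>2)" .
qed

lemma inj_h: "inj_on h {1..n}"
proof (rule inj_onI, rule ccontr)
  fix j k assume *: "j \<in> {1..n}" "k \<in> {1..n}" "h j = h k" "j \<noteq> k"
  then have "(lam k)\<^sup>2 = 0" using integral_Gam_orth[of j k] integral_Gam_orth[of k k] by simp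
  then show False using lam_pos[of k] * by simp
qed

lemma independent_h: "independent (h ` {1..n})"
proof (rule independent_if_scalars_zero)
  fix u v assume 0: "(\<Sum>v\<in>h ` {1..n}. u v *\<^sub>R v) = 0" and "v \<in> h ` {1..n}"
  then obtain j where j: "j \<in> {1..n}" "v = h j" by auto
  have "(\<Sum>k=1..n. u (h k) *\<^sub>R h k) = 0"
    using 0 by (subst (asm) sum.reindex[OF inj_h]) (simp add: o_def)
  then have "chi t \<bullet> (\<Sum>k=1..n. u (h k) *\<^sub>R h k) = 0" for t by (simp only: inner_zero_right)
  then have "(\<Sum>k=1..n. u (h k) * Gam chi (h k) t) = 0" for t
    by (simp only: Gam_def inner_sum_right inner_scaleR_right)
  then have "u (h j) * (lam j)\<^sup>2 = 0"
    using integral_comb_mult_Gam[OF j(1), of "\<lambda>k. u (h k)"] by simp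
  then show "u v = 0" using lam_pos[OF j(1)] j by simp
qed simp

definition q :: "(nat \<Rightarrow> real) \<Rightarrow> real" where
  "q x = (\<Sum>k=1..n. (x k)\<^sup>2 / (lam k)\<^sup>2)"

definition proj :: "(nat \<Rightarrow> real) \<Rightarrow> real \<Rightarrow> real" where
  "proj x t = (\<Sum>k=1..n. x k / (lam k)\<^sup>2 * Gam chi (h k) t)"

abbreviation Y :: "'a \<Rightarrow> nat \<Rightarrow> real" where "Y \<omega> \<equiv> (\<lambda>k. W (h k) \<omega>)"

lemma q_nonneg: "0 \<le> q x"
  unfolding q_def by (intro sum_nonneg) auto

lemma q_cong: "(\<And>k. k \<in> {1..n} \<Longrightarrow> x k = y k) \<Longrightarrow> q x = q y"
  unfolding q_def by (intro sum.cong) auto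

lemma coord_le_sqrt_q: "k \<in> {1..n} \<Longrightarrow> \<bar>x k\<bar> \<le> lam k * sqrt (q x)"
proof -
  assume k: "k \<in> {1..n}"
  have "(x k / lam k)\<^sup>2 \<le> q x"
    unfolding q_def power_divide using k by (intro member_le_sum) auto
  then have "\<bar>x k / lam k\<bar> \<le> sqrt (q x)" using real_sqrt_le_mono by fastforce
  then show ?thesis using lam_pos[OF k] by (simp add: field_simps)
qed

lemma continuous_on_q: "continuous_on S q"
  unfolding q_def[abs_def]
  by (intro continuous_intros continuous_on_subset[OF continuous_on_product_coordinates subset_UNIV])
    (use lam_pos in force)+

lemma q_measurable[measurable]: "q \<in> borel_measurable (PiM UNIV (\<lambda>_. borel))"
  by (rule continuous_borel_measurable_PiM[OF continuous_on_q])

lemma qY_measurable[measurable]: "(\<lambda>\<omega>. q (Y \<omega>)) \<in> borel_measurable M"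
  by (rule measurable_compose[OF process_vector_measurable q_measurable])

lemma integral_proj_square: "(\<integral>t. (proj x t)\<^sup>2 \<partial>L) = q x" and integrable_proj_square: "integrable L (\<lambda>t. (proj x t)\<^sup>2)"
proof -
  have "(\<Sum>k=1..n. (x k / (lam k)\<^sup>2)\<^sup>2 * (lam k)\<^sup>2) = q x"
    unfolding q_def
  proof (intro sum.cong refl)
    fix k assume "k \<in> {1..n}"
    then have "lam k \<noteq> 0" using lam_pos[of k] by simp
    then show "(x k / (lam k)\<^sup>2)\<^sup>2 * (lam k)\<^sup>2 = (x k)\<^sup>2 / (lam k)\<^sup>2"
      by (simp add: power_divide power2_eq_square)
  qed
  then show "(\<integral>t. (proj x t)\<^sup>2 \<partial>L) = q x"
    unfolding proj_def using integral_comb_square[of "\<lambda>k. x k / (lam k)\<^sup>2"] by simp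
  show "integrable L (\<lambda>t. (proj x t)\<^sup>2)"
    unfolding proj_def using integrable_comb_square[of "\<lambda>k. x k / (lam k)\<^sup>2"] by simp
qed

lemma proj_measurable_L[measurable]: "proj x \<in> borel_measurable L"
  unfolding proj_def[abs_def] by measurable

lemma l2norm_scaled_proj: "l2norm T (\<lambda>t. c * proj x t) = \<bar>c\<bar> * sqrt (q x)"
  by (simp add: l2norm_L power_mult_distrib integral_proj_square real_sqrt_mult)

lemma AE_q_pos: "AE \<omega> in M. q (Y \<omega>) > 0"
  using quadratic_form_negative_moment(1)[OF inj_h independent_h lam_pos, where s=0 and c="\<lambda>_. 0"] n_ge_3
  by (simp add: q_def)

lemma integrable_q_powr:
  assumes "0 \<le> s" "2 * s < real n"
  shows "integrable M (\<lambda>\<omega>. q (Y \<omega>) powr (-s))"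
proof (rule integrableI_bounded)
  show "(\<integral>\<^sup>+\<omega>. ennreal (norm (q (Y \<omega>) powr (-s))) \<partial>M) < \<infinity>"
    using quadratic_form_negative_moment(2)[OF inj_h independent_h lam_pos, where s=s and c="\<lambda>_. 0"] n_ge_3 assms
    by (simp add: q_def)
qed measurable

text \<open>The exponent in \<open>F = q(Y) powr \<alpha>\<close>.\<close>

definition \<alpha> :: real where "\<alpha> = (2 - real n) / 2"

lemma \<alpha>_neg: "\<alpha> < 0"
  using n_ge_3 by (simp add: \<alpha>_def)

text \<open>For \<open>\<epsilon> > 0\<close> a bounded smooth function; for \<open>\<epsilon> = 0\<close> the function defining \<open>F\<close>, with the value
  \<open>0 powr \<alpha> = 0\<close> at its singularity.\<close>

definition f_reg :: "real \<Rightarrow> (nat \<Rightarrow> real) \<Rightarrow> real" where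
  "f_reg \<epsilon> x = (q x + \<epsilon>) powr \<alpha>"

lemma q_deriv_coord:
  assumes k: "k \<in> {1..n}"
  shows "((\<lambda>s. q (x(k := s))) has_real_derivative 2 * s / (lam k)\<^sup>2) (at s)"
proof -
  have "q (x(k := s)) = s\<^sup>2 / (lam k)\<^sup>2 + (\<Sum>j\<in>{1..n} - {k}. (x j)\<^sup>2 / (lam j)\<^sup>2)" for s
    unfolding q_def using k by (subst sum.remove[of _ k]) (auto intro!: sum.cong)
  then show ?thesis
    by (simp only:) (rule DERIV_cong[OF DERIV_add[OF DERIV_cdivide[OF DERIV_power[OF DERIV_ident]] DERIV_const]], simp)
qed

lemma f_reg_has_partial:
  assumes k: "k \<in> {1..n}" and pos: "q x + \<epsilon> > 0"
  shows "((\<lambda>s. f_reg \<epsilon> (x(k := s))) has_real_derivative \<alpha> * (q x + \<epsilon>) powr (\<alpha> - 1) * (2 * x k / (lam k)\<^sup>2)) (at (x k))"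
proof -
  have "((\<lambda>s. (q (x(k := s)) + \<epsilon>) powr \<alpha>) has_real_derivative
      \<alpha> * (q (x(k := x k)) + \<epsilon>) powr (\<alpha> - 1) * (2 * x k / (lam k)\<^sup>2)) (at (x k))"
    using pos
    by (intro DERIV_chain2[OF has_real_derivative_powr] DERIV_cong[OF DERIV_add[OF q_deriv_coord[OF k] DERIV_const]]) auto
  then show ?thesis by (simp add: f_reg_def)
qed

lemma partial_deriv_f_reg:
  assumes "k \<in> {1..n}" "q x + \<epsilon> > 0"
  shows "partial_deriv k (f_reg \<epsilon>) x = (2 - real n) * (q x + \<epsilon>) powr (\<alpha> - 1) * (x k / (lam k)\<^sup>2)"
  unfolding partial_deriv_def DERIV_imp_deriv[OF f_reg_has_partial[OF assms]] by (simp add: \<alpha>_def)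

lemma C1_bounded_f_reg:
  assumes \<epsilon>: "\<epsilon> > 0"
  shows "C1_bounded n (f_reg \<epsilon>)"
proof -
  have pos: "q x + \<epsilon> > 0" for x using q_nonneg[of x] \<epsilon> by linarith
  have nz: "q x + \<epsilon> \<noteq> 0" for x using pos[of x] by simp
  note a = \<alpha>_neg
  have pd: "partial_deriv k (f_reg \<epsilon>) = (\<lambda>x. (2 - real n) * (q x + \<epsilon>) powr (\<alpha> - 1) * (x k / (lam k)\<^sup>2))"
    if "k \<in> {1..n}" for k
    using partial_deriv_f_reg[OF that pos] by (simp add: fun_eq_iff)
  have le: "(q x + \<epsilon>) powr b \<le> \<epsilon> powr b" if "b \<le> 0" for x b
    using that \<epsilon> q_nonneg[of x] by (intro powr_mono2') auto
  have bp: "\<bar>(2 - real n) * (q x + \<epsilon>) powr (\<alpha> - 1) * (x k / (lam k)\<^sup>2)\<bar> \<le> \<bar>2 - real n\<bar> * \<epsilon> powr (\<alpha> - 1/2) / lam k"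
    if k: "k \<in> {1..n}" for k x
  proof -
    note l = lam_pos[OF k]
    have "\<bar>x k\<bar> \<le> lam k * sqrt (q x + \<epsilon>)"
    proof -
      have "lam k * sqrt (q x) \<le> lam k * sqrt (q x + \<epsilon>)"
        using \<epsilon> l by (intro mult_left_mono real_sqrt_le_mono) auto
      with coord_le_sqrt_q[OF k, of x] show ?thesis by linarith
    qed
    then have x: "\<bar>x k / (lam k)\<^sup>2\<bar> \<le> (q x + \<epsilon>) powr (1/2) / lam k"
      using l pos[of x] by (simp add: powr_half_sqrt field_simps power2_eq_square)
    have "\<bar>(2 - real n) * (q x + \<epsilon>) powr (\<alpha> - 1) * (x k / (lam k)\<^sup>2)\<bar>
      = \<bar>2 - real n\<bar> * ((q x + \<epsilon>) powr (\<alpha> - 1) * \<bar>x k / (lam k)\<^sup>2\<bar>)"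
      by (simp add: abs_mult)
    also have "\<dots> \<le> \<bar>2 - real n\<bar> * ((q x + \<epsilon>) powr (\<alpha> - 1) * ((q x + \<epsilon>) powr (1/2) / lam k))"
      using x by (intro mult_left_mono) auto
    also have "(q x + \<epsilon>) powr (\<alpha> - 1) * ((q x + \<epsilon>) powr (1/2) / lam k) = (q x + \<epsilon>) powr (\<alpha> - 1/2) / lam k"
      by (simp add: powr_add[symmetric])
    also have "\<bar>2 - real n\<bar> * ((q x + \<epsilon>) powr (\<alpha> - 1/2) / lam k) \<le> \<bar>2 - real n\<bar> * (\<epsilon> powr (\<alpha> - 1/2) / lam k)"
      using le[of "\<alpha> - 1/2" x] a l by (intro mult_left_mono divide_right_mono) auto
    finally show ?thesis by simp
  qed
  show ?thesis
    unfolding C1_bounded_def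
  proof (intro conjI ballI allI impI)
    show "f_reg \<epsilon> x = f_reg \<epsilon> y" if "\<forall>i\<in>{1..n}. x i = y i" for x y
      unfolding f_reg_def using q_cong[of x y] that by simp
    show "continuous_on UNIV (f_reg \<epsilon>)"
      unfolding f_reg_def[abs_def] using nz by (intro continuous_intros continuous_on_q) auto
    show "bounded (range (f_reg \<epsilon>))"
      unfolding bounded_iff f_reg_def using le[of \<alpha>] a by (intro exI[of _ "\<epsilon> powr \<alpha>"]) auto
    fix k assume k: "k \<in> {1..n}"
    show "(\<lambda>s. f_reg \<epsilon> (x(k := s))) differentiable at (x k)" for x
      using f_reg_has_partial[OF k pos, of x] real_differentiable_def by blast
    show "continuous_on UNIV (partial_deriv k (f_reg \<epsilon>))"
      unfolding pd[OF k] using nz lam_pos[OF k]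
      by (intro continuous_intros continuous_on_q continuous_on_product_coordinates) auto
    show "bounded (range (partial_deriv k (f_reg \<epsilon>)))"
      unfolding pd[OF k] bounded_iff using bp[OF k] by (intro exI[of _ "\<bar>2 - real n\<bar> * \<epsilon> powr (\<alpha> - 1/2) / lam k"]) auto
  qed
qed

lemma cyl_deriv_f_reg:
  assumes "q (Y \<omega>) + \<epsilon> > 0"
  shows "cyl_deriv chi W n h (f_reg \<epsilon>) t \<omega> = (2 - real n) * (q (Y \<omega>) + \<epsilon>) powr (\<alpha> - 1) * proj (Y \<omega>) t"
proof -
  have "cyl_deriv chi W n h (f_reg \<epsilon>) t \<omega>
    = (\<Sum>i=1..n. Gam chi (h i) t * ((2 - real n) * (q (Y \<omega>) + \<epsilon>) powr (\<alpha> - 1) * (Y \<omega> i / (lam i)\<^sup>2)))"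
    unfolding cyl_deriv_def using assms by (intro sum.cong refl) (simp only: partial_deriv_f_reg)
  also have "\<dots> = (\<Sum>i=1..n. (2 - real n) * (q (Y \<omega>) + \<epsilon>) powr (\<alpha> - 1) * (Y \<omega> i / (lam i)\<^sup>2 * Gam chi (h i) t))"
    by (intro sum.cong refl) simp
  finally show ?thesis by (simp only: proj_def sum_distrib_left)
qed

text \<open>Where \<open>q\<close> vanishes the partial derivative does not exist and \<open>deriv\<close> has an unspecified value. That value is the
  same at all such points, because \<open>f_reg 0\<close> restricted to the line through any of them in the direction \<open>k\<close> is
  the same function; this keeps the pointwise derivative measurable.\<close>

lemma partial_deriv_f_at_singularity:
  assumes k: "k \<in> {1..n}" and q0: "q x = 0"
  shows "partial_deriv k (f_reg 0) x = deriv (\<lambda>s. (s\<^sup>2 / (lam k)\<^sup>2) powr \<alpha>) 0"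
proof -
  have x0: "x j = 0" if "j \<in> {1..n}" for j
    using coord_le_sqrt_q[OF that, of x] q0 by simp
  have "q (x(k := s)) = s\<^sup>2 / (lam k)\<^sup>2" for s
    unfolding q_def using k x0 by (subst sum.remove[of _ k]) (auto intro!: sum.neutral)
  then show ?thesis using x0[OF k] by (simp add: partial_deriv_def f_reg_def)
qed

lemma partial_deriv_f_measurable:
  assumes k: "k \<in> {1..n}"
  shows "(\<lambda>\<omega>. partial_deriv k (f_reg 0) (Y \<omega>)) \<in> borel_measurable M"
proof -
  have eq: "partial_deriv k (f_reg 0) (Y \<omega>) = (if q (Y \<omega>) = 0 then deriv (\<lambda>s. (s\<^sup>2 / (lam k)\<^sup>2) powr \<alpha>) 0
      else (2 - real n) * (q (Y \<omega>)) powr (\<alpha> - 1) * (Y \<omega> k / (lam k)\<^sup>2))" for \<omega>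
    using partial_deriv_f_at_singularity[OF k, of "Y \<omega>"] partial_deriv_f_reg[OF k, of "Y \<omega>" 0] q_nonneg[of "Y \<omega>"]
    by (cases "q (Y \<omega>) = 0") auto
  show ?thesis unfolding eq by measurable
qed

lemma integrable_F: "integrable M (cyl W h (f_reg 0))"
proof -
  have "2 * (- \<alpha>) = real n - 2" by (simp add: \<alpha>_def field_simps)
  then have "0 \<le> - \<alpha>" "2 * (- \<alpha>) < real n" using \<alpha>_neg by linarith+
  from integrable_q_powr[OF this] show ?thesis by (simp add: cyl_def[abs_def] f_reg_def)
qed

lemma powr_reg_tendsto:
  assumes "a > 0"
  shows "(\<lambda>N. (a + 1 / Suc N) powr b) \<longlonglongrightarrow> a powr b"
proof -
  have "(\<lambda>N. a + 1 / real (Suc N)) \<longlonglongrightarrow> a + 0"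
    by (intro tendsto_add tendsto_const LIMSEQ_Suc[OF lim_1_over_n])
  then show ?thesis using assms by (intro tendsto_powr tendsto_const) auto
qed

text \<open>Dominated convergence for \<open>\<epsilon> = 1 / (N + 1)\<close>. The functionals are dominated by \<open>q powr (- (n - 2) / 2)\<close>
  and the norms of the derivatives by a multiple of \<open>q powr (- (n - 1) / 2)\<close>; both are integrable by
  \<open>quadratic_form_negative_moment\<close>.\<close>

lemma has_malliavin_deriv_F: "has_malliavin_deriv M T chi W (cyl W h (f_reg 0)) (cyl_deriv chi W n h (f_reg 0))"
  unfolding has_malliavin_deriv_def
proof (intro conjI)
  note a = \<alpha>_neg
  define f where "f = f_reg 0"
  define DF where "DF = cyl_deriv chi W n h f"
  have DF: "DF t \<omega> = (2 - real n) * q (Y \<omega>) powr (\<alpha> - 1) * proj (Y \<omega>) t" if "q (Y \<omega>) > 0" for t \<omega>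
    using cyl_deriv_f_reg[of \<omega> 0 t] that by (simp add: DF_def f_def)
  show "integrable M (cyl W h (f_reg 0))" by (rule integrable_F)
  show mDF: "case_prod (cyl_deriv chi W n h (f_reg 0)) \<in> borel_measurable (L \<Otimes>\<^sub>M M)"
    by (rule cyl_deriv_joint_measurable[OF partial_deriv_f_measurable])
  show "AE \<omega> in M. set_integrable lborel {0..T} (\<lambda>t. (cyl_deriv chi W n h (f_reg 0) t \<omega>)\<^sup>2)"
    using AE_q_pos
  proof eventually_elim
    case (elim \<omega>)
    show ?case unfolding set_integrable_L
      using integrable_proj_square[of "Y \<omega>"] DF[OF elim] by (simp add: DF_def f_def power_mult_distrib)
  qed
  have half: "c * y powr (\<alpha> - 1) * sqrt y = c * y powr (- ((real n - 1) / 2))" if "y > 0" for c y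
  proof -
    have e: "\<alpha> - 1 + 1 / 2 = - ((real n - 1) / 2)" by (simp add: \<alpha>_def field_simps)
    have "y powr (\<alpha> - 1) * sqrt y = y powr (\<alpha> - 1 + 1 / 2)"
      using that by (simp only: powr_add powr_half_sqrt[OF less_imp_le[OF that]])
    then show ?thesis unfolding e by simp
  qed
  have l2DF: "AE \<omega> in M. l2norm T (\<lambda>t. DF t \<omega>) = (real n - 2) * q (Y \<omega>) powr (- ((real n - 1) / 2))"
    using AE_q_pos
  proof eventually_elim
    case (elim \<omega>)
    have "l2norm T (\<lambda>t. DF t \<omega>) = \<bar>(2 - real n) * q (Y \<omega>) powr (\<alpha> - 1)\<bar> * sqrt (q (Y \<omega>))"
      unfolding DF[OF elim] by (rule l2norm_scaled_proj)
    also have "\<dots> = (real n - 2) * q (Y \<omega>) powr (\<alpha> - 1) * sqrt (q (Y \<omega>))"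
      using n_ge_3 by (simp add: abs_mult)
    finally show ?case by (simp only: half[OF elim])
  qed
  have idom: "integrable M (\<lambda>\<omega>. (real n - 2) * q (Y \<omega>) powr (- ((real n - 1) / 2)))"
    using n_ge_3 by (intro integrable_mult_right integrable_q_powr) auto
  have "integrable M (\<lambda>\<omega>. l2norm T (\<lambda>t. DF t \<omega>)) \<longleftrightarrow> integrable M (\<lambda>\<omega>. (real n - 2) * q (Y \<omega>) powr (- ((real n - 1) / 2)))"
    by (rule integrable_cong_AE) (use l2norm_measurable[OF mDF] l2DF in \<open>simp_all add: DF_def f_def\<close>)
  with idom show "integrable M (\<lambda>\<omega>. l2norm T (\<lambda>t. cyl_deriv chi W n h (f_reg 0) t \<omega>))" by (simp add: DF_def f_def)
  show "\<exists>m g f. (\<forall>N::nat. C1_bounded (m N) (f N)) \<and>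
      (\<lambda>N. \<integral>\<omega>. \<bar>cyl W (g N) (f N) \<omega> - cyl W h (f_reg 0) \<omega>\<bar> \<partial>M) \<longlonglongrightarrow> 0 \<and>
      (\<lambda>N. \<integral>\<omega>. l2norm T (\<lambda>t. cyl_deriv chi W (m N) (g N) (f N) t \<omega> - cyl_deriv chi W n h (f_reg 0) t \<omega>) \<partial>M) \<longlonglongrightarrow> 0"
  proof (intro exI[of _ "\<lambda>_. n"] exI[of _ "\<lambda>_. h"] exI[of _ "\<lambda>N. f_reg (1 / Suc N)"] conjI allI)
    show C1: "C1_bounded n (f_reg (1 / real (Suc N)))" for N by (rule C1_bounded_f_reg) simp
    have mf: "(\<lambda>\<omega>. f_reg e (Y \<omega>)) \<in> borel_measurable M" for e unfolding f_reg_def by measurable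
    have pos: "0 < q (Y \<omega>) + 1 / real (Suc N)" if "q (Y \<omega>) > 0" for \<omega> N
      using that by (simp add: add_pos_pos)
    have le: "(q (Y \<omega>) + 1 / real (Suc N)) powr b \<le> q (Y \<omega>) powr b" if "q (Y \<omega>) > 0" "b \<le> 0" for \<omega> N b
      using that by (intro powr_mono2') auto
    have "(\<lambda>N. \<integral>\<omega>. \<bar>f_reg (1 / Suc N) (Y \<omega>) - f_reg 0 (Y \<omega>)\<bar> \<partial>M) \<longlonglongrightarrow> (\<integral>\<omega>. 0 \<partial>M)"
    proof (rule integral_dominated_convergence)
      show "integrable M (\<lambda>\<omega>. f_reg 0 (Y \<omega>))" using integrable_F by (simp add: cyl_def[abs_def])
      show "AE \<omega> in M. (\<lambda>N. \<bar>f_reg (1 / Suc N) (Y \<omega>) - f_reg 0 (Y \<omega>)\<bar>) \<longlonglongrightarrow> 0"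
        using AE_q_pos
      proof eventually_elim
        case (elim \<omega>)
        have "(\<lambda>N. \<bar>(q (Y \<omega>) + 1 / Suc N) powr \<alpha> - q (Y \<omega>) powr \<alpha>\<bar>) \<longlonglongrightarrow> \<bar>q (Y \<omega>) powr \<alpha> - q (Y \<omega>) powr \<alpha>\<bar>"
          by (intro tendsto_intros powr_reg_tendsto[OF elim])
        then show ?case by (simp add: f_reg_def)
      qed
      show "AE \<omega> in M. norm \<bar>f_reg (1 / Suc N) (Y \<omega>) - f_reg 0 (Y \<omega>)\<bar> \<le> f_reg 0 (Y \<omega>)" for N
        using AE_q_pos
      proof eventually_elim
        case (elim \<omega>)
        show ?case using le[OF elim, of \<alpha> N] a powr_ge_zero[of "q (Y \<omega>) + 1 / Suc N" \<alpha>]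
          unfolding f_reg_def by simp
      qed
    qed (use mf in measurable)
    then show "(\<lambda>N. \<integral>\<omega>. \<bar>cyl W h (f_reg (1 / real (Suc N))) \<omega> - cyl W h (f_reg 0) \<omega>\<bar> \<partial>M) \<longlonglongrightarrow> 0"
      by (simp add: cyl_def)
    let ?\<Delta> = "\<lambda>N t \<omega>. cyl_deriv chi W n h (f_reg (1 / real (Suc N))) t \<omega> - DF t \<omega>"
    have l2: "l2norm T (\<lambda>t. ?\<Delta> N t \<omega>) = (real n - 2) * (q (Y \<omega>) powr (\<alpha> - 1) - (q (Y \<omega>) + 1 / Suc N) powr (\<alpha> - 1)) * sqrt (q (Y \<omega>))"
      if "q (Y \<omega>) > 0" for N \<omega>
    proof -
      have "?\<Delta> N t \<omega> = ((2 - real n) * ((q (Y \<omega>) + 1 / Suc N) powr (\<alpha> - 1) - q (Y \<omega>) powr (\<alpha> - 1))) * proj (Y \<omega>) t" for t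
        unfolding DF[OF that] cyl_deriv_f_reg[OF pos[OF that]] by (simp add: algebra_simps)
      then have "l2norm T (\<lambda>t. ?\<Delta> N t \<omega>)
        = \<bar>(2 - real n) * ((q (Y \<omega>) + 1 / Suc N) powr (\<alpha> - 1) - q (Y \<omega>) powr (\<alpha> - 1))\<bar> * sqrt (q (Y \<omega>))"
        by (simp only: l2norm_scaled_proj)
      also have "\<bar>(2 - real n) * ((q (Y \<omega>) + 1 / Suc N) powr (\<alpha> - 1) - q (Y \<omega>) powr (\<alpha> - 1))\<bar>
        = (real n - 2) * (q (Y \<omega>) powr (\<alpha> - 1) - (q (Y \<omega>) + 1 / Suc N) powr (\<alpha> - 1))"
        using n_ge_3 le[OF that, of "\<alpha> - 1" N] a by (simp only: abs_mult) simp
      finally show ?thesis .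
    qed
    have "(\<lambda>N. \<integral>\<omega>. l2norm T (\<lambda>t. ?\<Delta> N t \<omega>) \<partial>M) \<longlonglongrightarrow> (\<integral>\<omega>. 0 \<partial>M)"
    proof (rule integral_dominated_convergence[OF _ _ idom])
      have "case_prod (\<lambda>t \<omega>. ?\<Delta> N t \<omega>) \<in> borel_measurable (L \<Otimes>\<^sub>M M)" for N
        using borel_measurable_diff[OF C1_cyl_measurable(2)[OF C1[of N], of h] mDF]
        by (simp add: DF_def f_def case_prod_unfold)
      then show "(\<lambda>\<omega>. l2norm T (\<lambda>t. ?\<Delta> N t \<omega>)) \<in> borel_measurable M" for N
        by (rule l2norm_measurable)
      show "AE \<omega> in M. (\<lambda>N. l2norm T (\<lambda>t. ?\<Delta> N t \<omega>)) \<longlonglongrightarrow> 0"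
        using AE_q_pos
      proof eventually_elim
        case (elim \<omega>)
        have "(\<lambda>N. (real n - 2) * (q (Y \<omega>) powr (\<alpha> - 1) - (q (Y \<omega>) + 1 / Suc N) powr (\<alpha> - 1)) * sqrt (q (Y \<omega>)))
          \<longlonglongrightarrow> (real n - 2) * (q (Y \<omega>) powr (\<alpha> - 1) - q (Y \<omega>) powr (\<alpha> - 1)) * sqrt (q (Y \<omega>))"
          by (intro tendsto_intros powr_reg_tendsto[OF elim])
        then show ?case unfolding l2[OF elim] by simp
      qed
      show "AE \<omega> in M. norm (l2norm T (\<lambda>t. ?\<Delta> N t \<omega>)) \<le> (real n - 2) * q (Y \<omega>) powr (- ((real n - 1) / 2))" for N
        using AE_q_pos
      proof eventually_elim
        case (elim \<omega>)
        have "l2norm T (\<lambda>t. ?\<Delta> N t \<omega>) \<le> (real n - 2) * q (Y \<omega>) powr (\<alpha> - 1) * sqrt (q (Y \<omega>))"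
          unfolding l2[OF elim] using n_ge_3 by (intro mult_right_mono mult_left_mono) (auto simp: q_nonneg)
        moreover have "0 \<le> l2norm T (\<lambda>t. ?\<Delta> N t \<omega>)" by (simp add: l2norm_L)
        ultimately show ?case by (simp only: half[OF elim] real_norm_def abs_of_nonneg)
      qed
    qed simp
    then show "(\<lambda>N. \<integral>\<omega>. l2norm T (\<lambda>t. cyl_deriv chi W n h (f_reg (1 / real (Suc N))) t \<omega> - cyl_deriv chi W n h (f_reg 0) t \<omega>) \<partial>M) \<longlonglongrightarrow> 0"
      by (simp add: DF_def f_def)
  qed
qed

lemma log_deriv_F:
  assumes "q (Y \<omega>) > 0"
  shows "cyl_deriv chi W n h (f_reg 0) t \<omega> / cyl W h (f_reg 0) \<omega> = - (real n - 2) * (proj (Y \<omega>) t / q (Y \<omega>))"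
proof -
  have "q (Y \<omega>) powr (\<alpha> - 1) = q (Y \<omega>) powr \<alpha> / q (Y \<omega>)" using assms by (simp add: powr_diff)
  then have 1: "cyl_deriv chi W n h (f_reg 0) t \<omega> = (2 - real n) * (q (Y \<omega>) powr \<alpha> / q (Y \<omega>)) * proj (Y \<omega>) t"
    using cyl_deriv_f_reg[of \<omega> 0 t] assms by simp
  have 2: "cyl W h (f_reg 0) \<omega> = q (Y \<omega>) powr \<alpha>" by (simp add: cyl_def f_reg_def)
  have "(2 - real n) * (A / Q) * P / A = - (real n - 2) * (P / Q)" if "A \<noteq> 0" "Q \<noteq> 0" for A P Q :: real
    using that by (simp add: field_simps)
  then show ?thesis unfolding 1 2 using assms by simp
qed

end

context orthogonal_gaussian_system
begin

section \<open>Stein's identity and the risk\<close>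

lemma proj_add_line: "proj (\<lambda>i. x i + z * d i) t = proj x t + z * proj d t"
  unfolding proj_def by (simp add: sum.distrib sum_distrib_left add_divide_distrib distrib_right mult.assoc)

lemma q_line_derivative:
  "((\<lambda>z. q (\<lambda>i. x i + z * Gam chi (h i) t)) has_real_derivative 2 * proj (\<lambda>i. x i + z * Gam chi (h i) t) t) (at z)"
proof -
  have "((\<lambda>z. (x k + z * Gam chi (h k) t)\<^sup>2 / (lam k)\<^sup>2) has_real_derivative
      2 * ((x k + z * Gam chi (h k) t) / (lam k)\<^sup>2 * Gam chi (h k) t)) (at z)" for k
    by (rule DERIV_cong[OF DERIV_cdivide[OF DERIV_power[OF DERIV_add[OF DERIV_const DERIV_cmult_right[OF DERIV_ident]]]]]) simp
  then show ?thesis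
    unfolding q_def proj_def sum_distrib_left by (intro DERIV_sum) auto
qed

text \<open>The derivative of \<open>proj x t\<close> in the direction \<open>chi t\<close>; its time integral is the trace \<open>n\<close> of the
  projection.\<close>

definition trace :: "real \<Rightarrow> real" where
  "trace t = proj (\<lambda>k. Gam chi (h k) t) t"

lemma trace_measurable[measurable]: "trace \<in> borel_measurable L"
  unfolding trace_def[abs_def] proj_def by measurable

lemma trace_nonneg: "0 \<le> trace t"
  unfolding trace_def proj_def by (intro sum_nonneg) (simp add: times_divide_eq_left)

lemma integrable_trace: "integrable L trace" and integral_trace: "(\<integral>t. trace t \<partial>L) = real n"
proof -
  have eq: "trace = (\<lambda>t. \<Sum>k=1..n. (1 / (lam k)\<^sup>2) * (Gam chi (h k) t * Gam chi (h k) t))"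
    by (simp add: trace_def proj_def fun_eq_iff)
  show "integrable L trace"
    unfolding eq by (intro Bochner_Integration.integrable_sum integrable_mult_right integrable_Gam_mult)
  have "(\<integral>t. trace t \<partial>L) = (\<Sum>k=1..n. (1 / (lam k)\<^sup>2) * (\<integral>t. Gam chi (h k) t * Gam chi (h k) t \<partial>L))"
    unfolding eq
    by (subst Bochner_Integration.integral_sum, intro integrable_mult_right integrable_Gam_mult)
      (simp only: integral_mult_right_zero)
  also have "\<dots> = (\<Sum>k=1..n. 1)"
  proof (intro sum.cong refl)
    fix k assume "k \<in> {1..n}"
    then show "(1 / (lam k)\<^sup>2) * (\<integral>t. Gam chi (h k) t * Gam chi (h k) t \<partial>L) = 1"
      using integral_Gam_orth[of k k] lam_pos[of k] by simp
  qed
  finally show "(\<integral>t. trace t \<partial>L) = real n" by simp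
qed

lemma proj_bound:
  obtains c where "0 \<le> c" "\<And>x. \<bar>proj x t\<bar> \<le> c * sqrt (q x)"
proof
  let ?c = "\<Sum>k=1..n. lam k / (lam k)\<^sup>2 * \<bar>Gam chi (h k) t\<bar>"
  show "0 \<le> ?c" using lam_pos by (intro sum_nonneg mult_nonneg_nonneg divide_nonneg_nonneg) (auto simp: less_imp_le)
  fix x
  have "\<bar>proj x t\<bar> \<le> (\<Sum>k=1..n. \<bar>x k / (lam k)\<^sup>2 * Gam chi (h k) t\<bar>)"
    unfolding proj_def by (rule sum_abs)
  also have "\<dots> \<le> (\<Sum>k=1..n. (lam k / (lam k)\<^sup>2 * \<bar>Gam chi (h k) t\<bar>) * sqrt (q x))"
  proof (rule sum_mono)
    fix k assume "k \<in> {1..n}"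
    from mult_right_mono[OF coord_le_sqrt_q[OF this, of x], of "\<bar>Gam chi (h k) t\<bar> / (lam k)\<^sup>2"]
    show "\<bar>x k / (lam k)\<^sup>2 * Gam chi (h k) t\<bar> \<le> (lam k / (lam k)\<^sup>2 * \<bar>Gam chi (h k) t\<bar>) * sqrt (q x)"
      by (simp add: abs_mult mult_ac)
  qed
  finally show "\<bar>proj x t\<bar> \<le> ?c * sqrt (q x)" by (simp only: sum_distrib_right)
qed

lemma sqrt_over_reg_le:
  assumes "\<epsilon> > 0" "(y::real) \<ge> 0"
  shows "sqrt y / (y + \<epsilon>) \<le> 1 + 1 / \<epsilon>"
proof -
  have "sqrt y \<le> 1 + y"
    using arith_geo_mean_sqrt[of 1 y] assms by simp
  also have "\<dots> \<le> (1 + 1 / \<epsilon>) * (y + \<epsilon>)"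
  proof -
    have "(1 + 1 / \<epsilon>) * (y + \<epsilon>) = y + \<epsilon> + y / \<epsilon> + 1" using assms by (simp add: field_simps)
    then show ?thesis using assms by simp
  qed
  finally show ?thesis using assms by (simp add: divide_le_eq)
qed

lemma continuous_on_proj: "continuous_on S (\<lambda>x. proj x t)"
  unfolding proj_def
  by (intro continuous_intros continuous_on_subset[OF continuous_on_product_coordinates subset_UNIV])
    (use lam_pos in force)+

text \<open>Integration by parts for \<open>\<Phi> = proj / (q + \<epsilon>)\<close>: the derivatives of \<open>proj\<close> and \<open>q\<close> along \<open>chi t\<close> are
  \<open>trace t\<close> and \<open>2 * proj\<close>. The shift \<open>c\<close> is the mean of \<open>Y\<close> under the shifted measure.\<close>

lemma stein_identity_regularized:
  fixes c :: "nat \<Rightarrow> real"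
  assumes U: "isonormal_process U V" and \<epsilon>: "\<epsilon> > 0"
  defines "Z \<equiv> \<lambda>\<omega> k. V (h k) \<omega> + c k"
  shows "(\<integral>\<omega>. proj (Z \<omega>) t / (q (Z \<omega>) + \<epsilon>) * V (chi t) \<omega> \<partial>U)
    = (\<integral>\<omega>. trace t / (q (Z \<omega>) + \<epsilon>) - 2 * (proj (Z \<omega>) t)\<^sup>2 / (q (Z \<omega>) + \<epsilon>)\<^sup>2 \<partial>U)"
proof -
  interpret U: isonormal_process U V by (rule U)
  have pos: "q x + \<epsilon> > 0" for x using q_nonneg[of x] \<epsilon> by linarith
  have nz: "q x + \<epsilon> \<noteq> 0" for x using pos[of x] by simp
  obtain C where C: "0 \<le> C" "\<And>x. \<bar>proj x t\<bar> \<le> C * sqrt (q x)" using proj_bound by blast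
  define K where "K = C * (1 + 1 / \<epsilon>)"
  have K: "\<bar>proj x t / (q x + \<epsilon>)\<bar> \<le> K" for x
  proof -
    have "\<bar>proj x t / (q x + \<epsilon>)\<bar> \<le> C * (sqrt (q x) / (q x + \<epsilon>))"
      using C(2)[of x] pos[of x] by (simp add: abs_of_pos divide_right_mono)
    also have "\<dots> \<le> K"
      unfolding K_def using C(1) \<epsilon> by (intro mult_left_mono sqrt_over_reg_le q_nonneg) auto
    finally show ?thesis .
  qed
  have K0: "0 \<le> K" using K order_trans[OF abs_ge_zero] by blast
  let ?s = "\<lambda>x i. x i + c i"
  define \<Phi> where "\<Phi> x = proj (?s x) t / (q (?s x) + \<epsilon>)" for x
  define \<Phi>' where "\<Phi>' x = trace t / (q (?s x) + \<epsilon>) - 2 * (proj (?s x) t)\<^sup>2 / (q (?s x) + \<epsilon>)\<^sup>2" for x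
  have shift: "continuous_on UNIV ?s"
    by (intro continuous_on_coordinatewise_then_product continuous_intros continuous_on_product_coordinates)
  have cq: "continuous_on UNIV (\<lambda>x. q (?s x))"
    by (rule continuous_on_compose2[OF continuous_on_q[of UNIV] shift]) simp
  have cp: "continuous_on UNIV (\<lambda>x. proj (?s x) t)"
    by (rule continuous_on_compose2[OF continuous_on_proj[of UNIV t] shift]) simp
  have c\<Phi>: "continuous_on UNIV \<Phi>" "continuous_on UNIV \<Phi>'"
    unfolding \<Phi>_def[abs_def] \<Phi>'_def[abs_def] using nz
    by (intro continuous_intros cq cp; simp)+
  have "(\<integral>\<omega>. \<Phi> (\<lambda>i. V (h i) \<omega>) * V (chi t) \<omega> \<partial>U) = (\<integral>\<omega>. \<Phi>' (\<lambda>i. V (h i) \<omega>) \<partial>U)"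
  proof (rule U.gaussian_integration_by_parts[where \<Phi>=\<Phi> and \<Phi>'=\<Phi>' and g=h and B="max K (trace t / \<epsilon> + 2 * K\<^sup>2)"])
    show "\<Phi> \<in> borel_measurable (PiM UNIV (\<lambda>_. borel))" "\<Phi>' \<in> borel_measurable (PiM UNIV (\<lambda>_. borel))"
      by (intro continuous_borel_measurable_PiM c\<Phi>)+
    fix x :: "nat \<Rightarrow> real"
    let ?d = "\<lambda>i. Gam chi (h i) t"
    have d: "h i \<bullet> chi t = Gam chi (h i) t" for i by (simp add: Gam_def inner_commute)
    have sh: "?s (\<lambda>i. x i + z * ?d i) = (\<lambda>i. ?s x i + z * ?d i)" for z by (simp add: fun_eq_iff)
    show "((\<lambda>z. \<Phi> (\<lambda>i. x i + z * (h i \<bullet> chi t))) has_real_derivative \<Phi>' (\<lambda>i. x i + z * (h i \<bullet> chi t))) (at z)" for z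
    proof -
      have dp: "((\<lambda>z. proj (\<lambda>i. ?s x i + z * ?d i) t) has_real_derivative trace t) (at z)"
        unfolding proj_add_line trace_def
        by (rule DERIV_cong[OF DERIV_add[OF DERIV_const DERIV_cmult_right[OF DERIV_ident]]]) simp
      have "((\<lambda>z. proj (\<lambda>i. ?s x i + z * ?d i) t / (q (\<lambda>i. ?s x i + z * ?d i) + \<epsilon>)) has_real_derivative
        (trace t * (q (\<lambda>i. ?s x i + z * ?d i) + \<epsilon>) - proj (\<lambda>i. ?s x i + z * ?d i) t * (2 * proj (\<lambda>i. ?s x i + z * ?d i) t + 0))
          / ((q (\<lambda>i. ?s x i + z * ?d i) + \<epsilon>) * (q (\<lambda>i. ?s x i + z * ?d i) + \<epsilon>))) (at z)"
        by (rule DERIV_divide[OF dp DERIV_add[OF q_line_derivative[of "?s x"] DERIV_const] nz])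
      moreover have "(a * e - p * (2 * p + 0)) / (e * e) = a / e - 2 * p\<^sup>2 / e\<^sup>2" if "e \<noteq> 0" for a e p :: real
        using that by (simp add: diff_divide_distrib power2_eq_square)
      ultimately show ?thesis
        unfolding \<Phi>_def \<Phi>'_def d sh using nz by simp
    qed
    have line: "continuous_on UNIV (\<lambda>z. (\<lambda>i. x i + z * (h i \<bullet> chi t)))"
      by (intro continuous_on_coordinatewise_then_product continuous_intros)
    show "continuous_on UNIV (\<lambda>z. \<Phi>' (\<lambda>i. x i + z * (h i \<bullet> chi t)))"
      by (rule continuous_on_compose2[OF c\<Phi>(2) line]) simp
    show "\<bar>\<Phi> x\<bar> \<le> max K (trace t / \<epsilon> + 2 * K\<^sup>2)"
      unfolding \<Phi>_def using K[of "?s x"] by (simp add: le_max_iff_disj)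
    have "\<bar>trace t / (q (?s x) + \<epsilon>)\<bar> \<le> trace t / \<epsilon>"
      using trace_nonneg[of t] pos[of "?s x"] \<epsilon> q_nonneg[of "?s x"] by (simp add: abs_of_nonneg frac_le)
    moreover have "\<bar>2 * (proj (?s x) t)\<^sup>2 / (q (?s x) + \<epsilon>)\<^sup>2\<bar> \<le> 2 * K\<^sup>2"
    proof -
      have "\<bar>2 * (proj (?s x) t)\<^sup>2 / (q (?s x) + \<epsilon>)\<^sup>2\<bar> = 2 * \<bar>proj (?s x) t / (q (?s x) + \<epsilon>)\<bar>\<^sup>2"
        by (simp add: power_divide)
      also have "\<dots> \<le> 2 * K\<^sup>2" using K[of "?s x"] by (intro mult_left_mono power_mono) auto
      finally show ?thesis .
    qed
    ultimately have "\<bar>\<Phi>' x\<bar> \<le> trace t / \<epsilon> + 2 * K\<^sup>2" unfolding \<Phi>'_def by linarith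
    then show "\<bar>\<Phi>' x\<bar> \<le> max K (trace t / \<epsilon> + 2 * K\<^sup>2)" by simp
  qed
  then show ?thesis by (simp add: \<Phi>_def \<Phi>'_def Z_def)
qed

text \<open>With \<open>B\<close> for the centred process and \<open>C\<close> for \<open>proj / q\<close>, the mean of \<open>B\<^sup>2\<close> is the total variance, that of
  \<open>C\<^sup>2\<close> is the mean \<open>I\<close> of \<open>1 / q\<close>, and that of \<open>B C\<close> is \<open>(n - 2) I\<close>. For the last,
  \<open>\<bar>B C\<bar> \<le> B\<^sup>2 + C\<^sup>2\<close> dominates the regularized products, and the time integral of the right-hand side of the
  regularized identity is \<open>n / (q + \<epsilon>) - 2 q / (q + \<epsilon>)\<^sup>2\<close>, bounded by \<open>(n + 2) / q\<close>.\<close>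

lemma stein_risk:
  fixes v :: 'h
  defines "U \<equiv> density M (\<lambda>\<omega>. ennreal (exp (W v \<omega> - (norm v)\<^sup>2 / 2)))"
  shows "integrable U (\<lambda>\<omega>. 1 / q (Y \<omega>))"
    and "integrable (L \<Otimes>\<^sub>M U) (\<lambda>(t, \<omega>). (X t \<omega> - Gam chi v t - (real n - 2) * (proj (Y \<omega>) t / q (Y \<omega>)))\<^sup>2)"
    and "(\<integral>(t, \<omega>). (X t \<omega> - Gam chi v t - (real n - 2) * (proj (Y \<omega>) t / q (Y \<omega>)))\<^sup>2 \<partial>(L \<Otimes>\<^sub>M U))
      = (\<integral>t. (norm (chi t))\<^sup>2 \<partial>L) - (real n - 2)\<^sup>2 * (\<integral>\<omega>. 1 / q (Y \<omega>) \<partial>U)"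
proof -
  define V where "V g \<omega> = W g \<omega> - g \<bullet> v" for g \<omega>
  have iso: "isonormal_process U V" unfolding U_def V_def by (rule cameron_martin)
  interpret U: isonormal_process U V by (rule iso)
  interpret L: finite_measure L by (rule finite_measure_L)
  interpret P: pair_sigma_finite L U
    unfolding pair_sigma_finite_def using L.sigma_finite_measure_axioms U.sigma_finite_measure_axioms by simp
  have sU[measurable_cong]: "sets U = sets M" by (simp add: U_def)
  have sLU: "sets (L \<Otimes>\<^sub>M U) = sets (L \<Otimes>\<^sub>M M)" by (intro sets_pair_measure_cong refl sU)
  have spU: "space U = space M" by (rule sets_eq_imp_space_eq[OF sU])
  have aeU: "AE \<omega> in M. R \<omega> \<Longrightarrow> AE \<omega> in U. R \<omega>" for R
    unfolding U_def by (subst AE_density) auto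
  have Yv: "Y \<omega> = (\<lambda>k. V (h k) \<omega> + h k \<bullet> v)" for \<omega> by (simp add: V_def)
  have qpos: "AE \<omega> in U. q (Y \<omega>) > 0" by (rule aeU[OF AE_q_pos])
  have mq[measurable]: "(\<lambda>\<omega>. q (Y \<omega>)) \<in> borel_measurable U"
    using qY_measurable measurable_cong_sets[OF sU refl] by blast
  have mqp[measurable]: "(\<lambda>p. q (Y (snd p))) \<in> borel_measurable (L \<Otimes>\<^sub>M U)"
    by (rule measurable_compose[OF measurable_snd mq])
  have iq: "integrable U (\<lambda>\<omega>. 1 / q (Y \<omega>))"
  proof -
    have "integrable U (\<lambda>\<omega>. q (Y \<omega>) powr (-1))"
    proof (rule integrableI_bounded)
      show "(\<integral>\<^sup>+\<omega>. ennreal (norm (q (Y \<omega>) powr (-1))) \<partial>U) < \<infinity>"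
        using U.quadratic_form_negative_moment(2)[OF inj_h independent_h lam_pos, where s=1 and c="\<lambda>k. h k \<bullet> v"] n_ge_3
        unfolding Yv q_def by simp
    qed measurable
    also have "integrable U (\<lambda>\<omega>. q (Y \<omega>) powr (-1)) \<longleftrightarrow> integrable U (\<lambda>\<omega>. 1 / q (Y \<omega>))"
    proof (rule integrable_cong_AE)
      show "AE \<omega> in U. q (Y \<omega>) powr (-1) = 1 / q (Y \<omega>)"
        using qpos by eventually_elim (simp add: powr_minus_divide)
    qed measurable
    finally show ?thesis .
  qed
  then show "integrable U (\<lambda>\<omega>. 1 / q (Y \<omega>))" .
  define I where "I = (\<integral>\<omega>. 1 / q (Y \<omega>) \<partial>U)"
  define B where "B = (\<lambda>p. X (fst p) (snd p) - Gam chi v (fst p))"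
  define Q where "Q = (\<lambda>p. proj (Y (snd p)) (fst p))"
  have mB[measurable]: "B \<in> borel_measurable (L \<Otimes>\<^sub>M U)"
  proof -
    have "(\<lambda>p. case_prod X p - Gam chi v (fst p)) \<in> borel_measurable (L \<Otimes>\<^sub>M M)" by measurable
    then show ?thesis unfolding B_def measurable_cong_sets[OF sLU refl] by (simp add: case_prod_unfold)
  qed
  have mQ[measurable]: "Q \<in> borel_measurable (L \<Otimes>\<^sub>M U)"
    unfolding Q_def proj_def measurable_cong_sets[OF sLU refl] by measurable
  have Bt: "AE \<omega> in U. B (t, \<omega>) = V (chi t) \<omega>" if "t \<in> space L" for t
  proof -
    have "AE \<omega> in U. W (chi t) \<omega> = X t \<omega>" using that by (intro aeU W_chi) (simp add: space_L)
    then show ?thesis by eventually_elim (simp add: B_def V_def Gam_def)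
  qed
  have mBt[measurable]: "(\<lambda>\<omega>. B (t, \<omega>)) \<in> borel_measurable U" if "t \<in> space L" for t
    by (rule measurable_compose[OF measurable_Pair1'[OF that] mB])
  have iBt: "integrable U (\<lambda>\<omega>. (B (t, \<omega>))\<^sup>2)" "(\<integral>\<omega>. (B (t, \<omega>))\<^sup>2 \<partial>U) = (norm (chi t))\<^sup>2" if t: "t \<in> space L" for t
  proof -
    note [measurable] = mBt[OF t]
    have ae: "AE \<omega> in U. (B (t, \<omega>))\<^sup>2 = (V (chi t) \<omega>)\<^sup>2" using Bt[OF t] by eventually_elim simp
    have "integrable U (\<lambda>\<omega>. (B (t, \<omega>))\<^sup>2) \<longleftrightarrow> integrable U (\<lambda>\<omega>. (V (chi t) \<omega>)\<^sup>2)"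
      by (rule integrable_cong_AE) (use ae in simp_all)
    then show "integrable U (\<lambda>\<omega>. (B (t, \<omega>))\<^sup>2)" using U.integrable_W_square by simp
    have "(\<integral>\<omega>. (B (t, \<omega>))\<^sup>2 \<partial>U) = (\<integral>\<omega>. (V (chi t) \<omega>)\<^sup>2 \<partial>U)"
      by (rule integral_cong_AE) (use ae in simp_all)
    then show "(\<integral>\<omega>. (B (t, \<omega>))\<^sup>2 \<partial>U) = (norm (chi t))\<^sup>2" by (simp add: U.integral_W_square)
  qed
  have iB: "integrable (L \<Otimes>\<^sub>M U) (\<lambda>p. (B p)\<^sup>2)"
  proof (rule P.Fubini_integrable)
    have "integrable L (\<lambda>t. \<integral>\<omega>. norm ((B (t, \<omega>))\<^sup>2) \<partial>U) \<longleftrightarrow> integrable L (\<lambda>t. (norm (chi t))\<^sup>2)"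
      by (rule Bochner_Integration.integrable_cong[OF refl]) (simp add: iBt)
    then show "integrable L (\<lambda>t. \<integral>\<omega>. norm ((B (t, \<omega>))\<^sup>2) \<partial>U)" using chi_square_integrable by simp
    show "AE t in L. integrable U (\<lambda>\<omega>. (B (t, \<omega>))\<^sup>2)" by (rule AE_I2) (rule iBt)
  qed measurable
  have EB: "(\<integral>p. (B p)\<^sup>2 \<partial>(L \<Otimes>\<^sub>M U)) = (\<integral>t. (norm (chi t))\<^sup>2 \<partial>L)"
    unfolding P.integral_fst'[OF iB, symmetric]
    by (rule Bochner_Integration.integral_cong[OF refl]) (rule iBt)
  define C where "C = (\<lambda>p. Q p / q (Y (snd p)))"
  have mC[measurable]: "C \<in> borel_measurable (L \<Otimes>\<^sub>M U)" unfolding C_def by measurable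
  have Csq: "(\<integral>t. (C (t, \<omega>))\<^sup>2 \<partial>L) = 1 / q (Y \<omega>)" "integrable L (\<lambda>t. (C (t, \<omega>))\<^sup>2)" for \<omega>
    unfolding C_def Q_def by (simp_all add: power_divide integral_proj_square integrable_proj_square power2_eq_square[of "q _"])
  have iC: "integrable (L \<Otimes>\<^sub>M U) (\<lambda>p. (C p)\<^sup>2)"
  proof (rule integrableI_bounded)
    have "(\<integral>\<^sup>+p. ennreal (norm ((C p)\<^sup>2)) \<partial>(L \<Otimes>\<^sub>M U)) = (\<integral>\<^sup>+\<omega>. (\<integral>\<^sup>+t. ennreal ((C (t, \<omega>))\<^sup>2) \<partial>L) \<partial>U)"
      by (subst P.nn_integral_snd[symmetric]) auto
    also have "\<dots> = (\<integral>\<^sup>+\<omega>. ennreal (1 / q (Y \<omega>)) \<partial>U)"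
      using Csq by (intro nn_integral_cong) (simp add: nn_integral_eq_integral)
    also have "\<dots> < \<infinity>"
      using iq by (subst nn_integral_eq_integral) (auto simp: q_nonneg)
    finally show "(\<integral>\<^sup>+p. ennreal (norm ((C p)\<^sup>2)) \<partial>(L \<Otimes>\<^sub>M U)) < \<infinity>" .
  qed measurable
  have EC: "(\<integral>p. (C p)\<^sup>2 \<partial>(L \<Otimes>\<^sub>M U)) = I"
    using P.integral_snd[of "\<lambda>t \<omega>. (C (t, \<omega>))\<^sup>2"] iC by (simp add: Csq I_def case_prod_unfold)
  have iBC: "integrable (L \<Otimes>\<^sub>M U) (\<lambda>p. B p * C p)"
  proof (rule Bochner_Integration.integrable_bound)
    show "integrable (L \<Otimes>\<^sub>M U) (\<lambda>p. (B p)\<^sup>2 + (C p)\<^sup>2)" using iB iC by simp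
    show "AE p in L \<Otimes>\<^sub>M U. norm (B p * C p) \<le> norm ((B p)\<^sup>2 + (C p)\<^sup>2)"
      by (intro AE_I2) (simp add: abs_mult_le_sum_squares)
  qed measurable
  define e where "e = (\<lambda>N. 1 / real (Suc N))"
  have e: "e N > 0" for N by (simp add: e_def)
  have e0: "e \<longlonglongrightarrow> 0" unfolding e_def by (rule LIMSEQ_Suc[OF lim_1_over_n])
  define Ce where "Ce = (\<lambda>N p. Q p / (q (Y (snd p)) + e N))"
  have mCe[measurable]: "Ce N \<in> borel_measurable (L \<Otimes>\<^sub>M U)" for N unfolding Ce_def by measurable
  \<comment> \<open>where \<open>q\<close> vanishes, \<open>C\<close> is 0 by division by zero, but so is \<open>Q\<close>\<close>
  have Ce_le: "\<bar>Ce N p\<bar> \<le> \<bar>C p\<bar>" for N p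
  proof (cases "q (Y (snd p)) = 0")
    case True
    then have "Y (snd p) k = 0" if "k \<in> {1..n}" for k using coord_le_sqrt_q[OF that, of "Y (snd p)"] by simp
    then have "Q p = 0" unfolding Q_def proj_def by (intro sum.neutral) auto
    then show ?thesis by (simp add: Ce_def)
  next
    case False
    then have "q (Y (snd p)) > 0" using q_nonneg[of "Y (snd p)"] by simp
    then show ?thesis using e[of N] by (simp add: Ce_def C_def abs_of_pos frac_le)
  qed
  have iBCe: "integrable (L \<Otimes>\<^sub>M U) (\<lambda>p. B p * Ce N p)" for N
    by (rule Bochner_Integration.integrable_bound[OF iBC]) (auto simp: abs_mult intro!: AE_I2 mult_left_mono Ce_le)
  have lim1: "(\<lambda>N. \<integral>p. B p * Ce N p \<partial>(L \<Otimes>\<^sub>M U)) \<longlonglongrightarrow> (\<integral>p. B p * C p \<partial>(L \<Otimes>\<^sub>M U))"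
  proof (rule integral_dominated_convergence[where w="\<lambda>p. \<bar>B p * C p\<bar>"])
    show "integrable (L \<Otimes>\<^sub>M U) (\<lambda>p. \<bar>B p * C p\<bar>)" using iBC by simp
    show "AE p in L \<Otimes>\<^sub>M U. norm (B p * Ce N p) \<le> \<bar>B p * C p\<bar>" for N
      by (auto simp: abs_mult intro!: AE_I2 mult_left_mono Ce_le)
    have "(\<lambda>N. Ce N p) \<longlonglongrightarrow> C p" for p
    proof (cases "q (Y (snd p)) = 0")
      case True
      then have "C p = 0" by (simp add: C_def)
      then have "Ce N p = 0" for N using Ce_le[of N p] by simp
      then show ?thesis using \<open>C p = 0\<close> by simp
    next
      case False
      have "(\<lambda>N. Q p / (q (Y (snd p)) + e N)) \<longlonglongrightarrow> Q p / (q (Y (snd p)) + 0)"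
        by (intro tendsto_intros e0) (use False in simp)
      then show ?thesis by (simp add: Ce_def C_def)
    qed
    then show "AE p in L \<Otimes>\<^sub>M U. (\<lambda>N. B p * Ce N p) \<longlonglongrightarrow> B p * C p"
      by (intro AE_I2 tendsto_mult tendsto_const)
  qed measurable
  define R where "R = (\<lambda>N \<omega>. real n / (q (Y \<omega>) + e N) - 2 * q (Y \<omega>) / (q (Y \<omega>) + e N)\<^sup>2)"
  have ER: "(\<integral>p. B p * Ce N p \<partial>(L \<Otimes>\<^sub>M U)) = (\<integral>\<omega>. R N \<omega> \<partial>U)" for N
  proof -
    have qe: "0 < q (Y \<omega>) + e N" for \<omega> using q_nonneg[of "Y \<omega>"] e[of N] by linarith
    let ?J = "\<lambda>p. trace (fst p) * (1 / (q (Y (snd p)) + e N)) - 2 * (Ce N p)\<^sup>2"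
    have i1: "integrable (L \<Otimes>\<^sub>M U) (\<lambda>p. trace (fst p) * (1 / (q (Y (snd p)) + e N)))"
    proof -
      have "integrable U (\<lambda>\<omega>. 1 / (q (Y \<omega>) + e N))"
      proof (rule U.integrable_const_bound[where B="1 / e N"])
        have "norm (1 / (q (Y \<omega>) + e N)) \<le> 1 / e N" for \<omega>
          using e[of N] q_nonneg[of "Y \<omega>"] qe[of \<omega>] by (simp add: abs_of_pos frac_le)
        then show "AE \<omega> in U. norm (1 / (q (Y \<omega>) + e N)) \<le> 1 / e N" by simp
      qed measurable
      from P.integrable_times_pair[OF integrable_trace this] show ?thesis by (simp add: case_prod_unfold)
    qed
    have i2: "integrable (L \<Otimes>\<^sub>M U) (\<lambda>p. 2 * (Ce N p)\<^sup>2)"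
    proof (rule Bochner_Integration.integrable_bound)
      show "integrable (L \<Otimes>\<^sub>M U) (\<lambda>p. 2 * (C p)\<^sup>2)" using iC by simp
      show "AE p in L \<Otimes>\<^sub>M U. norm (2 * (Ce N p)\<^sup>2) \<le> norm (2 * (C p)\<^sup>2)"
        using Ce_le by (intro AE_I2) (simp add: abs_le_square_iff)
    qed measurable
    have iJ: "integrable (L \<Otimes>\<^sub>M U) ?J" using i1 i2 by simp
    have "(\<integral>p. B p * Ce N p \<partial>(L \<Otimes>\<^sub>M U)) = (\<integral>t. (\<integral>\<omega>. B (t, \<omega>) * Ce N (t, \<omega>) \<partial>U) \<partial>L)"
      by (rule P.integral_fst'[OF iBCe, symmetric])
    also have "\<dots> = (\<integral>t. (\<integral>\<omega>. ?J (t, \<omega>) \<partial>U) \<partial>L)"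
    proof (rule Bochner_Integration.integral_cong[OF refl])
      fix t assume t: "t \<in> space L"
      note [measurable] = mBt[OF t]
      have [measurable]: "(\<lambda>\<omega>. Ce N (t, \<omega>)) \<in> borel_measurable U"
        by (rule measurable_compose[OF measurable_Pair1'[OF t] mCe])
      have "(\<integral>\<omega>. B (t, \<omega>) * Ce N (t, \<omega>) \<partial>U) = (\<integral>\<omega>. Ce N (t, \<omega>) * V (chi t) \<omega> \<partial>U)"
      proof (rule integral_cong_AE)
        show "AE \<omega> in U. B (t, \<omega>) * Ce N (t, \<omega>) = Ce N (t, \<omega>) * V (chi t) \<omega>"
          using Bt[OF t] by eventually_elim simp
      qed measurable
      also have "\<dots> = (\<integral>\<omega>. ?J (t, \<omega>) \<partial>U)"
        using stein_identity_regularized[OF iso e[of N], of "\<lambda>k. h k \<bullet> v" t]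
        by (simp add: Ce_def Q_def Yv power_divide)
      finally show "(\<integral>\<omega>. B (t, \<omega>) * Ce N (t, \<omega>) \<partial>U) = (\<integral>\<omega>. ?J (t, \<omega>) \<partial>U)" .
    qed
    also have "\<dots> = (\<integral>p. ?J p \<partial>(L \<Otimes>\<^sub>M U))" by (rule P.integral_fst'[OF iJ])
    also have "\<dots> = (\<integral>\<omega>. (\<integral>t. ?J (t, \<omega>) \<partial>L) \<partial>U)"
      using P.integral_snd[of "\<lambda>t \<omega>. ?J (t, \<omega>)"] iJ by (simp add: case_prod_unfold)
    also have "\<dots> = (\<integral>\<omega>. R N \<omega> \<partial>U)"
    proof (rule Bochner_Integration.integral_cong[OF refl])
      fix \<omega>
      have "(\<integral>t. ?J (t, \<omega>) \<partial>L) = (\<integral>t. trace t * (1 / (q (Y \<omega>) + e N)) - (2 / (q (Y \<omega>) + e N)\<^sup>2) * (proj (Y \<omega>) t)\<^sup>2 \<partial>L)"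
        by (simp add: Ce_def Q_def power_divide)
      also have "\<dots> = (\<integral>t. trace t * (1 / (q (Y \<omega>) + e N)) \<partial>L) - (\<integral>t. (2 / (q (Y \<omega>) + e N)\<^sup>2) * (proj (Y \<omega>) t)\<^sup>2 \<partial>L)"
        by (intro Bochner_Integration.integral_diff integrable_mult_left integrable_mult_right integrable_trace integrable_proj_square)
      also have "\<dots> = R N \<omega>"
        by (simp add: R_def integral_trace integral_proj_square)
      finally show "(\<integral>t. ?J (t, \<omega>) \<partial>L) = R N \<omega>" .
    qed
    finally show ?thesis .
  qed
  have "(\<lambda>N. \<integral>\<omega>. R N \<omega> \<partial>U) \<longlonglongrightarrow> (\<integral>\<omega>. (real n - 2) * (1 / q (Y \<omega>)) \<partial>U)"
  proof (rule integral_dominated_convergence[where w="\<lambda>\<omega>. (real n + 2) * (1 / q (Y \<omega>))"])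
    show "integrable U (\<lambda>\<omega>. (real n + 2) * (1 / q (Y \<omega>)))" using iq by (intro integrable_mult_right)
    show "AE \<omega> in U. (\<lambda>N. R N \<omega>) \<longlonglongrightarrow> (real n - 2) * (1 / q (Y \<omega>))"
      using qpos
    proof eventually_elim
      case (elim \<omega>)
      have "(\<lambda>N. R N \<omega>) \<longlonglongrightarrow> real n / (q (Y \<omega>) + 0) - 2 * q (Y \<omega>) / (q (Y \<omega>) + 0)\<^sup>2"
        unfolding R_def by (intro tendsto_intros e0) (use elim in auto)
      also have "real n / (q (Y \<omega>) + 0) - 2 * q (Y \<omega>) / (q (Y \<omega>) + 0)\<^sup>2 = (real n - 2) * (1 / q (Y \<omega>))"
        using elim by (simp add: power2_eq_square diff_divide_distrib)
      finally show ?case .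
    qed
    show "AE \<omega> in U. norm (R N \<omega>) \<le> (real n + 2) * (1 / q (Y \<omega>))" for N
      using qpos
    proof eventually_elim
      case (elim \<omega>)
      let ?a = "q (Y \<omega>)"
      have le: "?a \<le> ?a + e N" using e[of N] by simp
      have "\<bar>real n / (?a + e N)\<bar> \<le> real n / ?a" using elim le e[of N] by (simp add: frac_le)
      moreover have "\<bar>2 * ?a / (?a + e N)\<^sup>2\<bar> \<le> 2 / ?a"
      proof -
        have "?a * ?a \<le> (?a + e N)\<^sup>2"
          unfolding power2_eq_square using elim le by (intro mult_mono) auto
        then have "2 * ?a / (?a + e N)\<^sup>2 \<le> 2 * ?a / (?a * ?a)" using elim e[of N] by (intro divide_left_mono) auto
        then show ?thesis using elim by simp
      qed
      ultimately have "\<bar>R N \<omega>\<bar> \<le> real n / ?a + 2 / ?a" unfolding R_def by linarith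
      then show ?case by (simp add: add_divide_distrib)
    qed
  qed (simp_all add: R_def)
  then have "(\<integral>p. B p * C p \<partial>(L \<Otimes>\<^sub>M U)) = (\<integral>\<omega>. (real n - 2) * (1 / q (Y \<omega>)) \<partial>U)"
    by (rule LIMSEQ_unique[OF lim1[unfolded ER]])
  then have EBC: "(\<integral>p. B p * C p \<partial>(L \<Otimes>\<^sub>M U)) = (real n - 2) * I"
    by (simp only: integral_mult_right_zero I_def)
  have expand: "(B p - (real n - 2) * C p)\<^sup>2 = (B p)\<^sup>2 - (2 * (real n - 2)) * (B p * C p) + (real n - 2)\<^sup>2 * (C p)\<^sup>2" for p
    by (simp add: power2_diff power_mult_distrib mult_ac)
  have eq: "(\<lambda>(t, \<omega>). (X t \<omega> - Gam chi v t - (real n - 2) * (proj (Y \<omega>) t / q (Y \<omega>)))\<^sup>2) = (\<lambda>p. (B p - (real n - 2) * C p)\<^sup>2)"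
    by (simp add: B_def C_def Q_def case_prod_unfold fun_eq_iff)
  have i3: "integrable (L \<Otimes>\<^sub>M U) (\<lambda>p. (2 * (real n - 2)) * (B p * C p))" using iBC by (rule integrable_mult_right)
  have i4: "integrable (L \<Otimes>\<^sub>M U) (\<lambda>p. (real n - 2)\<^sup>2 * (C p)\<^sup>2)" using iC by (rule integrable_mult_right)
  show "integrable (L \<Otimes>\<^sub>M U) (\<lambda>(t, \<omega>). (X t \<omega> - Gam chi v t - (real n - 2) * (proj (Y \<omega>) t / q (Y \<omega>)))\<^sup>2)"
    unfolding eq expand by (intro Bochner_Integration.integrable_add Bochner_Integration.integrable_diff iB i3 i4)
  have "(\<integral>p. (B p - (real n - 2) * C p)\<^sup>2 \<partial>(L \<Otimes>\<^sub>M U))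
    = (\<integral>t. (norm (chi t))\<^sup>2 \<partial>L) - (2 * (real n - 2)) * ((real n - 2) * I) + (real n - 2)\<^sup>2 * I"
    unfolding expand
    by (subst Bochner_Integration.integral_add[OF Bochner_Integration.integrable_diff[OF iB i3] i4],
        subst Bochner_Integration.integral_diff[OF iB i3]) (simp only: integral_mult_right_zero EB EC EBC)
  also have "\<dots> = (\<integral>t. (norm (chi t))\<^sup>2 \<partial>L) - (real n - 2)\<^sup>2 * I"
    by (simp add: power2_eq_square algebra_simps)
  finally show "(\<integral>(t, \<omega>). (X t \<omega> - Gam chi v t - (real n - 2) * (proj (Y \<omega>) t / q (Y \<omega>)))\<^sup>2 \<partial>(L \<Otimes>\<^sub>M U))
      = (\<integral>t. (norm (chi t))\<^sup>2 \<partial>L) - (real n - 2)\<^sup>2 * (\<integral>\<omega>. 1 / q (Y \<omega>) \<partial>U)"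
    unfolding eq I_def .
qed

end

section \<open>The risk of the superefficient drift estimator\<close>

theorem mainTheorem8:
  fixes T :: real and M :: "'a measure" and X :: "real \<Rightarrow> 'a \<Rightarrow> real"
    and K :: "real \<Rightarrow> real \<Rightarrow> real" and \<gamma> :: "real \<Rightarrow> real \<Rightarrow> real"
    and chi :: "real \<Rightarrow> 'h::{real_inner,complete_space}"
    and W :: "'h \<Rightarrow> 'a \<Rightarrow> real" and h :: "nat \<Rightarrow> 'h" and lam :: "nat \<Rightarrow> real"
    and u :: "real \<Rightarrow> real" and n :: nat
    and f :: "(nat \<Rightarrow> real) \<Rightarrow> real" and F :: "'a \<Rightarrow> real" and PiX :: "real \<Rightarrow> 'a \<Rightarrow> real"
    and Pu :: "'a measure"
  assumes T: "T > 0"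
    and M: "prob_space M"
    and sigma_X: "sets M = sigma_sets (space M)
          (\<Union>t\<in>{0..T}. {X t -` A \<inter> space M | A. A \<in> sets borel})"
    and X_gauss: "centered_gaussian_family M {0..T} X"
    and X_meas: "case_prod X \<in> borel_measurable (restrict_space lborel {0..T} \<Otimes>\<^sub>M M)"
    and K_L2: "\<forall>t\<in>{0..T}. set_borel_measurable lborel {0..t} (K t) \<and>
          set_integrable lborel {0..t} (\<lambda>r. (K t r)\<^sup>2)"
    and \<gamma>: "\<gamma> = kernel_cov K"
    and X_cov: "\<forall>s\<in>{0..T}. \<forall>t\<in>{0..T}. (\<integral>\<omega>. X s \<omega> * X t \<omega> \<partial>M) = \<gamma> s t"
    and \<gamma>_int: "set_integrable lborel {0..T} (\<lambda>t. \<gamma> t t)"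
    and H: "is_H_completion T \<gamma> chi"
    and W: "isonormal M W"
    and W_chi: "\<forall>t\<in>{0..T}. AE \<omega> in M. W (chi t) \<omega> = X t \<omega>"
    and h_total: "closure (span (h ` {1..})) = UNIV"
    and h_orth: "\<forall>j\<ge>1. \<forall>k\<ge>1. j \<noteq> k \<longrightarrow>
          (LINT t:{0..T}|lborel. Gam chi (h j) t * Gam chi (h k) t) = 0"
    and lam: "lam = (\<lambda>k. l2norm T (Gam chi (h k)))"
    and lam_pos: "\<forall>k\<ge>1. lam k > 0"
    and n: "n \<ge> 3"
    and u: "\<exists>v. \<forall>t\<in>{0..T}. u t = Gam chi v t"
    and Pu: "Pu = shifted_measure M T chi W u"
    and f: "f = (\<lambda>x. (\<Sum>k=1..n. (x k)\<^sup>2 / (lam k)\<^sup>2) powr ((2 - real n) / 2))"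
    and F: "F = cyl W h f"
    and PiX: "PiX = (\<lambda>t \<omega>. \<Sum>k=1..n. W (h k) \<omega> / (lam k)\<^sup>2 * Gam chi (h k) t)"
  shows "has_malliavin_deriv M T chi W F (cyl_deriv chi W n h f) \<and>
    (AE \<omega> in M. \<forall>t\<in>{0..T}. cyl_deriv chi W n h f t \<omega> / F \<omega>
        = - (real n - 2) * (PiX t \<omega> / (l2norm T (\<lambda>s. PiX s \<omega>))\<^sup>2)) \<and>
    integrable Pu (\<lambda>\<omega>. 1 / (l2norm T (\<lambda>t. PiX t \<omega>))\<^sup>2) \<and>
    (\<forall>DF. has_malliavin_deriv M T chi W F DF \<longrightarrow>
      (AE (t, \<omega>) in restrict_space lborel {0..T} \<Otimes>\<^sub>M M.
        DF t \<omega> / F \<omega> = - (real n - 2) * (PiX t \<omega> / (l2norm T (\<lambda>s. PiX s \<omega>))\<^sup>2)) \<and>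
      integrable (restrict_space lborel {0..T} \<Otimes>\<^sub>M Pu)
        (\<lambda>(t, \<omega>). (X t \<omega> + DF t \<omega> / F \<omega> - u t)\<^sup>2) \<and>
      (\<integral>\<omega>. (l2norm T (\<lambda>t. X t \<omega> + DF t \<omega> / F \<omega> - u t))\<^sup>2 \<partial>Pu)
        = (LINT t:{0..T}|lborel. \<gamma> t t)
          - (real n - 2)\<^sup>2 * (\<integral>\<omega>. 1 / (l2norm T (\<lambda>t. PiX t \<omega>))\<^sup>2 \<partial>Pu))"
proof -
  interpret M: prob_space M by (rule M)
  let ?L = "restrict_space lborel {0..T}"
  have iso: "isonormal_process M W" by (rule isonormal_imp_isonormal_process[OF M W])
  have chi_inner: "chi s \<bullet> chi t = \<gamma> s t" if "s \<in> {0..T}" "t \<in> {0..T}" for s t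
    using H that unfolding is_H_completion_def by blast
  have chi_total: "closure (span (chi ` {0..T})) = UNIV"
    using H unfolding is_H_completion_def by blast
  have set_int: "(LINT t:{0..T}|lborel. g t) = (\<integral>t. g t \<partial>?L)" for g :: "real \<Rightarrow> real"
    by (simp add: set_lebesgue_integral_def integral_restrict_space)
  have norm_chi: "(norm (chi t))\<^sup>2 = \<gamma> t t" if "t \<in> {0..T}" for t
    using chi_inner[OF that that] by (simp add: power2_norm_eq_inner)
  have spL: "space ?L = {0..T}" by (simp add: space_restrict_space)
  interpret S: orthogonal_gaussian_system M W T X chi h lam n
  proof (rule orthogonal_gaussian_system.intro[OF isonormal_path_process.intro[OF iso]])
    show "isonormal_path_process_axioms M W T X chi"
    proof
      show "T > 0" by (rule T)
      show "sets M = sigma_sets (space M) (\<Union>t\<in>{0..T}. {X t -` A \<inter> space M | A. A \<in> sets borel})"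
        by (rule sigma_X)
      show "X t \<in> borel_measurable M" if "t \<in> {0..T}" for t
      proof -
        have "centered_normal M (\<lambda>\<omega>. \<Sum>i\<in>{t}. 1 * X i \<omega>)"
          using X_gauss[unfolded centered_gaussian_family_def, rule_format, of "{t}" "\<lambda>_. 1"] that by simp
        then show ?thesis by (simp add: centered_normal_def)
      qed
      show "case_prod X \<in> borel_measurable (?L \<Otimes>\<^sub>M M)" by (rule X_meas)
      have "integrable ?L (\<lambda>t. \<gamma> t t)"
        using \<gamma>_int by (simp add: set_integrable_def integrable_restrict_space)
      also have "?this \<longleftrightarrow> integrable ?L (\<lambda>t. (norm (chi t))\<^sup>2)"
        by (rule Bochner_Integration.integrable_cong[OF refl]) (simp add: norm_chi spL)
      finally show "integrable ?L (\<lambda>t. (norm (chi t))\<^sup>2)" .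
      show "AE \<omega> in M. W (chi t) \<omega> = X t \<omega>" if "t \<in> {0..T}" for t
        using W_chi that by blast
    qed
    show "orthogonal_gaussian_system_axioms T chi h lam n"
    proof
      show "(\<integral>t. Gam chi (h j) t * Gam chi (h k) t \<partial>?L) = 0" if "j \<in> {1..n}" "k \<in> {1..n}" "j \<noteq> k" for j k
        using h_orth that by (simp add: set_int)
      show "lam = (\<lambda>k. l2norm T (Gam chi (h k)))" by (rule lam)
      show "lam k > 0" if "k \<in> {1..n}" for k using lam_pos that by simp
      show "n \<ge> 3" by (rule n)
    qed
  qed
  \<comment> \<open>the drift is \<open>\<Gamma> v\<close>, and totality of the \<open>chi t\<close> identifies \<open>v\<close> as the vector defining the density\<close>
  obtain v where v: "\<And>t. t \<in> {0..T} \<Longrightarrow> u t = Gam chi v t" using u by blast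
  have Gam_inv: "Gam_inv T chi u = v"
    unfolding Gam_inv_def
  proof (rule the_equality)
    show "\<forall>t\<in>{0..T}. Gam chi v t = u t" using v by simp
    fix v' assume v': "\<forall>t\<in>{0..T}. Gam chi v' t = u t"
    have "chi ` {0..T} \<subseteq> {x. x \<bullet> (v' - v) = 0}"
      using v v' by (auto simp: Gam_def inner_diff_right)
    then have "span (chi ` {0..T}) \<subseteq> {x. x \<bullet> (v' - v) = 0}"
      by (rule span_minimal) (auto simp: subspace_def inner_add_left)
    then have "closure (span (chi ` {0..T})) \<subseteq> {x. x \<bullet> (v' - v) = 0}"
      by (rule closure_minimal) (intro closed_Collect_eq continuous_intros)
    then have "(v' - v) \<bullet> (v' - v) = 0" unfolding chi_total by blast
    then show "v' = v" by simp
  qed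
  have PuU: "Pu = density M (\<lambda>\<omega>. ennreal (exp (W v \<omega> - (norm v)\<^sup>2 / 2)))"
    unfolding Pu shifted_measure_def Gam_inv ..
  have f0: "f = S.f_reg 0" unfolding f by (simp add: fun_eq_iff S.f_reg_def S.q_def S.\<alpha>_def)
  have PiX': "PiX t \<omega> = S.proj (\<lambda>k. W (h k) \<omega>) t" for t \<omega> by (simp add: PiX S.proj_def)
  have l2PiX: "(l2norm T (\<lambda>t. PiX t \<omega>))\<^sup>2 = S.q (\<lambda>k. W (h k) \<omega>)" for \<omega>
    unfolding PiX' S.l2norm_L by (simp add: S.integral_proj_square S.q_nonneg)
  have mall: "has_malliavin_deriv M T chi W F (cyl_deriv chi W n h f)"
    unfolding F f0 by (rule S.has_malliavin_deriv_F)
  have log_deriv: "AE \<omega> in M. \<forall>t\<in>{0..T}. cyl_deriv chi W n h f t \<omega> / F \<omega>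
        = - (real n - 2) * (PiX t \<omega> / (l2norm T (\<lambda>s. PiX s \<omega>))\<^sup>2)"
    using S.AE_q_pos
  proof eventually_elim
    case (elim \<omega>)
    then show ?case unfolding l2PiX unfolding PiX' F f0 using S.log_deriv_F by blast
  qed
  note risk = S.stein_risk[of v, folded PuU]
  have int_inv: "integrable Pu (\<lambda>\<omega>. 1 / (l2norm T (\<lambda>t. PiX t \<omega>))\<^sup>2)"
    unfolding l2PiX by (rule risk(1))
  interpret P: pair_sigma_finite ?L M by (rule S.pair_L_M)
  have "isonormal_process Pu (\<lambda>g \<omega>. W g \<omega> - g \<bullet> v)"
    unfolding PuU by (rule S.cameron_martin)
  then interpret U: prob_space Pu by (rule isonormal_process.axioms)
  interpret PU: pair_sigma_finite ?L Pu
    unfolding pair_sigma_finite_def using P.M1.sigma_finite_measure_axioms U.sigma_finite_measure_axioms by simp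
  have sU: "sets Pu = sets M" by (simp add: PuU)
  have sLU: "sets (?L \<Otimes>\<^sub>M Pu) = sets (?L \<Otimes>\<^sub>M M)" by (intro sets_pair_measure_cong refl sU)
  have aeU: "AE \<omega> in M. R \<omega> \<Longrightarrow> AE \<omega> in Pu. R \<omega>" for R
    unfolding PuU by (subst AE_density) auto
  have main: "(AE (t, \<omega>) in ?L \<Otimes>\<^sub>M M.
        DF t \<omega> / F \<omega> = - (real n - 2) * (PiX t \<omega> / (l2norm T (\<lambda>s. PiX s \<omega>))\<^sup>2)) \<and>
      integrable (?L \<Otimes>\<^sub>M Pu) (\<lambda>(t, \<omega>). (X t \<omega> + DF t \<omega> / F \<omega> - u t)\<^sup>2) \<and>
      (\<integral>\<omega>. (l2norm T (\<lambda>t. X t \<omega> + DF t \<omega> / F \<omega> - u t))\<^sup>2 \<partial>Pu)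
        = (LINT t:{0..T}|lborel. \<gamma> t t)
          - (real n - 2)\<^sup>2 * (\<integral>\<omega>. 1 / (l2norm T (\<lambda>t. PiX t \<omega>))\<^sup>2 \<partial>Pu)"
    if DF: "has_malliavin_deriv M T chi W F DF" for DF
  proof -
    have mDF[measurable]: "case_prod DF \<in> borel_measurable (?L \<Otimes>\<^sub>M M)"
      and mF[measurable]: "F \<in> borel_measurable M"
      using DF by (auto simp: has_malliavin_deriv_def)
    have mDF'[measurable]: "(\<lambda>p. DF (fst p) (snd p)) \<in> borel_measurable (?L \<Otimes>\<^sub>M M)"
      using mDF by (simp add: case_prod_unfold)
    have mX[measurable]: "(\<lambda>p. X (fst p) (snd p)) \<in> borel_measurable (?L \<Otimes>\<^sub>M M)"
      using X_meas by (simp add: case_prod_unfold)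
    have mq[measurable]: "(\<lambda>p. S.q (\<lambda>k. W (h k) (snd p))) \<in> borel_measurable (?L \<Otimes>\<^sub>M M)"
      by (rule measurable_compose[OF measurable_snd S.qY_measurable])
    have mproj[measurable]: "(\<lambda>p. S.proj (\<lambda>k. W (h k) (snd p)) (fst p)) \<in> borel_measurable (?L \<Otimes>\<^sub>M M)"
      unfolding S.proj_def by measurable
    let ?eq = "\<lambda>p. DF (fst p) (snd p) / F (snd p) = - (real n - 2) * (S.proj (\<lambda>k. W (h k) (snd p)) (fst p) / S.q (\<lambda>k. W (h k) (snd p)))"
    have pred_eq: "{p \<in> space (?L \<Otimes>\<^sub>M M). ?eq p} \<in> sets (?L \<Otimes>\<^sub>M M)" by measurable
    have "AE p in ?L \<Otimes>\<^sub>M M. (case p of (t, \<omega>) \<Rightarrow> DF t \<omega> = cyl_deriv chi W n h f t \<omega>)"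
      by (rule S.malliavin_deriv_unique[OF DF mall])
    moreover have "AE p in ?L \<Otimes>\<^sub>M M. S.q (\<lambda>k. W (h k) (snd p)) > 0"
      by (rule P.AE_pair_snd[OF S.AE_q_pos]) measurable
    ultimately have ae: "AE p in ?L \<Otimes>\<^sub>M M. ?eq p"
    proof eventually_elim
      case (elim p)
      then show ?case using S.log_deriv_F[of "snd p" "fst p"] by (simp add: case_prod_unfold F f0)
    qed
    have "AE t in ?L. AE \<omega> in M. ?eq (t, \<omega>)" by (rule P.AE_pair[OF ae])
    then have "AE t in ?L. AE \<omega> in Pu. ?eq (t, \<omega>)" by eventually_elim (rule aeU)
    then have aePu: "AE p in ?L \<Otimes>\<^sub>M Pu. ?eq p"
      by (intro PU.AE_pair_measure) (use pred_eq in \<open>simp_all only: sLU sets_eq_imp_space_eq[OF sLU]\<close>)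
    have mu[measurable]: "(\<lambda>p. u (fst p)) \<in> borel_measurable (?L \<Otimes>\<^sub>M M)"
    proof -
      have "(\<lambda>p. Gam chi v (fst p)) \<in> borel_measurable (?L \<Otimes>\<^sub>M M)" by measurable
      also have "?this \<longleftrightarrow> ?thesis"
        by (rule measurable_cong) (auto simp: space_pair_measure spL v)
      finally show ?thesis .
    qed
    let ?G = "\<lambda>p. (X (fst p) (snd p) + DF (fst p) (snd p) / F (snd p) - u (fst p))\<^sup>2"
    let ?R = "\<lambda>p. (X (fst p) (snd p) - Gam chi v (fst p) - (real n - 2) * (S.proj (\<lambda>k. W (h k) (snd p)) (fst p) / S.q (\<lambda>k. W (h k) (snd p))))\<^sup>2"
    have mG: "?G \<in> borel_measurable (?L \<Otimes>\<^sub>M Pu)" and mR: "?R \<in> borel_measurable (?L \<Otimes>\<^sub>M Pu)"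
      unfolding measurable_cong_sets[OF sLU refl] by measurable
    have GR: "AE p in ?L \<Otimes>\<^sub>M Pu. ?G p = ?R p"
      using aePu AE_space
    proof eventually_elim
      case (elim p)
      then have "u (fst p) = Gam chi v (fst p)" by (auto simp: space_pair_measure spL v)
      moreover have "(x + - a * z - w)\<^sup>2 = (x - w - a * z)\<^sup>2" for x a z w :: real
        by (rule arg_cong[where f="\<lambda>y. y\<^sup>2"]) simp
      ultimately show ?case unfolding elim(1) by (simp only:)
    qed
    have iR: "integrable (?L \<Otimes>\<^sub>M Pu) ?R" using risk(2) by (simp add: case_prod_unfold)
    have iG: "integrable (?L \<Otimes>\<^sub>M Pu) ?G"
      using iR integrable_cong_AE[OF mG mR GR] by blast
    have "(\<integral>\<omega>. (l2norm T (\<lambda>t. X t \<omega> + DF t \<omega> / F \<omega> - u t))\<^sup>2 \<partial>Pu) = (\<integral>\<omega>. (\<integral>t. ?G (t, \<omega>) \<partial>?L) \<partial>Pu)"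
      by (intro Bochner_Integration.integral_cong refl) (simp add: S.l2norm_L)
    also have "\<dots> = (\<integral>p. ?G p \<partial>(?L \<Otimes>\<^sub>M Pu))"
      using PU.integral_snd[of "\<lambda>t \<omega>. ?G (t, \<omega>)"] iG by (simp add: case_prod_unfold)
    also have "\<dots> = (\<integral>p. ?R p \<partial>(?L \<Otimes>\<^sub>M Pu))" by (rule integral_cong_AE[OF mG mR GR])
    also have "\<dots> = (\<integral>t. (norm (chi t))\<^sup>2 \<partial>?L) - (real n - 2)\<^sup>2 * (\<integral>\<omega>. 1 / S.q (\<lambda>k. W (h k) \<omega>) \<partial>Pu)"
      using risk(3) by (simp add: case_prod_unfold)
    also have "(\<integral>t. (norm (chi t))\<^sup>2 \<partial>?L) = (LINT t:{0..T}|lborel. \<gamma> t t)"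
      unfolding set_int by (rule Bochner_Integration.integral_cong[OF refl]) (simp add: norm_chi spL)
    finally have value_eq: "(\<integral>\<omega>. (l2norm T (\<lambda>t. X t \<omega> + DF t \<omega> / F \<omega> - u t))\<^sup>2 \<partial>Pu)
        = (LINT t:{0..T}|lborel. \<gamma> t t) - (real n - 2)\<^sup>2 * (\<integral>\<omega>. 1 / (l2norm T (\<lambda>t. PiX t \<omega>))\<^sup>2 \<partial>Pu)"
      unfolding l2PiX .
    show ?thesis
    proof (intro conjI value_eq)
      show "AE (t, \<omega>) in ?L \<Otimes>\<^sub>M M. DF t \<omega> / F \<omega> = - (real n - 2) * (PiX t \<omega> / (l2norm T (\<lambda>s. PiX s \<omega>))\<^sup>2)"
        using ae unfolding l2PiX unfolding PiX' by (simp add: case_prod_unfold)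
      show "integrable (?L \<Otimes>\<^sub>M Pu) (\<lambda>(t, \<omega>). (X t \<omega> + DF t \<omega> / F \<omega> - u t)\<^sup>2)"
        using iG by (simp add: case_prod_unfold)
    qed
  qed
  show ?thesis using mall log_deriv int_inv main by blast
qed

end
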